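(* Let $d\ge 1$ be an integer, $\alpha\in(1,2)$, $q=\frac{\alpha-1}{d}$, $M>0$ and $b\in\mathbb{R}^d$. Let $u_M(t,x)$ be the solution of $$u_t-\Delta^{\alpha/2}u+b\cdot\nabla\left(u|u|^q\right)=0,\quad t>0,\ x\in\mathbb{R}^d,\qquad u(0,x)=M\delta_0(x).$$ There exists a constant $C=C(d,\alpha,M,b)$ such that $$C^{-1}p(t,x)\le u_M(t,x)\le C\,p(t,x)\qquad\text{for all } t>0,\ x\in\mathbb{R}^d,$$ where $p(t,x)$ is the fundamental solution of $v_t=\Delta^{\alpha/2}v$.
   Context: The fractional Laplacian $\Delta^{\alpha/2}$ is defined by $\widehat{\Delta^{\alpha/2}\phi}(\xi)=-|\xi|^{\alpha}\widehat{\phi}(\xi)$ for $\phi\in C_c^\infty(\mathbb{R}^d)$. The function $p$ is $p(t,x)=(2\pi)^{-d}\int_{\mathbb{R}^d}e^{-ix\cdot\xi}e^{-t|\xi|^\alpha}\,d\xi$ for $t>0$, $x\in\mathbb{R}^d$, and $p(t,x,y):=p(t,y-x)$. The solution $u_M$ is understood in the mild (Duhamel) sense. It is known from earlier literature that this solution exists, is unique and positive, satisfies $u_M(t,\cdot)\in L^p(\mathbb{R}^d)$ for every $p\in[1,\infty]$ and $t>0$, and is self-similar: $u_M(t,x)=a^d u_M(a^\alpha t,ax)$ for all $a>0$ (in particular $u_M(t,x)=t^{-d/\alpha}u_M(1,t^{-1/\alpha}x)$). It satisfies, for all $t>0$ and $x\in\mathbb{R}^d$, $$u_M(t,x)=M\,p(t,x)+\int_0^t\int_{\mathbb{R}^d}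 b\cdot\nabla_z p(t-s,x,z)\,[u_M(s,z)]^{q+1}\,dz\,ds,$$ where the integral is absolutely convergent. These properties of $u_M$ are standing assumptions. *)

theory Defs
  imports "HOL-Analysis.Analysis"
begin

(* The integral is real, because its integrand is conjugated by the reflection of the
   frequency variable; Re only changes the type. *)
definition stable_kernel :: "real \<Rightarrow> real \<Rightarrow> real ^ 'n \<Rightarrow> real" where
  "stable_kernel \<alpha> t x =
     Re ((1 / of_real ((2 * pi) ^ CARD('n))) *
         (LINT \<xi>|lborel. exp (- \<i> * of_real (x \<bullet> \<xi>)) * of_real (exp (- t * norm \<xi> powr \<alpha>))))"

definition stable_kernel2 :: "real \<Rightarrow> real \<Rightarrow> real ^ 'n \<Rightarrow> real ^ 'n \<Rightarrow> real" where
  "stable_kernel2 \<alpha> t x y = stable_kernel \<alpha> t (y - x)"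

definition grad :: "('a::real_inner \<Rightarrow> real) \<Rightarrow> 'a \<Rightarrow> 'a" where
  "grad f z = (THE D. GDERIV f z :> D)"

definition duhamel_integrand ::
  "real \<Rightarrow> real \<Rightarrow> real ^ 'n \<Rightarrow> (real \<Rightarrow> real ^ 'n \<Rightarrow> real) \<Rightarrow> real \<Rightarrow> real ^ 'n \<Rightarrow> real \<Rightarrow> real ^ 'n \<Rightarrow> real" where
  "duhamel_integrand \<alpha> q b u t x s z =
     (b \<bullet> grad (\<lambda>y. stable_kernel2 \<alpha> (t - s) x y) z) * (u s z * \<bar>u s z\<bar> powr q)"

(* Mild form of u_t - Delta^(alpha/2) u + b . grad (u |u|^q) = 0, u(0) = M delta_0. The plus
   sign in front of the integral comes from integrating by parts in z. For positive u the
   nonlinearity is u^(q+1). Only the values of u at positive times matter. *)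
definition mild_solution ::
  "real \<Rightarrow> real \<Rightarrow> real ^ 'n \<Rightarrow> real \<Rightarrow> (real \<Rightarrow> real ^ 'n \<Rightarrow> real) \<Rightarrow> bool" where
  "mild_solution \<alpha> q b M u \<longleftrightarrow>
     (\<forall>t>0. \<forall>x.
        set_integrable (lborel \<Otimes>\<^sub>M lborel) ({0<..<t} \<times> UNIV)
          (\<lambda>(s, z). duhamel_integrand \<alpha> q b u t x s z) \<and>
        u t x = M * stable_kernel \<alpha> t x +
          (LINT s:{0<..<t}|lborel. (LINT z|lborel. duhamel_integrand \<alpha> q b u t x s z)))"

definition in_all_Lp :: "(real ^ 'n \<Rightarrow> real) \<Rightarrow> bool" where
  "in_all_Lp f \<longleftrightarrow>
     f \<in> borel_measurable lborel \<and>
     (\<forall>r\<ge>1. integrable lborel (\<lambda>x. \<bar>f x\<bar> powr r)) \<and>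
     (\<exists>K. AE x in lborel. \<bar>f x\<bar> \<le> K)"

definition self_similar :: "real \<Rightarrow> (real \<Rightarrow> real ^ 'n \<Rightarrow> real) \<Rightarrow> bool" where
  "self_similar \<alpha> u \<longleftrightarrow>
     (\<forall>a>0. \<forall>t>0. \<forall>x. u t x = a ^ CARD('n) * u (a powr \<alpha> * t) (a *\<^sub>R x))"

(* The class in which the solution u_M with initial datum M delta_0 is known to exist and to
   be unique. *)
definition source_solution ::
  "real \<Rightarrow> real \<Rightarrow> real ^ 'n \<Rightarrow> real \<Rightarrow> (real \<Rightarrow> real ^ 'n \<Rightarrow> real) \<Rightarrow> bool" where
  "source_solution \<alpha> q b M u \<longleftrightarrow>
     mild_solution \<alpha> q b M u \<and>
     (\<forall>t>0. \<forall>x. 0 < u t x) \<and>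
     (\<forall>t>0. in_all_Lp (u t)) \<and>
     self_similar \<alpha> u"

end

theory Submission
  imports Defs "HOL-Probability.Probability" "HOL-Real_Asymp.Real_Asymp"
begin

text \<open>
  By self-similarity, everything is decided at time 1: write \<open>U = u 1\<close>. The goal is to trap both
  the kernel \<open>p(1, x)\<close> and \<open>U x\<close> between multiples of \<open>w x = (max 1 \<bar>x\<bar>) powr - (d + \<alpha>)\<close>
  (\<open>tail_weight\<close>).

  The kernel. The function \<open>exp (- (\<lambda> powr (\<alpha>/2)))\<close> is a limit of nonnegative combinations of
  exponentials \<open>exp (- s * \<lambda>)\<close>. Hence every linear inequality between integrals over frequencies and
  point values that holds for the Gaussians \<open>exp (- s * \<bar>\<xi>\<bar>\<^sup>2)\<close>, for all \<open>s > 0\<close>, also holds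
  for \<open>exp (- (\<bar>\<xi>\<bar> powr \<alpha>))\<close> (\<open>stable_mixture_positivity\<close>). This replaces the stable
  subordinator. The Gaussian Fourier transform is explicit, and so the size of the kernel is read off
  from elementary one-variable inequalities. For example, a Gaussian kernel with variance parameter
  \<open>s\<close> is at most \<open>C * r powr - d * (1 - exp (- s / r\<^sup>2))\<close> at distance \<open>r\<close>, and the right-hand side
  becomes \<open>C * r powr - d * (1 - exp (- (r powr - \<alpha>)))\<close>, of order \<open>r powr - (d + \<alpha>)\<close>. In
  this way the kernel is comparable with \<open>w\<close>, and its gradient is \<open>O(w x / \<bar>x\<bar>)\<close>: one power better.

  The solution. After the substitution \<open>z = s powr (1/\<alpha>) * y\<close> the Duhamel term at time 1 is bounded by
  \<open>\<integral> H x y * U y powr (1 + q) dy\<close>, where \<open>H\<close> (\<open>duhamel_weight\<close>) is an explicit kernel that maps \<open>w\<close> to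
  at most a multiple of \<open>w\<close>, has bounded integrals in \<open>x\<close>, and is \<open>O(w x / \<bar>x\<bar>)\<close> if \<open>y\<close> stays
  bounded and \<open>x\<close> is large. The nonlinearity is critical, so \<open>U powr q\<close> offers no smallness near
  the origin; but \<open>U\<close> vanishes at infinity, and hence \<open>U powr q\<close> is small outside a large ball. The
  part of the integral over that ball is \<open>O(w)\<close> by the third property, which gives the linear
  inequality \<open>U \<le> A1 * w + \<epsilon> * H U\<close> with small \<open>\<epsilon>\<close>. As \<open>H\<close> preserves \<open>w\<close> up to a constant, the excess
  \<open>V = max 0 (U - A * w)\<close> satisfies \<open>V \<le> \<epsilon> * H V\<close>, and integration in \<open>x\<close> forces
  \<open>V = 0\<close> (\<open>upper_tail_bound\<close>).

  For the lower bound, the same splitting together with \<open>U \<le> A * w\<close> shows that the Duhamel term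
  is \<open>o(w)\<close> at infinity: the ball contributes \<open>O(w x / \<bar>x\<bar>)\<close> because of the gain in the gradient, and
  the rest \<open>\<epsilon> * w\<close>. So \<open>M * p(1, x)\<close> dominates for large \<open>x\<close>. On the remaining compact set \<open>U\<close> is
  positive and continuous, hence bounded below (\<open>lower_tail_bound\<close>).

  The constant may depend on the solution in this argument; it serves for all solutions because there
  is at most one.
\<close>

section \<open>Fourier transform of Gaussians\<close>

lemma nn_integral_lborel_scale:
  fixes f :: "'a::euclidean_space \<Rightarrow> ennreal"
  assumes [measurable]: "f \<in> borel_measurable borel" and c: "c > 0"
  shows "(\<integral>\<^sup>+x. f x \<partial>lborel) = ennreal (c ^ DIM('a)) * (\<integral>\<^sup>+x. f (t + c *\<^sub>R x) \<partial>lborel)"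
  by (subst lborel_affine[of c t]) (use c in \<open>simp_all add: nn_integral_density nn_integral_distr nn_integral_cmult\<close>)

lemma integral_lborel_scale:
  fixes f :: "'a::euclidean_space \<Rightarrow> real"
  assumes [measurable]: "f \<in> borel_measurable borel" and c: "c > 0"
  shows "(LINT x|lborel. f x) = c ^ DIM('a) * (LINT x|lborel. f (c *\<^sub>R x))"
  by (subst lborel_affine[of c 0]) (use c in \<open>simp_all add: integral_density integral_distr\<close>)

text \<open>Lebesgue measure is the image of a product measure under \<open>f \<mapsto> (\<Sum>b\<in>Basis. f b *\<^sub>R b)\<close>, so
  Fubini for finite products carries over.\<close>

lemma integral_lborel_prod:
  fixes f :: "'a::euclidean_space \<Rightarrow> real \<Rightarrow> complex"
  assumes int: "\<And>b. b \<in> Basis \<Longrightarrow> integrable lborel (f b)"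
  shows "integrable lborel (\<lambda>x. \<Prod>b\<in>Basis. f b (x \<bullet> b))"
    and "(LINT x|lborel. (\<Prod>b\<in>Basis. f b (x \<bullet> b))) = (\<Prod>b\<in>Basis. (LINT x|lborel. f b x))"
proof -
  interpret product_sigma_finite "\<lambda>_::'a. lborel :: real measure"
    by standard
  have [measurable]: "f b \<in> borel_measurable borel" if "b \<in> Basis" for b
    using int[OF that] by auto
  have d: "lborel = distr (\<Pi>\<^sub>M b\<in>Basis. lborel) borel (\<lambda>f. \<Sum>b\<in>Basis. f b *\<^sub>R (b::'a))"
    unfolding lborel_eq_real by (rule lborel_def)
  have m: "(\<lambda>f. \<Sum>b\<in>Basis. f b *\<^sub>R (b::'a)) \<in> (\<Pi>\<^sub>M b\<in>Basis. lborel) \<rightarrow>\<^sub>M borel"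
    by measurable
  have eq: "(\<Prod>b\<in>Basis. f b ((\<Sum>b\<in>Basis. g b *\<^sub>R (b::'a)) \<bullet> b)) = (\<Prod>b\<in>Basis. f b (g b))" for g
    by (intro prod.cong) auto
  have m2: "(\<lambda>x. \<Prod>b\<in>Basis. f b (x \<bullet> b)) \<in> borel_measurable borel"
    by measurable
  show "integrable lborel (\<lambda>x. \<Prod>b\<in>Basis. f b (x \<bullet> b))"
    unfolding d by (subst integrable_distr_eq[OF m m2], unfold eq)
      (rule product_integrable_prod, use int in auto)
  show "(LINT x|lborel. (\<Prod>b\<in>Basis. f b (x \<bullet> b))) = (\<Prod>b\<in>Basis. (LINT x|lborel. f b x))"
    by (subst d, subst integral_distr[OF m m2], unfold eq)
      (rule product_integral_prod, use int in auto)
qed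

lemma gauss_char_1d:
  fixes s x :: real
  assumes s: "s > 0"
  shows "integrable lborel (\<lambda>\<xi>. iexp (x * \<xi>) * of_real (exp (- s * \<xi>\<^sup>2)))"
    and "(LINT \<xi>|lborel. iexp (x * \<xi>) * of_real (exp (- s * \<xi>\<^sup>2)))
          = of_real (sqrt (pi / s) * exp (- x\<^sup>2 / (4 * s)))"
proof -
  define c where "c = sqrt (2 * s)"
  have c: "c > 0" "c\<^sup>2 = 2 * s" using s by (auto simp: c_def)
  let ?g = "\<lambda>\<xi>. iexp (x / c * \<xi>) * of_real (std_normal_density \<xi>)"
  have 1: "?g (0 + c * \<xi>) = (1 / sqrt (2 * pi)) * (iexp (x * \<xi>) * of_real (exp (- s * \<xi>\<^sup>2)))" for \<xi>
    using c by (simp add: std_normal_density_def power_mult_distrib)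
  have "integrable lborel (\<lambda>\<xi>. std_normal_density \<xi>)"
    by (rule integrable_normal_density) simp
  then have i0: "integrable lborel ?g"
    by (rule Bochner_Integration.integrable_bound) (auto simp: norm_mult)
  have i1: "integrable lborel (\<lambda>\<xi>. ?g (0 + c * \<xi>))"
    by (rule lborel_integrable_real_affine[OF i0]) (use c in simp)
  have "integrable lborel (\<lambda>\<xi>. complex_of_real (sqrt (2 * pi)) * ?g (0 + c * \<xi>))"
    by (rule integrable_mult_right) (rule i1)
  moreover have "complex_of_real (sqrt (2 * pi)) * ?g (0 + c * \<xi>) = iexp (x * \<xi>) * of_real (exp (- s * \<xi>\<^sup>2))" for \<xi>
    unfolding 1 by (simp add: of_real_mult[symmetric] del: of_real_mult)
  ultimately show int: "integrable lborel (\<lambda>\<xi>. iexp (x * \<xi>) * of_real (exp (- s * \<xi>\<^sup>2)))"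
    by (simp only:)
  have "of_real (exp (- (x / c)\<^sup>2 / 2)) = char std_normal_distribution (x / c)"
    by (simp add: char_std_normal_distribution)
  also have "\<dots> = (LINT \<xi>|lborel. ?g \<xi>)"
    unfolding char_def by (subst integral_density) (auto simp: scaleR_conv_of_real mult.commute)
  also have "\<dots> = c *\<^sub>R (LINT \<xi>|lborel. ?g (0 + c * \<xi>))"
    by (subst lborel_integral_real_affine[where c=c and t=0]) (use c in auto)
  also have "\<dots> = of_real (c / sqrt (2 * pi)) * (LINT \<xi>|lborel. iexp (x * \<xi>) * of_real (exp (- s * \<xi>\<^sup>2)))"
    unfolding 1 by (simp add: scaleR_conv_of_real)
  finally have e: "of_real (exp (- (x / c)\<^sup>2 / 2)) = of_real (c / sqrt (2 * pi)) * (LINT \<xi>|lborel. iexp (x * \<xi>) * of_real (exp (- s * \<xi>\<^sup>2)))" .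
  have "sqrt (pi / s) = sqrt (2 * pi) / c"
    unfolding c_def by (subst real_sqrt_divide[symmetric]) (use s in \<open>simp add: field_simps\<close>)
  moreover have "- (x / c)\<^sup>2 / 2 = - x\<^sup>2 / (4 * s)"
    using c s by (simp add: power_divide)
  ultimately have "of_real (sqrt (pi / s) * exp (- x\<^sup>2 / (4 * s)))
     = of_real (sqrt (2 * pi) / c) * complex_of_real (exp (- (x / c)\<^sup>2 / 2))"
    by simp
  also have "\<dots> = (LINT \<xi>|lborel. iexp (x * \<xi>) * of_real (exp (- s * \<xi>\<^sup>2)))"
    unfolding e using c by (simp add: field_simps)
  finally show "(LINT \<xi>|lborel. iexp (x * \<xi>) * of_real (exp (- s * \<xi>\<^sup>2)))
          = of_real (sqrt (pi / s) * exp (- x\<^sup>2 / (4 * s)))" by simp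
qed

text \<open>The complex integrand \<open>exp (i x \<bullet> \<xi> - s \<bar>\<xi>\<bar>\<^sup>2)\<close> is a product over the coordinates; the
  cosine is taken only after the factors have been integrated.\<close>

lemma gauss_fourier:
  fixes x :: "'a::euclidean_space"
  assumes s: "s > 0"
  shows "integrable lborel (\<lambda>\<xi>::'a. exp (- s * (norm \<xi>)\<^sup>2))" (is ?A)
    and "(LINT \<xi>|lborel. exp (- s * (norm \<xi>)\<^sup>2) * cos (x \<bullet> \<xi>))
          = (pi / s) powr (DIM('a) / 2) * exp (- (norm x)\<^sup>2 / (4 * s))" (is ?B)
proof -
  have eq: "(\<Prod>b\<in>Basis. iexp ((x \<bullet> b) * (\<xi> \<bullet> b)) * complex_of_real (exp (- s * (\<xi> \<bullet> b)\<^sup>2)))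
      = iexp (x \<bullet> \<xi>) * of_real (exp (- s * (norm \<xi>)\<^sup>2))" for x \<xi> :: 'a
  proof -
    have n: "(norm \<xi>)\<^sup>2 = (\<Sum>b\<in>Basis. (\<xi> \<bullet> b)\<^sup>2)"
      by (subst norm_eq_sqrt_inner, subst euclidean_inner) (simp add: sum_nonneg power2_eq_square)
    have "iexp (x \<bullet> \<xi>) = (\<Prod>b\<in>Basis. iexp ((x \<bullet> b) * (\<xi> \<bullet> b)))"
      by (subst euclidean_inner) (simp add: exp_sum[symmetric] sum_distrib_left)
    moreover have "exp (- s * (norm \<xi>)\<^sup>2) = (\<Prod>b\<in>Basis. exp (- s * (\<xi> \<bullet> b)\<^sup>2))"
      unfolding n by (simp add: exp_sum[symmetric] sum_distrib_left)
    ultimately show ?thesis by (simp add: prod.distrib)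
  qed
  have I: "integrable lborel (\<lambda>\<xi>. iexp (x \<bullet> \<xi>) * complex_of_real (exp (- s * (norm \<xi>)\<^sup>2)))" for x :: 'a
    using integral_lborel_prod(1)[of "\<lambda>b \<xi>. iexp ((x \<bullet> b) * \<xi>) * complex_of_real (exp (- s * \<xi>\<^sup>2))"]
      gauss_char_1d(1)[OF s] unfolding eq by blast
  show ?A
    using integrable_norm[OF I[of 0]] by (simp add: norm_mult)
  have "(LINT \<xi>|lborel. iexp (x \<bullet> \<xi>) * complex_of_real (exp (- s * (norm \<xi>)\<^sup>2)))
    = (\<Prod>b\<in>(Basis::'a set). of_real (sqrt (pi / s) * exp (- (x \<bullet> b)\<^sup>2 / (4 * s))))"
    using integral_lborel_prod(2)[of "\<lambda>b \<xi>. iexp ((x \<bullet> b) * \<xi>) * complex_of_real (exp (- s * \<xi>\<^sup>2))"]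
      gauss_char_1d[OF s] unfolding eq by simp
  also have "\<dots> = of_real ((\<Prod>b\<in>(Basis::'a set). sqrt (pi / s)) * (\<Prod>b\<in>(Basis::'a set).  exp (- (x \<bullet> b)\<^sup>2 / (4 * s))))"
    by (simp add: prod.distrib)
  also have "(\<Prod>b\<in>(Basis::'a set). sqrt (pi / s)) = (pi / s) powr (DIM('a) / 2)"
    using s by (simp add: powr_half_sqrt[symmetric] powr_realpow[symmetric] powr_powr)
  also have "(\<Prod>b\<in>(Basis::'a set).  exp (- (x \<bullet> b)\<^sup>2 / (4 * s))) = exp (- (norm x)\<^sup>2 / (4 * s))"
  proof -
    have n: "(norm x)\<^sup>2 = (\<Sum>b\<in>Basis. (x \<bullet> b)\<^sup>2)"
      by (subst norm_eq_sqrt_inner, subst euclidean_inner) (simp add: sum_nonneg power2_eq_square)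
    show ?thesis unfolding n by (simp add: exp_sum[symmetric] sum_divide_distrib sum_negf)
  qed
  finally have c: "(LINT \<xi>|lborel. iexp (x \<bullet> \<xi>) * complex_of_real (exp (- s * (norm \<xi>)\<^sup>2)))
     = of_real ((pi / s) powr (DIM('a) / 2) * exp (- (norm x)\<^sup>2 / (4 * s)))" .
  have "(LINT \<xi>|lborel. Re (iexp (x \<bullet> \<xi>) * complex_of_real (exp (- s * (norm \<xi>)\<^sup>2))))
     = (pi / s) powr (DIM('a) / 2) * exp (- (norm x)\<^sup>2 / (4 * s))"
    unfolding integral_Re[OF I] c by simp
  then show ?B by (simp add: Re_exp mult.commute)
qed

section \<open>Stable exponentials as mixtures of exponentials\<close>

text \<open>For \<open>0 < \<beta> < 1\<close> all binomial coefficients of \<open>(1 - z) powr \<beta>\<close> except the constant one are negative.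
  The endpoint \<open>z = 1\<close>, which is frequency zero below, lies outside the open disc of the binomial
  series and follows from monotone convergence of the nonnegative terms.\<close>

lemma one_minus_powr_expansion:
  fixes \<beta> :: real
  assumes \<beta>: "0 < \<beta>" "\<beta> < 1"
  obtains c :: "nat \<Rightarrow> real" where "\<And>j. 0 \<le> c j"
    and "\<And>z. 0 \<le> z \<Longrightarrow> z \<le> 1 \<Longrightarrow> (\<lambda>j. c j * z ^ j) sums (1 - (1 - z) powr \<beta>)"
proof -
  define c where "c j = (if j = 0 then 0 else - ((\<beta> gchoose j) * (- 1) ^ j))" for j :: nat
  have c0: "0 \<le> c j" for j
  proof (cases j)
    case 0
    then show ?thesis by (simp add: c_def)
  next
    case (Suc i)
    have "(\<beta> gchoose j) * (- 1) ^ j = pochhammer (- \<beta>) j / fact j"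
      using power_mult_distrib[of "-1" "-1::real" j] by (simp add: gbinomial_pochhammer)
    also have "\<dots> = (- \<beta>) * pochhammer (1 - \<beta>) i / fact j"
      unfolding Suc pochhammer_rec by simp
    also have "\<dots> \<le> 0"
      using \<beta> by (intro divide_nonpos_pos mult_nonpos_nonneg pochhammer_nonneg) auto
    finally show ?thesis by (simp add: c_def Suc)
  qed
  have lt1: "(\<lambda>j. c j * z ^ j) sums (1 - (1 - z) powr \<beta>)" if z: "0 \<le> z" "z < 1" for z
  proof -
    have "(\<lambda>j. (\<beta> gchoose j) * (- z) ^ j) sums (1 + - z) powr \<beta>"
      by (rule gen_binomial_real) (use z in auto)
    from sums_diff[OF sums_single[of 0 "\<lambda>_. 1"] this]
    have "(\<lambda>j. (if j = 0 then 1 else 0) - (\<beta> gchoose j) * (- z) ^ j) sums (1 - (1 - z) powr \<beta>)"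
      by simp
    moreover have "(if j = 0 then 1 else 0) - (\<beta> gchoose j) * (- z) ^ j = c j * z ^ j" for j
      by (auto simp: c_def power_minus[of z])
    ultimately show ?thesis by simp
  qed
  have le1: "sum c {..<J} \<le> 1" for J
  proof (rule tendsto_le[OF _ tendsto_const])
    show "((\<lambda>z. \<Sum>j<J. c j * z ^ j) \<longlongrightarrow> sum c {..<J}) (at_left 1)"
      by (auto intro!: tendsto_eq_intros sum.cong)
    show "\<forall>\<^sub>F z in at_left 1. (\<Sum>j<J. c j * z ^ j) \<le> 1"
      using eventually_at_left_real[of 0 "1::real"]
    proof (rule eventually_mono)
      fix z :: real assume z: "z \<in> {0<..<1}"
      have "(\<Sum>j<J. c j * z ^ j) \<le> 1 - (1 - z) powr \<beta>"
        using lt1[of z] z c0 sum_le_suminf[of "\<lambda>j. c j * z ^ j" "{..<J}"] by (auto simp: sums_iff)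
      then show "(\<Sum>j<J. c j * z ^ j) \<le> 1" by (smt (verit) powr_ge_zero)
    qed simp
  qed simp
  have sm: "summable c"
    by (rule summableI_nonneg_bounded[of _ 1]) (use c0 le1 in \<open>auto simp: atLeast0LessThan\<close>)
  have "suminf c \<le> 1"
    by (rule suminf_le_const[OF sm le1])
  moreover have "1 \<le> suminf c"
  proof (rule tendsto_le[OF _ tendsto_const])
    have "((\<lambda>z. 1 - (1 - z) powr \<beta>) \<longlongrightarrow> 1 - 0) (at_left (1::real))"
    proof (intro tendsto_intros)
      show "((\<lambda>z. (1 - z) powr \<beta>) \<longlongrightarrow> 0) (at_left (1::real))"
        using \<beta> by (intro tendsto_zero_powrI[where b=\<beta>] tendsto_eq_intros)
          (auto simp: eventually_at_left_field intro!: exI[of _ 0])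
    qed
    then show "((\<lambda>z. 1 - (1 - z) powr \<beta>) \<longlongrightarrow> 1) (at_left (1::real))" by simp
    show "\<forall>\<^sub>F z in at_left 1. 1 - (1 - z) powr \<beta> \<le> suminf c"
      using eventually_at_left_real[of 0 "1::real"]
    proof (rule eventually_mono)
      fix z :: real assume z: "z \<in> {0<..<1}"
      then have "c n * z ^ n \<le> c n" for n
        by (intro mult_left_le power_le_one c0) auto
      then show "1 - (1 - z) powr \<beta> \<le> suminf c"
        using lt1[of z] sm suminf_le[of "\<lambda>j. c j * z ^ j" c] z by (auto simp: sums_iff)
    qed simp
  qed simp
  ultimately have "c sums 1" using sm by (simp add: sums_iff)
  show ?thesis
  proof (rule that[OF c0])
    fix z :: real assume z: "0 \<le> z" "z \<le> 1"
    show "(\<lambda>j. c j * z ^ j) sums (1 - (1 - z) powr \<beta>)"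
      using lt1[of z] z \<open>c sums 1\<close> by (cases "z = 1") auto
  qed
qed

text \<open>The class of functions \<open>\<phi>\<close> for which the functional is nonnegative at \<open>\<lambda>v. exp (- s * v) * \<phi> v\<close> for
  all \<open>s > 0\<close> is a convex cone that is closed under multiplication by \<open>exp (- u * v)\<close> and under bounded
  pointwise limits. It contains \<open>exp (- (v powr \<beta>))\<close>, which is the limit as \<open>N \<rightarrow> \<infinity>\<close> of
  \<open>exp (- (N powr \<beta>) * (1 - z) powr \<beta>)\<close> with \<open>z = exp (- v / N)\<close>: by the previous
  lemma, the exponent is \<open>- (N powr \<beta>)\<close> plus a power series in \<open>z\<close> with nonnegative coefficients,
  and so the whole expression is one, too. The additional factor \<open>exp (- s * v)\<close> provides the
  integrability for the limits, and is removed at the end with \<open>s \<rightarrow> 0\<close>.\<close>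

theorem stable_mixture_positivity:
  fixes M :: "'b measure" and l k :: "'b \<Rightarrow> real" and c p :: "nat \<Rightarrow> real"
  assumes \<beta>: "0 < \<beta>" "\<beta> < 1"
    and [measurable]: "l \<in> borel_measurable M" "k \<in> borel_measurable M"
    and l0: "\<And>\<omega>. 0 \<le> l \<omega>" and p0: "\<And>i. 0 \<le> p i"
    and int: "\<And>s. s > 0 \<Longrightarrow> integrable M (\<lambda>\<omega>. exp (- s * l \<omega>) * k \<omega>)"
    and int\<beta>: "integrable M (\<lambda>\<omega>. exp (- (l \<omega> powr \<beta>)) * k \<omega>)"
    and pos: "\<And>s. s > 0 \<Longrightarrow> 0 \<le> (\<integral>\<omega>. exp (- s * l \<omega>) * k \<omega> \<partial>M) + (\<Sum>i<n. c i * exp (- s * p i))"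
  shows "0 \<le> (\<integral>\<omega>. exp (- (l \<omega> powr \<beta>)) * k \<omega> \<partial>M) + (\<Sum>i<n. c i * exp (- (p i powr \<beta>)))"
proof -
  define L where "L \<phi> = (\<integral>\<omega>. \<phi> (l \<omega>) * k \<omega> \<partial>M) + (\<Sum>i<n. c i * \<phi> (p i))" for \<phi> :: "real \<Rightarrow> real"
  have lim: "(\<lambda>n. L (\<lambda>v. exp (- s * v) * \<phi> n v)) \<longlonglongrightarrow> L (\<lambda>v. exp (- s * v) * \<psi> v)"
    if m[measurable]: "\<And>n. \<phi> n \<in> borel_measurable borel" "\<psi> \<in> borel_measurable borel"
      and B: "\<And>n v. v \<ge> 0 \<Longrightarrow> \<bar>\<phi> n v\<bar> \<le> B" and cv: "\<And>v. v \<ge> 0 \<Longrightarrow> (\<lambda>n. \<phi> n v) \<longlonglongrightarrow> \<psi> v"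
      and s: "s > 0" for \<phi> :: "nat \<Rightarrow> real \<Rightarrow> real" and \<psi> B s
    unfolding L_def
  proof (intro tendsto_add tendsto_sum tendsto_mult tendsto_const cv p0)
    show "(\<lambda>n. \<integral>\<omega>. exp (- s * l \<omega>) * \<phi> n (l \<omega>) * k \<omega> \<partial>M) \<longlonglongrightarrow>
        (\<integral>\<omega>. exp (- s * l \<omega>) * \<psi> (l \<omega>) * k \<omega> \<partial>M)"
    proof (rule integral_dominated_convergence[where w="\<lambda>\<omega>. B * \<bar>exp (- s * l \<omega>) * k \<omega>\<bar>"])
      show "integrable M (\<lambda>\<omega>. B * \<bar>exp (- s * l \<omega>) * k \<omega>\<bar>)"
        using int[OF s] by simp
      show "AE \<omega> in M. (\<lambda>n. exp (- s * l \<omega>) * \<phi> n (l \<omega>) * k \<omega>) \<longlonglongrightarrow> exp (- s * l \<omega>) * \<psi> (l \<omega>) * k \<omega>"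
        by (intro AE_I2 tendsto_intros cv l0)
      fix n
      have "\<bar>\<phi> n (l \<omega>)\<bar> * \<bar>exp (- s * l \<omega>) * k \<omega>\<bar> \<le> B * \<bar>exp (- s * l \<omega>) * k \<omega>\<bar>" for \<omega>
        by (intro mult_right_mono B l0) auto
      then show "AE \<omega> in M. norm (exp (- s * l \<omega>) * \<phi> n (l \<omega>) * k \<omega>) \<le> B * \<bar>exp (- s * l \<omega>) * k \<omega>\<bar>"
        by (auto simp: abs_mult mult_ac)
    qed auto
  qed
  define Adm where "Adm \<phi> \<longleftrightarrow> \<phi> \<in> borel_measurable borel \<and> (\<exists>B. \<forall>v\<ge>0. \<bar>\<phi> v\<bar> \<le> B) \<and>
      (\<forall>s>0. 0 \<le> L (\<lambda>v. exp (- s * v) * \<phi> v))" for \<phi> :: "real \<Rightarrow> real"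
  have Adm_int: "integrable M (\<lambda>\<omega>. exp (- s * l \<omega>) * \<phi> (l \<omega>) * k \<omega>)" if "Adm \<phi>" "s > 0" for \<phi> s
  proof -
    from that have [measurable]: "\<phi> \<in> borel_measurable borel" by (simp add: Adm_def)
    from that obtain B where B: "\<And>v. v \<ge> 0 \<Longrightarrow> \<bar>\<phi> v\<bar> \<le> B" by (auto simp: Adm_def)
    have "integrable M (\<lambda>\<omega>. B * \<bar>exp (- s * l \<omega>) * k \<omega>\<bar>)"
      using int[OF that(2)] by simp
    moreover have "\<bar>\<phi> (l \<omega>)\<bar> * \<bar>exp (- s * l \<omega>) * k \<omega>\<bar> \<le> B * \<bar>exp (- s * l \<omega>) * k \<omega>\<bar>" for \<omega>
      by (intro mult_right_mono B l0) auto
    then have "norm (exp (- s * l \<omega>) * \<phi> (l \<omega>) * k \<omega>) \<le> norm (B * \<bar>exp (- s * l \<omega>) * k \<omega>\<bar>)" for \<omega>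
      unfolding real_norm_def by - (rule order_trans[OF _ abs_ge_self], simp add: abs_mult mult_ac)
    then have "AE \<omega> in M. norm (exp (- s * l \<omega>) * \<phi> (l \<omega>) * k \<omega>) \<le> norm (B * \<bar>exp (- s * l \<omega>) * k \<omega>\<bar>)"
      by simp
    ultimately show "integrable M (\<lambda>\<omega>. exp (- s * l \<omega>) * \<phi> (l \<omega>) * k \<omega>)"
      using Bochner_Integration.integrable_bound[of M "\<lambda>\<omega>. B * \<bar>exp (- s * l \<omega>) * k \<omega>\<bar>"
          "\<lambda>\<omega>. exp (- s * l \<omega>) * \<phi> (l \<omega>) * k \<omega>"] by simp
  qed
  have Adm_lim: "Adm \<psi>"
    if A: "\<And>n. Adm (\<phi> n)" and m: "\<psi> \<in> borel_measurable borel"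
      and B: "\<And>n v. v \<ge> 0 \<Longrightarrow> \<bar>\<phi> n v\<bar> \<le> B" and cv: "\<And>v. v \<ge> 0 \<Longrightarrow> (\<lambda>n. \<phi> n v) \<longlonglongrightarrow> \<psi> v"
    for \<phi> :: "nat \<Rightarrow> real \<Rightarrow> real" and \<psi> B
    unfolding Adm_def
  proof (intro conjI m exI[of _ B] allI impI)
    fix v :: real assume "v \<ge> 0"
    then show "\<bar>\<psi> v\<bar> \<le> B"
      using B by (intro LIMSEQ_le_const2[OF tendsto_rabs[OF cv]]) auto
  next
    fix s :: real assume s: "s > 0"
    show "0 \<le> L (\<lambda>v. exp (- s * v) * \<psi> v)"
      by (rule LIMSEQ_le_const[OF lim[OF _ m B cv s]]) (use A s in \<open>auto simp: Adm_def\<close>)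
  qed
  have Adm_shift: "Adm (\<lambda>v. exp (- u * v) * \<phi> v)" if A: "Adm \<phi>" and u: "u \<ge> 0" for \<phi> u
    unfolding Adm_def
  proof (intro conjI allI impI)
    show "(\<lambda>v. exp (- u * v) * \<phi> v) \<in> borel_measurable borel" using A by (auto simp: Adm_def)
    from A obtain B where B: "\<And>v. v \<ge> 0 \<Longrightarrow> \<bar>\<phi> v\<bar> \<le> B" by (auto simp: Adm_def)
    show "\<exists>B. \<forall>v\<ge>0. \<bar>exp (- u * v) * \<phi> v\<bar> \<le> B"
    proof (intro exI[of _ B] allI impI)
      fix v :: real assume v: "v \<ge> 0"
      have "\<bar>exp (- u * v) * \<phi> v\<bar> \<le> 1 * B"
        unfolding abs_mult using u v by (intro mult_mono B) auto
      then show "\<bar>exp (- u * v) * \<phi> v\<bar> \<le> B" by simp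
    qed
    fix s :: real assume "s > 0"
    then have "0 \<le> L (\<lambda>v. exp (- (s + u) * v) * \<phi> v)"
      using A u unfolding Adm_def by (metis add_pos_nonneg)
    moreover have "exp (- (s + u) * v) = exp (- s * v) * exp (- u * v)" for v
      by (simp add: exp_add[symmetric] algebra_simps)
    ultimately show "0 \<le> L (\<lambda>v. exp (- s * v) * (exp (- u * v) * \<phi> v))"
      by (simp only: mult.assoc)
  qed
  have Adm_add: "Adm (\<lambda>v. \<phi> v + \<psi> v)" if A: "Adm \<phi>" "Adm \<psi>" for \<phi> \<psi>
    unfolding Adm_def
  proof (intro conjI allI impI)
    show "(\<lambda>v. \<phi> v + \<psi> v) \<in> borel_measurable borel" using A by (auto simp: Adm_def)
    from A obtain B B' where "\<And>v. v \<ge> 0 \<Longrightarrow> \<bar>\<phi> v\<bar> \<le> B" "\<And>v. v \<ge> 0 \<Longrightarrow> \<bar>\<psi> v\<bar> \<le> B'"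
      by (auto simp: Adm_def)
    then show "\<exists>B. \<forall>v\<ge>0. \<bar>\<phi> v + \<psi> v\<bar> \<le> B"
      by (intro exI[of _ "B + B'"]) (smt (verit))
    fix s :: real assume s: "s > 0"
    have "L (\<lambda>v. exp (- s * v) * (\<phi> v + \<psi> v)) = L (\<lambda>v. exp (- s * v) * \<phi> v) + L (\<lambda>v. exp (- s * v) * \<psi> v)"
      unfolding L_def using Bochner_Integration.integral_add[OF Adm_int[OF A(1) s] Adm_int[OF A(2) s]]
      by (simp add: algebra_simps sum.distrib)
    then show "0 \<le> L (\<lambda>v. exp (- s * v) * (\<phi> v + \<psi> v))"
      using A s by (auto simp: Adm_def)
  qed
  have Adm_scale: "Adm (\<lambda>v. r * \<phi> v)" if A: "Adm \<phi>" and r: "r \<ge> 0" for \<phi> r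
    unfolding Adm_def
  proof (intro conjI allI impI)
    show "(\<lambda>v. r * \<phi> v) \<in> borel_measurable borel" using A by (auto simp: Adm_def)
    from A obtain B where "\<And>v. v \<ge> 0 \<Longrightarrow> \<bar>\<phi> v\<bar> \<le> B" by (auto simp: Adm_def)
    then show "\<exists>B. \<forall>v\<ge>0. \<bar>r * \<phi> v\<bar> \<le> B"
      using r by (intro exI[of _ "r * B"]) (auto simp: abs_mult intro!: mult_left_mono)
    fix s :: real assume s: "s > 0"
    have "L (\<lambda>v. exp (- s * v) * (r * \<phi> v)) = r * L (\<lambda>v. exp (- s * v) * \<phi> v)"
      unfolding L_def by (simp add: algebra_simps sum_distrib_left flip: Bochner_Integration.integral_mult_right_zero)
    then show "0 \<le> L (\<lambda>v. exp (- s * v) * (r * \<phi> v))"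
      using A s r by (auto simp: Adm_def)
  qed
  have Adm_one: "Adm (\<lambda>_. 1)"
    using pos by (auto simp: Adm_def L_def)
  have Adm_zero: "Adm (\<lambda>_. 0)"
    using Adm_scale[OF Adm_one, of 0] by simp
  have Adm_sum: "Adm (\<lambda>v. \<Sum>j<m. \<phi> j v)" if "\<And>j. Adm (\<phi> j)" for \<phi> :: "nat \<Rightarrow> real \<Rightarrow> real" and m :: nat
    by (induction m) (auto intro: Adm_zero Adm_add that)
  obtain a where a0: "\<And>j. 0 \<le> a j"
    and a: "\<And>z. 0 \<le> z \<Longrightarrow> z \<le> 1 \<Longrightarrow> (\<lambda>j. a j * z ^ j) sums (1 - (1 - z) powr \<beta>)"
    using one_minus_powr_expansion[OF \<beta>] by blast
  define S where "S J z = (\<Sum>j<J. a j * z ^ j)" for J :: nat and z :: real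
  have S01: "0 \<le> S J z" "S J z \<le> 1" if z: "0 \<le> z" "z \<le> 1" for J z
  proof -
    show "0 \<le> S J z" using a0 z by (auto simp: S_def intro!: sum_nonneg)
    have "S J z \<le> 1 - (1 - z) powr \<beta>"
      unfolding S_def using a[OF z] a0 z sum_le_suminf[of "\<lambda>j. a j * z ^ j" "{..<J}"] by (auto simp: sums_iff)
    then show "S J z \<le> 1" by (smt (verit) powr_ge_zero)
  qed
  define Z where "Z N v = exp (- v / real (Suc N))" for N v
  have Z01: "0 \<le> Z N v" "Z N v \<le> 1" if "v \<ge> 0" for N v using that by (auto simp: Z_def)
  have Adm_S: "Adm (\<lambda>v. S J (Z N v) * \<phi> v)" if "Adm \<phi>" for J N \<phi>
  proof -
    have "Adm (\<lambda>v. \<Sum>j<J. a j * (exp (- (real j / real (Suc N)) * v) * \<phi> v))"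
      by (intro Adm_sum Adm_scale Adm_shift that a0) auto
    also have "(\<lambda>v. \<Sum>j<J. a j * (exp (- (real j / real (Suc N)) * v) * \<phi> v)) = (\<lambda>v. S J (Z N v) * \<phi> v)"
      by (auto simp: S_def Z_def sum_distrib_right sum_distrib_left exp_of_nat_mult[symmetric] algebra_simps intro!: ext sum.cong)
    finally show ?thesis .
  qed
  have Adm_pow: "Adm (\<lambda>v. S J (Z N v) ^ i)" for J N i
    by (induction i) (auto intro: Adm_one Adm_S)
  have Zm[measurable]: "Z N \<in> borel_measurable borel" for N unfolding Z_def by measurable
  have Sm[measurable]: "S J \<in> borel_measurable borel" for J unfolding S_def by measurable
  have Adm_exp: "Adm (\<lambda>v. exp (r * S J (Z N v)))" if r: "r \<ge> 0" for r J N
  proof (rule Adm_lim)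
    show "Adm (\<lambda>v. \<Sum>i<m. r ^ i / fact i * S J (Z N v) ^ i)" for m
      using r by (intro Adm_sum Adm_scale Adm_pow) auto
    show "(\<lambda>v. exp (r * S J (Z N v))) \<in> borel_measurable borel" by measurable
    have e: "(\<lambda>i. r ^ i / fact i * x ^ i) sums exp (r * x)" for x
      using exp_converges[of "r * x"] by (simp add: power_mult_distrib field_simps)
    fix v :: real assume v: "v \<ge> 0"
    note S = S01[OF Z01[OF v]]
    show "(\<lambda>m. \<Sum>i<m. r ^ i / fact i * S J (Z N v) ^ i) \<longlonglongrightarrow> exp (r * S J (Z N v))"
      using e by (simp add: sums_def)
    fix m
    have "(\<Sum>i<m. r ^ i / fact i * S J (Z N v) ^ i) \<le> exp (r * S J (Z N v))"
      using e[of "S J (Z N v)"] r S sum_le_suminf[of "\<lambda>i. r ^ i / fact i * S J (Z N v) ^ i" "{..<m}"]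
      by (auto simp: sums_iff)
    also have "\<dots> \<le> exp r" using S r by (auto intro: mult_left_le)
    finally show "\<bar>\<Sum>i<m. r ^ i / fact i * S J (Z N v) ^ i\<bar> \<le> exp r"
      using S r by (subst abs_of_nonneg) (auto intro!: sum_nonneg)
  qed
  have Adm_exp1: "Adm (\<lambda>v. exp (- r * (1 - Z N v) powr \<beta>))" if r: "r \<ge> 0" for r N
  proof (rule Adm_lim)
    show "Adm (\<lambda>v. exp (- r) * exp (r * S J (Z N v)))" for J
      by (intro Adm_scale Adm_exp r) auto
    show "(\<lambda>v. exp (- r * (1 - Z N v) powr \<beta>)) \<in> borel_measurable borel" by measurable
    fix v :: real assume v: "v \<ge> 0"
    have "(\<lambda>J. exp (- r) * exp (r * S J (Z N v))) \<longlonglongrightarrow> exp (- r) * exp (r * (1 - (1 - Z N v) powr \<beta>))"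
      using a[OF Z01[OF v]] unfolding S_def sums_def by (intro tendsto_intros)
    then show "(\<lambda>J. exp (- r) * exp (r * S J (Z N v))) \<longlonglongrightarrow> exp (- r * (1 - Z N v) powr \<beta>)"
      by (simp add: exp_add[symmetric] algebra_simps)
    fix J
    show "\<bar>exp (- r) * exp (r * S J (Z N v))\<bar> \<le> 1"
      using S01[OF Z01[OF v]] r by (auto simp: exp_add[symmetric] intro: mult_left_le)
  qed
  have fin: "Adm (\<lambda>v. exp (- (v powr \<beta>)))"
  proof (rule Adm_lim[where B = 1])
    show "Adm (\<lambda>v. exp (- (real (Suc N) powr \<beta>) * (1 - Z N v) powr \<beta>))" for N
      by (rule Adm_exp1) auto
    show "(\<lambda>v. exp (- (v powr \<beta>))) \<in> borel_measurable borel" by measurable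
    fix v :: real assume v: "v \<ge> 0"
    have "(\<lambda>N. real (Suc N) * (1 - Z N v)) \<longlonglongrightarrow> v"
      unfolding Z_def by real_asymp
    then have "(\<lambda>N. exp (- ((real (Suc N) * (1 - Z N v)) powr \<beta>))) \<longlonglongrightarrow> exp (- (v powr \<beta>))"
      using \<beta> Z01[OF v]
      by (intro tendsto_intros tendsto_powr') auto
    then show "(\<lambda>N. exp (- (real (Suc N) powr \<beta>) * (1 - Z N v) powr \<beta>)) \<longlonglongrightarrow> exp (- (v powr \<beta>))"
      using Z01[OF v] by (simp add: powr_mult)
  qed auto
  have "(\<lambda>m. L (\<lambda>v. exp (- (1 / real (Suc m)) * v) * exp (- (v powr \<beta>)))) \<longlonglongrightarrow> L (\<lambda>v. exp (- (v powr \<beta>)))"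
    unfolding L_def
  proof (intro tendsto_add tendsto_sum tendsto_mult tendsto_const)
    have t: "(\<lambda>m. exp (- (1 / real (Suc m)) * v) * exp (- (v powr \<beta>))) \<longlonglongrightarrow> exp (- (v powr \<beta>))" for v
      by real_asymp
    show "(\<lambda>m. exp (- (1 / real (Suc m)) * p i) * exp (- (p i powr \<beta>))) \<longlonglongrightarrow> exp (- (p i powr \<beta>))" for i
      by (rule t)
    show "(\<lambda>m. \<integral>\<omega>. exp (- (1 / real (Suc m)) * l \<omega>) * exp (- (l \<omega> powr \<beta>)) * k \<omega> \<partial>M) \<longlonglongrightarrow>
        (\<integral>\<omega>. exp (- (l \<omega> powr \<beta>)) * k \<omega> \<partial>M)"
    proof (rule integral_dominated_convergence[where w="\<lambda>\<omega>. \<bar>exp (- (l \<omega> powr \<beta>)) * k \<omega>\<bar>"])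
      show "AE \<omega> in M. (\<lambda>m. exp (- (1 / real (Suc m)) * l \<omega>) * exp (- (l \<omega> powr \<beta>)) * k \<omega>)
          \<longlonglongrightarrow> exp (- (l \<omega> powr \<beta>)) * k \<omega>"
        by (intro AE_I2 tendsto_mult t tendsto_const)
      fix m
      have "exp (- (1 / real (Suc m)) * l \<omega>) * \<bar>exp (- (l \<omega> powr \<beta>)) * k \<omega>\<bar> \<le> 1 * \<bar>exp (- (l \<omega> powr \<beta>)) * k \<omega>\<bar>" for \<omega>
        by (intro mult_right_mono) (use l0 in auto)
      then show "AE \<omega> in M. norm (exp (- (1 / real (Suc m)) * l \<omega>) * exp (- (l \<omega> powr \<beta>)) * k \<omega>) \<le> \<bar>exp (- (l \<omega> powr \<beta>)) * k \<omega>\<bar>"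
        by (auto simp: abs_mult mult_ac)
    qed (use int\<beta> in auto)
  qed
  then have "0 \<le> L (\<lambda>v. exp (- (v powr \<beta>)))"
  proof (rule LIMSEQ_le_const)
    have "0 \<le> L (\<lambda>v. exp (- (1 / real (Suc m)) * v) * exp (- (v powr \<beta>)))" for m
      by (rule fin[unfolded Adm_def, THEN conjunct2, THEN conjunct2, rule_format]) simp
    then show "\<exists>N. \<forall>m\<ge>N. 0 \<le> L (\<lambda>v. exp (- (1 / real (Suc m)) * v) * exp (- (v powr \<beta>)))"
      by blast
  qed
  then show ?thesis by (simp add: L_def)
qed

section \<open>Power weights and differentiation of cosine integrals\<close>

text \<open>Equivalent to \<open>y / k \<le> exp (y / k)\<close>, raised to the power \<open>k\<close>.\<close>

lemma powr_mult_exp_le: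
  fixes y k :: real
  assumes "k > 0" "y \<ge> 0"
  shows "y powr k * exp (- y) \<le> k powr k"
proof -
  have "y / k \<le> exp (y / k)"
    by (smt (verit) exp_ge_add_one_self)
  then have "y powr k \<le> (k * exp (y / k)) powr k"
    using assms by (intro powr_mono2) (auto simp: field_simps)
  also have "\<dots> = k powr k * exp y"
    using assms by (simp add: powr_mult powr_def[of "exp _"])
  finally show ?thesis by (simp add: exp_minus field_simps)
qed

text \<open>The factor \<open>max 1\<close> (rather than \<open>min 1 (norm x powr - p)\<close>) gives the value 1 at the origin,
  where \<open>0 powr - p = 0\<close>.\<close>

definition tail_weight :: "real \<Rightarrow> 'a::euclidean_space \<Rightarrow> real" where
  "tail_weight \<gamma> x = max 1 (norm x) powr - (real DIM('a) + \<gamma>)"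

lemma tail_weight_measurable [measurable]: "tail_weight \<gamma> \<in> borel_measurable borel"
  unfolding tail_weight_def by measurable

lemma tail_weight_pos: "0 < tail_weight \<gamma> x"
  by (auto simp: tail_weight_def)

lemma tail_weight_nonneg [simp]: "0 \<le> tail_weight \<gamma> x"
  using tail_weight_pos[of \<gamma> x] by simp

lemma integrable_max_powr:
  fixes p :: real
  assumes p: "p > 1"
  shows "(\<integral>\<^sup>+t. ennreal (max 1 \<bar>t\<bar> powr - p) \<partial>lborel) < \<infinity>"
proof -
  have "((\<lambda>t. t powr - p) has_integral -(1 powr (- p + 1)) / (- p + 1)) {1::real..}"
    by (rule has_integral_powr_to_inf) (use p in auto)
  then have I: "(\<integral>\<^sup>+t. indicator {1..} t * t powr - p \<partial>lborel) = ennreal (-(1 powr (- p + 1)) / (- p + 1))"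
    by (intro nn_integral_has_integral_lebesgue) auto
  have I2: "(\<integral>\<^sup>+t. indicator {1..} (- t) * (- t) powr - p \<partial>lborel) = ennreal (-(1 powr (- p + 1)) / (- p + 1))"
    using I by (subst (asm) nn_integral_real_affine[where c="-1" and t=0]) auto
  have "(\<integral>\<^sup>+t. ennreal (max 1 \<bar>t\<bar> powr - p) \<partial>lborel)
      \<le> (\<integral>\<^sup>+t. indicator {-1..1} t + (ennreal (indicator {1..} t * t powr - p) + ennreal (indicator {1..} (- t) * (- t) powr - p)) \<partial>lborel)"
    by (intro nn_integral_mono) (auto simp: max_def abs_if split: split_indicator)
  also have "\<dots> = emeasure lborel {-1..1::real} + (ennreal (-(1 powr (- p + 1)) / (- p + 1)) + ennreal (-(1 powr (- p + 1)) / (- p + 1)))"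
    by (simp add: nn_integral_add I I2)
  also have "\<dots> < \<infinity>" by simp
  finally show ?thesis .
qed

text \<open>With \<open>p = 1 + \<gamma> / d\<close> the weight is a product of \<open>d\<close> equal factors \<open>(max 1 \<bar>x\<bar>) powr - p\<close>, and each of
  them is at most the same expression in one coordinate; as \<open>p > 1\<close>, the product of these is
  integrable.\<close>

lemma integrable_tail_weight:
  assumes \<gamma>: "\<gamma> > 0"
  shows "integrable lborel (tail_weight \<gamma> :: 'a::euclidean_space \<Rightarrow> real)"
proof (rule integrableI_bounded)
  define p where "p = 1 + \<gamma> / DIM('a)"
  have p: "p > 1" using \<gamma> by (simp add: p_def)
  have dp: "real DIM('a) + \<gamma> = p * DIM('a)" by (simp add: p_def field_simps)
  have "tail_weight \<gamma> x \<le> (\<Prod>b\<in>Basis. max 1 \<bar>x \<bullet> b\<bar> powr - p)" for x :: 'a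
  proof -
    have "tail_weight \<gamma> x = (\<Prod>b\<in>(Basis::'a set). max 1 (norm x) powr - p)"
      by (simp add: tail_weight_def dp powr_realpow[symmetric] powr_powr)
    also have "\<dots> \<le> (\<Prod>b\<in>Basis. max 1 \<bar>x \<bullet> b\<bar> powr - p)"
      using p by (intro prod_mono conjI powr_mono2' max.mono Basis_le_norm) auto
    finally show ?thesis .
  qed
  then have "(\<integral>\<^sup>+x. ennreal (norm (tail_weight \<gamma> (x::'a))) \<partial>lborel)
      \<le> (\<integral>\<^sup>+x. (\<Prod>b\<in>(Basis::'a set). ennreal (max 1 \<bar>x \<bullet> b\<bar> powr - p)) \<partial>lborel)"
    by (intro nn_integral_mono) (simp add: prod_ennreal ennreal_leI)
  also have "\<dots> = (\<Prod>b\<in>(Basis::'a set). (\<integral>\<^sup>+t. ennreal (max 1 \<bar>t\<bar> powr - p) \<partial>lborel))"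
    by (rule nn_integral_lborel_prod) auto
  also have "\<dots> < \<infinity>"
    using integrable_max_powr[OF p] by (simp add: power_less_top_ennreal)
  finally show "(\<integral>\<^sup>+x. ennreal (norm (tail_weight \<gamma> (x::'a))) \<partial>lborel) < \<infinity>" .
qed measurable

lemma integrable_stable_moment:
  fixes k :: nat
  assumes \<alpha>: "\<alpha> \<ge> 1"
  shows "integrable lborel (\<lambda>\<xi>::'a::euclidean_space. norm \<xi> ^ k * exp (- (norm \<xi> powr \<alpha>)))"
proof -
  define m where "m = real DIM('a) + 1 + real k"
  have m: "m > 0" by (simp add: m_def)
  have le: "norm \<xi> ^ k * exp (- (norm \<xi> powr \<alpha>)) \<le> exp 1 * m powr m * tail_weight 1 \<xi>" for \<xi> :: 'a
  proof -
    define R where "R = max 1 (norm \<xi>)"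
    have R: "R \<ge> 1" "norm \<xi> \<le> R" by (auto simp: R_def)
    have "norm \<xi> powr \<alpha> \<ge> R - 1"
    proof (cases "norm \<xi> \<ge> 1")
      case True
      then have "norm \<xi> powr 1 \<le> norm \<xi> powr \<alpha>" using \<alpha> by (intro powr_mono) auto
      then show ?thesis using True by (simp add: R_def)
    qed (simp add: R_def)
    then have "norm \<xi> ^ k * exp (- (norm \<xi> powr \<alpha>)) \<le> R ^ k * exp (1 - R)"
      using R by (intro mult_mono power_mono) auto
    also have "\<dots> = exp 1 * (R powr m * exp (- R)) * R powr - (real DIM('a) + 1)"
    proof -
      have "R powr m * R powr - (real DIM('a) + 1) = R ^ k"
        using R by (simp add: m_def powr_add[symmetric] powr_realpow)
      then show ?thesis by (simp add: exp_diff exp_minus field_simps)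
    qed
    also have "\<dots> \<le> exp 1 * (m powr m) * R powr - (real DIM('a) + 1)"
      using R m by (intro mult_right_mono mult_left_mono powr_mult_exp_le) auto
    finally show ?thesis by (simp add: tail_weight_def R_def)
  qed
  show ?thesis
  proof (rule Bochner_Integration.integrable_bound)
    show "integrable lborel (\<lambda>\<xi>::'a. exp 1 * m powr m * tail_weight 1 \<xi>)"
      by (intro integrable_mult_right integrable_tail_weight) simp
    show "AE \<xi>::'a in lborel. norm (norm \<xi> ^ k * exp (- (norm \<xi> powr \<alpha>))) \<le> norm (exp 1 * m powr m * tail_weight 1 \<xi>)"
      using le by (auto simp: abs_mult)
  qed measurable
qed

lemma cos_taylor_bound:
  fixes a t :: real
  shows "\<bar>cos (a + t) - cos a + t * sin a\<bar> \<le> t\<^sup>2"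
proof -
  have "cmod (iexp t - (\<Sum>k\<le>1. (\<i> * t) ^ k / fact k)) \<le> \<bar>t\<bar> ^ 2 / fact 2"
    using iexp_approx1[of t 1] by (simp add: numeral_2_eq_2)
  moreover have "cmod (iexp a * (iexp t - 1 - \<i> * t)) = cmod (iexp t - (\<Sum>k\<le>1. (\<i> * t) ^ k / fact k))"
    unfolding norm_mult by (simp add: diff_diff_eq)
  ultimately have "cmod (iexp a * (iexp t - 1 - \<i> * t)) \<le> t\<^sup>2 / 2"
    by (simp only:) simp
  moreover have "Re (iexp a * (iexp t - 1 - \<i> * t)) = cos (a + t) - cos a + t * sin a"
    by (simp add: Re_exp Im_exp cos_add algebra_simps)
  ultimately have "\<bar>cos (a + t) - cos a + t * sin a\<bar> \<le> t\<^sup>2 / 2"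
    using abs_Re_le_cmod[of "iexp a * (iexp t - 1 - \<i> * t)"] by simp
  then show ?thesis by (smt (verit) field_sum_of_halves zero_le_power2)
qed

lemma integrable_times_cos:
  fixes f :: "'a::euclidean_space \<Rightarrow> real"
  assumes "integrable lborel f"
  shows "integrable lborel (\<lambda>\<xi>. f \<xi> * cos (x \<bullet> \<xi>))"
proof (rule Bochner_Integration.integrable_bound[OF assms])
  show "AE \<xi> in lborel. norm (f \<xi> * cos (x \<bullet> \<xi>)) \<le> norm (f \<xi>)"
    by (simp add: abs_mult mult_left_le)
qed (use assms in measurable)

text \<open>The second-order Taylor bound of the cosine makes the remainder at most \<open>\<bar>h\<bar>\<^sup>2\<close> times the second moment
  of \<open>f\<close>.\<close>

lemma gderiv_cos_integral:
  fixes f :: "'a::euclidean_space \<Rightarrow> real"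
  assumes f [measurable]: "f \<in> borel_measurable borel" and f0: "\<And>\<xi>. 0 \<le> f \<xi>"
    and i0: "integrable lborel f" and i2: "integrable lborel (\<lambda>\<xi>. (norm \<xi>)\<^sup>2 * f \<xi>)"
  shows "integrable lborel (\<lambda>\<xi>. (f \<xi> * sin (x \<bullet> \<xi>)) *\<^sub>R \<xi>)" (is ?I)
    and "GDERIV (\<lambda>x. LINT \<xi>|lborel. f \<xi> * cos (x \<bullet> \<xi>)) x :> - (LINT \<xi>|lborel. (f \<xi> * sin (x \<bullet> \<xi>)) *\<^sub>R \<xi>)" (is ?D)
proof -
  show I: ?I
  proof (rule Bochner_Integration.integrable_bound)
    show "integrable lborel (\<lambda>\<xi>. f \<xi> + (norm \<xi>)\<^sup>2 * f \<xi>)"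
      using i0 i2 by simp
    have "norm ((f \<xi> * sin (x \<bullet> \<xi>)) *\<^sub>R \<xi>) \<le> norm (f \<xi> + (norm \<xi>)\<^sup>2 * f \<xi>)" for \<xi>
    proof -
      have "norm \<xi> \<le> 1 + (norm \<xi>)\<^sup>2"
        by (smt (verit) power2_less_imp_less self_le_power one_power2 norm_ge_zero power_one_right zero_le_power2 pos2)
      then have "\<bar>sin (x \<bullet> \<xi>)\<bar> * norm \<xi> \<le> 1 * (1 + (norm \<xi>)\<^sup>2)"
        by (intro mult_mono) auto
      then have "f \<xi> * (\<bar>sin (x \<bullet> \<xi>)\<bar> * norm \<xi>) \<le> f \<xi> * (1 + (norm \<xi>)\<^sup>2)"
        using f0 by (intro mult_left_mono) auto
      then show ?thesis using f0[of \<xi>] by (simp add: abs_mult algebra_simps)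
    qed
    then show "AE \<xi> in lborel. norm ((f \<xi> * sin (x \<bullet> \<xi>)) *\<^sub>R \<xi>) \<le> norm (f \<xi> + (norm \<xi>)\<^sup>2 * f \<xi>)"
      by simp
  qed measurable
  note ic = integrable_times_cos[OF i0]
  define K where "K = (LINT \<xi>|lborel. (norm \<xi>)\<^sup>2 * f \<xi>)"
  define D where "D = - (LINT \<xi>|lborel. (f \<xi> * sin (x \<bullet> \<xi>)) *\<^sub>R \<xi>)"
  define F where "F = (\<lambda>x. LINT \<xi>|lborel. f \<xi> * cos (x \<bullet> \<xi>))"
  have bd: "norm (F (x + h) - F x - h \<bullet> D) \<le> K * (norm h)\<^sup>2" for h
  proof -
    have ih: "integrable lborel (\<lambda>\<xi>. f \<xi> * (h \<bullet> \<xi>) * sin (x \<bullet> \<xi>))"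
      using integrable_inner_right[OF I, of h] by (simp add: mult_ac)
    have hD: "h \<bullet> D = - (LINT \<xi>|lborel. f \<xi> * (h \<bullet> \<xi>) * sin (x \<bullet> \<xi>))"
      using integral_inner_right[of h lborel "\<lambda>\<xi>. (f \<xi> * sin (x \<bullet> \<xi>)) *\<^sub>R \<xi>"] I
      by (simp add: D_def mult_ac)
    have "F (x + h) - F x - h \<bullet> D =
        (LINT \<xi>|lborel. f \<xi> * cos ((x + h) \<bullet> \<xi>) - f \<xi> * cos (x \<bullet> \<xi>) + f \<xi> * (h \<bullet> \<xi>) * sin (x \<bullet> \<xi>))"
      unfolding F_def hD using ic ih by simp
    also have "norm \<dots> \<le> (LINT \<xi>|lborel. (norm h)\<^sup>2 * ((norm \<xi>)\<^sup>2 * f \<xi>))"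
    proof (rule Bochner_Integration.integral_norm_bound_integral)
      show "integrable lborel (\<lambda>\<xi>. f \<xi> * cos ((x + h) \<bullet> \<xi>) - f \<xi> * cos (x \<bullet> \<xi>) + f \<xi> * (h \<bullet> \<xi>) * sin (x \<bullet> \<xi>))"
        using ic ih by simp
      show "integrable lborel (\<lambda>\<xi>. (norm h)\<^sup>2 * ((norm \<xi>)\<^sup>2 * f \<xi>))"
        using i2 by simp
      fix \<xi> :: 'a
      have "\<bar>cos (x \<bullet> \<xi> + h \<bullet> \<xi>) - cos (x \<bullet> \<xi>) + (h \<bullet> \<xi>) * sin (x \<bullet> \<xi>)\<bar> \<le> (h \<bullet> \<xi>)\<^sup>2"
        by (rule cos_taylor_bound)
      also have "\<dots> \<le> (norm h)\<^sup>2 * (norm \<xi>)\<^sup>2"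
        using Cauchy_Schwarz_ineq[of h \<xi>] by (simp add: power2_norm_eq_inner)
      finally have "f \<xi> * \<bar>cos (x \<bullet> \<xi> + h \<bullet> \<xi>) - cos (x \<bullet> \<xi>) + (h \<bullet> \<xi>) * sin (x \<bullet> \<xi>)\<bar> \<le> f \<xi> * ((norm h)\<^sup>2 * (norm \<xi>)\<^sup>2)"
        by (rule mult_left_mono[OF _ f0])
      moreover have "norm (f \<xi> * cos ((x + h) \<bullet> \<xi>) - f \<xi> * cos (x \<bullet> \<xi>) + f \<xi> * (h \<bullet> \<xi>) * sin (x \<bullet> \<xi>))
          = f \<xi> * \<bar>cos (x \<bullet> \<xi> + h \<bullet> \<xi>) - cos (x \<bullet> \<xi>) + (h \<bullet> \<xi>) * sin (x \<bullet> \<xi>)\<bar>"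
        by (subst abs_of_nonneg[OF f0[of \<xi>], symmetric], subst abs_mult[symmetric]) (simp add: inner_add_left algebra_simps)
      ultimately show "norm (f \<xi> * cos ((x + h) \<bullet> \<xi>) - f \<xi> * cos (x \<bullet> \<xi>) + f \<xi> * (h \<bullet> \<xi>) * sin (x \<bullet> \<xi>))
         \<le> (norm h)\<^sup>2 * ((norm \<xi>)\<^sup>2 * f \<xi>)" by (simp add: mult_ac)
    qed
    finally show ?thesis by (simp add: K_def mult.commute)
  qed
  have "(F has_derivative (\<lambda>h. h \<bullet> D)) (at x)"
    unfolding has_derivative_at
  proof
    show "bounded_linear (\<lambda>h. h \<bullet> D)" by (rule bounded_linear_inner_left)
    show "(\<lambda>h. norm (F (x + h) - F x - h \<bullet> D) / norm h) \<midarrow>0\<rightarrow> 0"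
    proof (rule Lim_null_comparison)
      show "\<forall>\<^sub>F h in at 0. norm (norm (F (x + h) - F x - h \<bullet> D) / norm h) \<le> K * norm h"
        using bd by (intro always_eventually allI) (auto simp: divide_le_eq power2_eq_square mult.assoc)
      show "(\<lambda>h. K * norm h) \<midarrow>0\<rightarrow> 0"
        by (auto intro!: tendsto_eq_intros)
    qed
  qed
  then show ?D by (simp add: gderiv_def F_def D_def)
qed

lemma gauss_second_moment:
  assumes s: "s > 0"
  shows "integrable lborel (\<lambda>\<xi>::'a::euclidean_space. (norm \<xi>)\<^sup>2 * exp (- s * (norm \<xi>)\<^sup>2))"
proof (rule Bochner_Integration.integrable_bound)
  show "integrable lborel (\<lambda>\<xi>::'a. 2 / s * exp (- (s / 2) * (norm \<xi>)\<^sup>2))"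
    by (intro integrable_mult_right gauss_fourier(1)) (use s in simp)
  have "(norm \<xi>)\<^sup>2 * exp (- s * (norm \<xi>)\<^sup>2) \<le> 2 / s * exp (- (s / 2) * (norm \<xi>)\<^sup>2)" for \<xi> :: 'a
  proof -
    have "s / 2 * (norm \<xi>)\<^sup>2 \<le> exp (s / 2 * (norm \<xi>)\<^sup>2)"
      by (smt (verit) exp_ge_add_one_self)
    then have "(norm \<xi>)\<^sup>2 \<le> 2 / s * exp (s / 2 * (norm \<xi>)\<^sup>2)"
      using s by (simp add: field_simps)
    then have "(norm \<xi>)\<^sup>2 * exp (- s * (norm \<xi>)\<^sup>2) \<le> 2 / s * exp (s / 2 * (norm \<xi>)\<^sup>2) * exp (- s * (norm \<xi>)\<^sup>2)"
      by (rule mult_right_mono) simp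
    also have "\<dots> = 2 / s * exp (- (s / 2) * (norm \<xi>)\<^sup>2)"
      by (simp add: mult.assoc exp_add[symmetric])
    finally show ?thesis .
  qed
  then show "AE \<xi> in lborel. norm ((norm \<xi>)\<^sup>2 * exp (- s * (norm \<xi>)\<^sup>2)) \<le> norm (2 / s * exp (- (s / 2) * (norm (\<xi>::'a))\<^sup>2))"
    using s by (auto simp: abs_mult)
qed measurable

text \<open>Both sides are minus the derivative of the Gaussian transform in the direction \<open>b\<close>, once under
  the integral and once from the closed form.\<close>

lemma gauss_gradient:
  fixes x b :: "'a::euclidean_space"
  assumes s: "s > 0"
  shows "integrable lborel (\<lambda>\<xi>. exp (- s * (norm \<xi>)\<^sup>2) * ((b \<bullet> \<xi>) * sin (x \<bullet> \<xi>)))"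
    and "(LINT \<xi>|lborel. exp (- s * (norm \<xi>)\<^sup>2) * ((b \<bullet> \<xi>) * sin (x \<bullet> \<xi>)))
          = (b \<bullet> x) / (2 * s) * ((pi / s) powr (DIM('a) / 2) * exp (- (norm x)\<^sup>2 / (4 * s)))"
proof -
  let ?f = "\<lambda>\<xi>::'a. exp (- s * (norm \<xi>)\<^sup>2)"
  let ?F = "\<lambda>x::'a. (pi / s) powr (DIM('a) / 2) * exp (- (norm x)\<^sup>2 / (4 * s))"
  note g = gderiv_cos_integral[of ?f, OF _ _ gauss_fourier(1)[OF s] gauss_second_moment[OF s]]
  have I: "integrable lborel (\<lambda>\<xi>. (?f \<xi> * sin (x \<bullet> \<xi>)) *\<^sub>R \<xi>)"
    by (rule g(1)) auto
  have D: "GDERIV ?F x :> - (LINT \<xi>|lborel. (?f \<xi> * sin (x \<bullet> \<xi>)) *\<^sub>R \<xi>)"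
    using g(2)[of x] unfolding gauss_fourier(2)[OF s] by simp
  have "(?F has_derivative (\<lambda>h. - ((h \<bullet> x) / (2 * s) * ?F x))) (at x)"
    unfolding power2_norm_eq_inner using s
    by (auto intro!: derivative_eq_intros simp: inner_commute field_simps)
  from has_derivative_unique[OF this D[unfolded gderiv_def]]
  have "- ((b \<bullet> x) / (2 * s) * ?F x) = b \<bullet> - (LINT \<xi>|lborel. (?f \<xi> * sin (x \<bullet> \<xi>)) *\<^sub>R \<xi>)"
    by metis
  then show "(LINT \<xi>|lborel. ?f \<xi> * ((b \<bullet> \<xi>) * sin (x \<bullet> \<xi>))) = (b \<bullet> x) / (2 * s) * ?F x"
    using integral_inner_right[of b lborel "\<lambda>\<xi>. (?f \<xi> * sin (x \<bullet> \<xi>)) *\<^sub>R \<xi>"] I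
    by (simp add: mult_ac)
  show "integrable lborel (\<lambda>\<xi>. exp (- s * (norm \<xi>)\<^sup>2) * ((b \<bullet> \<xi>) * sin (x \<bullet> \<xi>)))"
    using integrable_inner_right[OF I, of b] by (simp add: mult_ac)
qed

section \<open>Two-sided bounds of the stable profile\<close>

lemma one_minus_exp_ge:
  fixes v :: real
  assumes "v \<ge> 0"
  shows "v / (1 + v) \<le> 1 - exp (- v)"
proof -
  have "exp (- v) \<le> 1 / (1 + v)"
    using exp_ge_add_one_self[of v] assms by (simp add: exp_minus field_simps)
  then show ?thesis using assms by (simp add: field_simps)
qed

lemma inverse_powr_exp_le:
  fixes v m :: real
  assumes "m > 0" "v > 0"
  shows "v powr - m * exp (- 1 / (4 * v)) \<le> (4 * m) powr m"
proof -
  have "v powr - m = 4 powr m * (1 / (4 * v)) powr m"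
    using assms by (simp add: powr_divide powr_mult powr_minus field_simps)
  then have "v powr - m * exp (- 1 / (4 * v)) = 4 powr m * ((1 / (4 * v)) powr m * exp (- (1 / (4 * v))))"
    by simp
  also have "\<dots> \<le> 4 powr m * m powr m"
    using assms by (intro mult_left_mono powr_mult_exp_le) auto
  finally show ?thesis using assms by (simp add: powr_mult)
qed

text \<open>With \<open>m = d / 2\<close> and \<open>v = s / r\<^sup>2\<close> the Gaussian kernel at distance \<open>r\<close> is a multiple of the left-hand
  side; its gradient leads to \<open>m = d / 2 + 1\<close>.
  The right-hand side is a combination of the exponentials \<open>exp (- 0 * v)\<close> and \<open>exp (- 1 * v)\<close>, whose
  stable counterpart \<open>1 - exp (- (r powr - \<alpha>))\<close> has the decay of a stable tail. As \<open>v \<rightarrow> 0\<close> the left-hand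
  side is smaller than any power of \<open>v\<close>, and as \<open>v \<rightarrow> \<infinity>\<close> it tends to 0 while \<open>1 - exp (- v)\<close>
  tends to 1.\<close>

lemma gauss_profile_upper:
  fixes m :: real
  assumes m: "m > 0"
  obtains C where "C > 0" "\<And>v. v > 0 \<Longrightarrow> v powr - m * exp (- 1 / (4 * v)) \<le> C * (1 - exp (- v))"
proof
  define C where "C = (4 * (m + 1)) powr (m + 1) + (4 * m) powr m"
  show "C > 0" using m by (simp add: C_def add_pos_pos)
  fix v :: real assume v: "v > 0"
  have "v powr - m * exp (- 1 / (4 * v)) = (v powr - (m + 1) * exp (- 1 / (4 * v)) + v powr - m * exp (- 1 / (4 * v))) * (v / (1 + v))"
  proof -
    have "v powr - m = v powr - (m + 1) * v"
      using v by (simp add: powr_diff powr_minus field_simps powr_add)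
    then show ?thesis using v by (simp add: field_simps)
  qed
  also have "\<dots> \<le> C * (v / (1 + v))"
    unfolding C_def using v m by (intro mult_right_mono add_mono inverse_powr_exp_le) auto
  also have "\<dots> \<le> C * (1 - exp (- v))"
    using one_minus_exp_ge[of v] v \<open>C > 0\<close> by (intro mult_left_mono) auto
  finally show "v powr - m * exp (- 1 / (4 * v)) \<le> C * (1 - exp (- v))" .
qed

text \<open>A minorant of the Gaussian profile by a combination of three exponentials, whose stable counterpart
  is still positive to first order. The combination is
  \<open>exp (- v) * ((1 - exp (- v)) - \<epsilon> * (1 - exp (- K * v)))\<close>. Because the Gaussian profile is almost zero for
  small \<open>v\<close>, the bracket must be nonpositive there, and \<open>\<epsilon> = 2 / K\<close> achieves this for \<open>v \<le> 1 / K\<close>. In the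
  stable counterpart the factor \<open>K\<close> enters only as \<open>K powr \<beta>\<close>, so the subtracted part is of relative size
  \<open>K powr (\<beta> - 1)\<close> and disappears for large \<open>K\<close>.\<close>

lemma gauss_profile_lower:
  fixes m \<beta> :: real
  assumes m: "m > 0" and \<beta>: "0 < \<beta>" "\<beta> < 1"
  obtains K C c \<rho>0 \<epsilon> where "K > 0" "C > 0" "c > 0" "\<rho>0 > 0"
    "\<forall>v>0. (1 - \<epsilon>) * exp (- v) - exp (- 2 * v) + \<epsilon> * exp (- (1 + K) * v) \<le> C * (v powr - m * exp (- 1 / (4 * v)))"
    "\<forall>\<rho>. 0 < \<rho> \<longrightarrow> \<rho> \<le> \<rho>0 \<longrightarrow> c * \<rho> \<le> (1 - \<epsilon>) * exp (- \<rho>) - exp (- (2 powr \<beta> * \<rho>)) + \<epsilon> * exp (- ((1 + K) powr \<beta> * \<rho>))"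
proof -
  define \<delta> :: real where "\<delta> = 2 powr \<beta> - 1"
  have \<delta>: "\<delta> > 0" using \<beta> by (simp add: \<delta>_def)
  have "((\<lambda>K. 2 * (1 + K) powr \<beta> / K) \<longlongrightarrow> 0) at_top"
    using \<beta> by real_asymp
  then have "eventually (\<lambda>K. 2 * (1 + K) powr \<beta> / K < \<delta> / 2) at_top"
    using \<delta> by (intro order_tendstoD) auto
  then have "eventually (\<lambda>K. 2 * (1 + K) powr \<beta> / K < \<delta> / 2 \<and> K \<ge> 2) at_top"
    using eventually_ge_at_top by (rule eventually_conj)
  then obtain K :: real where K: "2 * (1 + K) powr \<beta> / K < \<delta> / 2" "K \<ge> 2"
    by (auto simp: eventually_at_top_linorder)
  \<comment> \<open>the least value for which \<open>v \<le> \<epsilon> * (K * v / (1 + K * v))\<close> holds up to \<open>v = 1 / K\<close>\<close>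
  define \<epsilon> where "\<epsilon> = 2 / K"
  define C where "C = m powr m * exp (K / 4)"
  show ?thesis
  proof (rule that[of K C "\<delta> / 4" "\<delta> / 16" \<epsilon>])
    show "K > 0" "C > 0" "\<delta> / 4 > 0" "\<delta> / 16 > 0" using K \<delta> m by (auto simp: C_def)
  next
    show "\<forall>v>0. (1 - \<epsilon>) * exp (- v) - exp (- 2 * v) + \<epsilon> * exp (- (1 + K) * v) \<le> C * (v powr - m * exp (- 1 / (4 * v)))"
    proof (intro allI impI)
      fix v :: real assume v: "v > 0"
      have \<epsilon>: "0 < \<epsilon>" using K by (auto simp: \<epsilon>_def)
      let ?h = "(1 - exp (- v)) - \<epsilon> * (1 - exp (- (K * v)))"
      have h: "(1 - \<epsilon>) * exp (- v) - exp (- 2 * v) + \<epsilon> * exp (- (1 + K) * v) = exp (- v) * ?h"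
        by (simp add: algebra_simps exp_add[symmetric])
      show "(1 - \<epsilon>) * exp (- v) - exp (- 2 * v) + \<epsilon> * exp (- (1 + K) * v) \<le> C * (v powr - m * exp (- 1 / (4 * v)))"
      proof (cases "K * v \<le> 1")
        case True
        have "v \<le> \<epsilon> * (K * v / (1 + K * v))"
        proof -
          have "v * (1 + K * v) \<le> v * 2" using True v by (intro mult_left_mono) auto
          moreover have "1 + K * v > 0" using K v by (intro add_pos_pos) auto
          ultimately show ?thesis using K by (simp add: \<epsilon>_def pos_le_divide_eq mult.commute)
        qed
        also have "\<dots> \<le> \<epsilon> * (1 - exp (- (K * v)))"
          using one_minus_exp_ge[of "K * v"] K v \<epsilon> by (intro mult_left_mono) auto
        finally have "?h \<le> 0" using exp_ge_add_one_self[of "- v"] by simp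
        then have "exp (- v) * ?h \<le> 0" by (simp add: mult_nonneg_nonpos)
        also have "0 \<le> C * (v powr - m * exp (- 1 / (4 * v)))" by (simp add: C_def)
        finally show ?thesis unfolding h .
      next
        case False
        have "\<epsilon> * (1 - exp (- (K * v))) \<ge> 0" using \<epsilon> K v by (intro mult_nonneg_nonneg) auto
        then have "?h \<le> 1" using exp_ge_zero[of "- v"] by linarith
        then have "exp (- v) * ?h \<le> exp (- v) * 1" by (intro mult_left_mono) auto
        also have "exp (- v) * 1 \<le> m powr m * v powr - m"
          using powr_mult_exp_le[of m v] m v by (simp add: powr_minus field_simps)
        also have "\<dots> \<le> m powr m * v powr - m * (exp (K / 4) * exp (- 1 / (4 * v)))"
        proof -
          have "1 / (4 * v) \<le> K / 4" using False K v by (simp add: field_simps)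
          then have "1 \<le> exp (K / 4) * exp (- 1 / (4 * v))" by (simp add: exp_add[symmetric])
          then have "m powr m * v powr - m * 1 \<le> m powr m * v powr - m * (exp (K / 4) * exp (- 1 / (4 * v)))"
            by (intro mult_left_mono) auto
          then show ?thesis by simp
        qed
        finally show ?thesis unfolding h by (simp add: C_def mult_ac)
      qed
    qed
  next
    show "\<forall>\<rho>. 0 < \<rho> \<longrightarrow> \<rho> \<le> \<delta> / 16 \<longrightarrow> \<delta> / 4 * \<rho> \<le> (1 - \<epsilon>) * exp (- \<rho>) - exp (- (2 powr \<beta> * \<rho>)) + \<epsilon> * exp (- ((1 + K) powr \<beta> * \<rho>))"
    proof (intro allI impI)
      fix \<rho> :: real assume \<rho>: "0 < \<rho>" "\<rho> \<le> \<delta> / 16"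
      have \<epsilon>: "0 < \<epsilon>" "\<epsilon> \<le> 1" using K by (auto simp: \<epsilon>_def)
      have 1: "(1 - \<epsilon>) * (1 - \<rho>) \<le> (1 - \<epsilon>) * exp (- \<rho>)"
        using \<epsilon> exp_ge_add_one_self[of "- \<rho>"] by (intro mult_left_mono) auto
      have 3: "\<epsilon> * (1 - (1 + K) powr \<beta> * \<rho>) \<le> \<epsilon> * exp (- ((1 + K) powr \<beta> * \<rho>))"
        using \<epsilon> exp_ge_add_one_self[of "- ((1 + K) powr \<beta> * \<rho>)"] by (intro mult_left_mono) auto
      define y where "y = 2 powr \<beta> * \<rho>"
      have y: "y \<ge> 0" using \<rho> by (simp add: y_def)
      have "exp (- y) \<le> 1 / (1 + y)"
        using exp_ge_add_one_self[of y] y by (simp add: exp_minus field_simps)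
      also have "\<dots> \<le> 1 - y + y\<^sup>2"
        using y by (simp add: field_simps power2_eq_square power3_eq_cube)
      finally have 2: "exp (- y) \<le> 1 - y + y\<^sup>2" .
      have "2 powr \<beta> \<le> (2::real) powr 1" using \<beta> by (intro powr_mono) auto
      then have "y \<le> 2 * \<rho>" using \<rho> by (simp add: y_def)
      then have "y\<^sup>2 \<le> (2 * \<rho>)\<^sup>2" using y by (rule power_mono)
      also have "\<dots> \<le> 4 * \<rho> * (\<delta> / 16)" using \<rho> by (simp add: power2_eq_square)
      finally have 4: "y\<^sup>2 \<le> \<delta> / 4 * \<rho>" by simp
      have "\<epsilon> * (1 + K) powr \<beta> \<le> \<delta> / 2" using K(1) by (simp add: \<epsilon>_def)
      then have 5: "\<epsilon> * (1 + K) powr \<beta> * \<rho> \<le> \<delta> / 2 * \<rho>" using \<rho> by (intro mult_right_mono) auto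
      have 6: "y = \<delta> * \<rho> + \<rho>" by (simp add: y_def \<delta>_def algebra_simps)
      have 7: "\<epsilon> * \<rho> \<ge> 0" using \<epsilon> \<rho> by simp
      have "\<delta> / 4 * \<rho> \<le> (1 - \<epsilon>) * (1 - \<rho>) - (1 - y + y\<^sup>2) + \<epsilon> * (1 - (1 + K) powr \<beta> * \<rho>)"
        using 4 5 6 7 by (simp add: algebra_simps)
      also have "\<dots> \<le> (1 - \<epsilon>) * exp (- \<rho>) - exp (- y) + \<epsilon> * exp (- ((1 + K) powr \<beta> * \<rho>))"
        using 1 2 3 by linarith
      finally show "\<delta> / 4 * \<rho> \<le> (1 - \<epsilon>) * exp (- \<rho>) - exp (- (2 powr \<beta> * \<rho>)) + \<epsilon> * exp (- ((1 + K) powr \<beta> * \<rho>))"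
        by (simp add: y_def)
    qed
  qed
qed

text \<open>The stable kernel at time 1 without the factor \<open>(2 * pi) powr - d\<close>.\<close>

definition stable_profile :: "real \<Rightarrow> 'a::euclidean_space \<Rightarrow> real" where
  "stable_profile \<alpha> x = (LINT \<xi>|lborel. exp (- (norm \<xi> powr \<alpha>)) * cos (x \<bullet> \<xi>))"

lemma sq_powr_half: "((norm x)\<^sup>2) powr (\<alpha> / 2) = norm x powr \<alpha>"
proof (cases "norm x = 0")
  case False
  then have "(norm x)\<^sup>2 = norm x powr 2" by (simp add: powr_numeral)
  then show ?thesis by (simp only: powr_powr) simp
qed simp

lemma gauss_scaled:
  fixes s r d :: real
  assumes "s > 0" "r > 0"
  shows "(pi / s) powr (d / 2) * exp (- r\<^sup>2 / (4 * s))
    = pi powr (d / 2) * r powr - d * ((s * r powr - 2) powr - (d / 2) * exp (- 1 / (4 * (s * r powr - 2))))"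
proof -
  have "(s * r powr - 2) powr - (d / 2) = s powr - (d / 2) * r powr d"
    using assms by (simp add: powr_mult powr_powr)
  moreover have "(pi / s) powr (d / 2) = pi powr (d / 2) * s powr - (d / 2)"
    using assms by (simp add: powr_divide powr_minus field_simps)
  moreover have "- r\<^sup>2 / (4 * s) = - 1 / (4 * (s * r powr - 2))"
    using assms by (simp add: powr_minus powr_numeral field_simps)
  moreover have "r powr - d * r powr d = 1"
    using assms by (simp add: powr_minus field_simps)
  ultimately show ?thesis by (simp add: mult_ac)
qed

context
  fixes \<alpha> :: real and space_type :: "'a::euclidean_space itself"
  assumes \<alpha>: "1 < \<alpha>" "\<alpha> < 2"
begin

text \<open>The form in which the transfer principle yields upper bounds: the two point values are taken at the
  frequencies \<open>0\<close> and \<open>r powr - 2\<close>.\<close>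

lemma stable_mixture_upper:
  fixes k :: "'a \<Rightarrow> real" and A r :: real
  assumes r: "r > 0" and [measurable]: "k \<in> borel_measurable borel"
    and i1: "\<And>s. s > 0 \<Longrightarrow> integrable lborel (\<lambda>\<xi>. exp (- s * (norm \<xi>)\<^sup>2) * k \<xi>)"
    and i2: "integrable lborel (\<lambda>\<xi>. exp (- (norm \<xi> powr \<alpha>)) * k \<xi>)"
    and A: "A \<ge> 0" and le: "\<And>s. s > 0 \<Longrightarrow> (LINT \<xi>|lborel. exp (- s * (norm \<xi>)\<^sup>2) * k \<xi>) \<le> A * (1 - exp (- (s * r powr - 2)))"
  shows "(LINT \<xi>|lborel. exp (- (norm \<xi> powr \<alpha>)) * k \<xi>) \<le> A * r powr - \<alpha>"
proof -
  have "0 \<le> (\<integral>\<xi>. exp (- (((norm \<xi>)\<^sup>2) powr (\<alpha> / 2))) * (- k \<xi>) \<partial>lborel)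
     + (\<Sum>i<2. (if i = 0 then A else - A) * exp (- ((if i = (0::nat) then 0 else r powr - 2) powr (\<alpha> / 2))))"
  proof (rule stable_mixture_positivity)
    fix s :: real assume s: "s > 0"
    show "integrable lborel (\<lambda>\<xi>. exp (- s * (norm \<xi>)\<^sup>2) * (- k \<xi>))"
      using i1[OF s] by simp
    show "0 \<le> (LINT \<xi>|lborel. exp (- s * (norm \<xi>)\<^sup>2) * (- k \<xi>)) +
           (\<Sum>i<2. (if i = 0 then A else - A) * exp (- s * (if i = (0::nat) then 0 else r powr - 2)))"
      using le[OF s] by (simp add: numeral_2_eq_2 algebra_simps)
  qed (use \<alpha> i2 in \<open>auto simp: sq_powr_half\<close>)
  then have "(LINT \<xi>|lborel. exp (- (norm \<xi> powr \<alpha>)) * k \<xi>) \<le> A * (1 - exp (- (r powr - \<alpha>)))"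
    unfolding sq_powr_half by (simp add: numeral_2_eq_2 right_diff_distrib powr_powr)
  also have "\<dots> \<le> A * r powr - \<alpha>"
    using A exp_ge_add_one_self[of "- (r powr - \<alpha>)"] by (intro mult_left_mono) auto
  finally show ?thesis .
qed

lemma integrable_stable:
  "integrable lborel (\<lambda>\<xi>::'a. exp (- (norm \<xi> powr \<alpha>)))"
  "integrable lborel (\<lambda>\<xi>::'a. norm \<xi> * exp (- (norm \<xi> powr \<alpha>)))"
  "integrable lborel (\<lambda>\<xi>::'a. (norm \<xi>)\<^sup>2 * exp (- (norm \<xi> powr \<alpha>)))"
  using integrable_stable_moment[of \<alpha> 0] integrable_stable_moment[of \<alpha> 1] integrable_stable_moment[of \<alpha> 2] \<alpha>
  by auto

lemma tail_weight_ge: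
  fixes x :: "'a" and \<gamma> f A B :: real
  assumes "\<gamma> \<ge> 0" and "f \<le> A" and "x \<noteq> 0 \<Longrightarrow> f \<le> B * norm x powr - (DIM('a) + \<gamma>)" and "A \<ge> 0" "B \<ge> 0"
  shows "f \<le> (A + B) * tail_weight \<gamma> x"
proof (cases "norm x \<le> 1")
  case True
  then have "tail_weight \<gamma> x = 1" by (simp add: tail_weight_def)
  then show ?thesis using assms by simp
next
  case False
  then have "tail_weight \<gamma> x = norm x powr - (DIM('a) + \<gamma>)" by (simp add: tail_weight_def max_def)
  moreover have "x \<noteq> 0" using False by auto
  then have "f \<le> B * norm x powr - (DIM('a) + \<gamma>)" by (rule assms(3))
  ultimately show ?thesis using \<open>A \<ge> 0\<close> by (simp add: distrib_right add_increasing)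
qed

lemma stable_profile_upper:
  "\<exists>C>0. \<forall>x::'a. stable_profile \<alpha> x \<le> C * tail_weight \<alpha> x"
proof -
  define m where "m = real DIM('a) / 2"
  have m: "m > 0" by (simp add: m_def)
  obtain C where C: "C > 0" "\<And>v. v > 0 \<Longrightarrow> v powr - m * exp (- 1 / (4 * v)) \<le> C * (1 - exp (- v))"
    using gauss_profile_upper[OF m] by blast
  define A where "A = (LINT \<xi>::'a|lborel. exp (- (norm \<xi> powr \<alpha>)))"
  have "A \<ge> 0" by (simp add: A_def)
  define B where "B = pi powr m * C"
  have B: "B > 0" using C by (simp add: B_def)
  show ?thesis
  proof (intro exI[of _ "A + B"] conjI allI)
    show "A + B > 0" using \<open>A \<ge> 0\<close> B by simp
    fix x :: 'a
    note ic = integrable_times_cos[of _ x]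
    show "stable_profile \<alpha> x \<le> (A + B) * tail_weight \<alpha> x"
    proof (rule tail_weight_ge)
      show "stable_profile \<alpha> x \<le> A" unfolding stable_profile_def A_def
        by (intro integral_mono ic integrable_stable) (simp add: mult_left_le)
      assume "x \<noteq> 0"
      then have r: "norm x > 0" by simp
      have "stable_profile \<alpha> x \<le> (B * norm x powr - DIM('a)) * norm x powr - \<alpha>"
        unfolding stable_profile_def
      proof (rule stable_mixture_upper[OF r])
        fix s :: real assume s: "s > 0"
        show "integrable lborel (\<lambda>\<xi>::'a. exp (- s * (norm \<xi>)\<^sup>2) * cos (x \<bullet> \<xi>))"
          by (rule ic, rule gauss_fourier[OF s])
        have "pi powr m * norm x powr - DIM('a) * ((s * norm x powr - 2) powr - m * exp (- 1 / (4 * (s * norm x powr - 2))))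
           \<le> pi powr m * norm x powr - DIM('a) * (C * (1 - exp (- (s * norm x powr - 2))))"
          using s r by (intro mult_left_mono C) auto
        then show "(LINT \<xi>|lborel. exp (- s * (norm \<xi>)\<^sup>2) * cos (x \<bullet> \<xi>)) \<le> B * norm x powr - DIM('a) * (1 - exp (- (s * norm x powr - 2)))"
          unfolding gauss_fourier(2)[OF s] gauss_scaled[OF s r] by (simp add: B_def m_def mult_ac)
      qed (use B ic integrable_stable in auto)
      then show "stable_profile \<alpha> x \<le> B * norm x powr - (DIM('a) + \<alpha>)"
        by (simp add: powr_add[symmetric] mult.assoc)
    qed (use \<alpha> \<open>A \<ge> 0\<close> B in auto)
  qed
qed

lemma stable_profile_gderiv:
  fixes x :: 'a
  shows "integrable lborel (\<lambda>\<xi>. (exp (- (norm \<xi> powr \<alpha>)) * sin (x \<bullet> \<xi>)) *\<^sub>R \<xi>)"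
    and "GDERIV (stable_profile \<alpha>) x :> - (LINT \<xi>|lborel. (exp (- (norm \<xi> powr \<alpha>)) * sin (x \<bullet> \<xi>)) *\<^sub>R \<xi>)"
  using gderiv_cos_integral[of "\<lambda>\<xi>::'a. exp (- (norm \<xi> powr \<alpha>))" x] integrable_stable
  by (auto simp: stable_profile_def[abs_def])

text \<open>The gradient of the Gaussian kernel carries the factor \<open>r / s = 1 / (r * v)\<close>. So the extra \<open>1 / r\<close> is
  gained, and the extra \<open>1 / v\<close> only changes the exponent in the one-variable inequality.\<close>

lemma stable_profile_gradient_bound:
  "\<exists>C>0. \<forall>x::'a. \<exists>D. GDERIV (stable_profile \<alpha>) x :> D \<and> norm D \<le> C * tail_weight (\<alpha> + 1) x"
proof -
  define m where "m = real DIM('a) / 2 + 1"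
  have m: "m > 0" by (simp add: m_def)
  obtain C where C: "C > 0" "\<And>v. v > 0 \<Longrightarrow> v powr - m * exp (- 1 / (4 * v)) \<le> C * (1 - exp (- v))"
    using gauss_profile_upper[OF m] by blast
  define A where "A = (LINT \<xi>::'a|lborel. norm \<xi> * exp (- (norm \<xi> powr \<alpha>)))"
  have "A \<ge> 0" by (simp add: A_def)
  define B where "B = pi powr (DIM('a) / 2) * C / 2"
  have B: "B > 0" using C by (simp add: B_def)
  show ?thesis
  proof (intro exI[of _ "A + B"] conjI allI)
    show "A + B > 0" using \<open>A \<ge> 0\<close> B by simp
    fix x :: 'a
    define D where "D = - (LINT \<xi>|lborel. (exp (- (norm \<xi> powr \<alpha>)) * sin (x \<bullet> \<xi>)) *\<^sub>R \<xi>)"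
    have "norm D \<le> (A + B) * tail_weight (\<alpha> + 1) x"
    proof (rule tail_weight_ge)
      show "norm D \<le> A" unfolding D_def A_def norm_minus_cancel
      proof (rule Bochner_Integration.integral_norm_bound_integral[OF stable_profile_gderiv(1) integrable_stable(2)])
        fix \<xi> :: 'a
        have "\<bar>sin (x \<bullet> \<xi>)\<bar> * (norm \<xi> * exp (- (norm \<xi> powr \<alpha>))) \<le> 1 * (norm \<xi> * exp (- (norm \<xi> powr \<alpha>)))"
          by (intro mult_right_mono) auto
        then show "norm ((exp (- (norm \<xi> powr \<alpha>)) * sin (x \<bullet> \<xi>)) *\<^sub>R \<xi>) \<le> norm \<xi> * exp (- (norm \<xi> powr \<alpha>))"
          by (simp add: abs_mult mult_ac)
      qed
      assume "x \<noteq> 0"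
      then have r: "norm x > 0" by simp
      have bd: "(LINT \<xi>|lborel. exp (- (norm \<xi> powr \<alpha>)) * ((e \<bullet> \<xi>) * sin (x \<bullet> \<xi>)))
         \<le> (norm e * B * norm x powr - (DIM('a) + 1)) * norm x powr - \<alpha>" for e :: 'a
      proof (rule stable_mixture_upper[OF r])
        show "integrable lborel (\<lambda>\<xi>. exp (- (norm \<xi> powr \<alpha>)) * ((e \<bullet> \<xi>) * sin (x \<bullet> \<xi>)))"
          using integrable_inner_right[OF stable_profile_gderiv(1)[of x], of e] by (simp add: mult_ac)
        fix s :: real assume s: "s > 0"
        show "integrable lborel (\<lambda>\<xi>. exp (- s * (norm \<xi>)\<^sup>2) * ((e \<bullet> \<xi>) * sin (x \<bullet> \<xi>)))"
          by (rule gauss_gradient(1)[OF s])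
        define v where "v = s * norm x powr - 2"
        have v: "v > 0" using s r by (simp add: v_def)
        have sv: "s = v * (norm x)\<^sup>2" using r by (simp add: v_def powr_minus powr_numeral field_simps)
        define P where "P = pi powr (DIM('a) / 2) * norm x powr - DIM('a) * (v powr - (DIM('a) / 2) * exp (- 1 / (4 * v)))"
        have P0: "P \<ge> 0" by (simp add: P_def)
        have "(LINT \<xi>|lborel. exp (- s * (norm \<xi>)\<^sup>2) * ((e \<bullet> \<xi>) * sin (x \<bullet> \<xi>))) = (e \<bullet> x) / (2 * s) * P"
          unfolding gauss_gradient(2)[OF s] gauss_scaled[OF s r] P_def v_def by simp
        also have "\<dots> \<le> (norm e * norm x) / (2 * s) * P"
          using P0 s by (intro mult_right_mono divide_right_mono norm_cauchy_schwarz) auto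
        also have "\<dots> = norm e * (pi powr (DIM('a) / 2) / 2) * norm x powr - (DIM('a) + 1) * (v powr - m * exp (- 1 / (4 * v)))"
        proof -
          have 1: "v powr - m = v powr - (DIM('a) / 2) / v"
            using v by (simp add: m_def powr_diff powr_minus_divide powr_add)
          have 2: "norm x powr - (DIM('a) + 1) = norm x powr - DIM('a) / norm x"
            using r by (simp add: powr_diff powr_minus_divide powr_add)
          show ?thesis unfolding 1 2 P_def sv using r v by (simp add: field_simps power2_eq_square)
        qed
        also have "\<dots> \<le> norm e * (pi powr (DIM('a) / 2) / 2) * norm x powr - (DIM('a) + 1) * (C * (1 - exp (- v)))"
          by (intro mult_left_mono C v) auto
        finally show "(LINT \<xi>|lborel. exp (- s * (norm \<xi>)\<^sup>2) * ((e \<bullet> \<xi>) * sin (x \<bullet> \<xi>)))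
            \<le> norm e * B * norm x powr - (DIM('a) + 1) * (1 - exp (- (s * norm x powr - 2)))"
          by (simp add: B_def v_def mult_ac)
      qed (use B in auto)
      have "(norm D)\<^sup>2 = (- D) \<bullet> (LINT \<xi>|lborel. (exp (- (norm \<xi> powr \<alpha>)) * sin (x \<bullet> \<xi>)) *\<^sub>R \<xi>)"
        by (simp add: power2_norm_eq_inner D_def)
      also have "\<dots> = (LINT \<xi>|lborel. exp (- (norm \<xi> powr \<alpha>)) * (((- D) \<bullet> \<xi>) * sin (x \<bullet> \<xi>)))"
        using integral_inner_right[of "- D" lborel "\<lambda>\<xi>. (exp (- (norm \<xi> powr \<alpha>)) * sin (x \<bullet> \<xi>)) *\<^sub>R \<xi>"]
          stable_profile_gderiv(1)[of x] by (simp add: mult_ac)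
      also have "\<dots> \<le> (norm (- D) * B * norm x powr - (DIM('a) + 1)) * norm x powr - \<alpha>"
        by (rule bd)
      also have "\<dots> = norm D * (B * norm x powr - (DIM('a) + (\<alpha> + 1)))"
        by (simp add: powr_add[symmetric] mult.assoc algebra_simps)
      finally show "norm D \<le> B * norm x powr - (DIM('a) + (\<alpha> + 1))"
        using B by (cases "norm D = 0") (auto simp: power2_eq_square)
    qed (use \<alpha> \<open>A \<ge> 0\<close> B in auto)
    then show "\<exists>D. GDERIV (stable_profile \<alpha>) x :> D \<and> norm D \<le> (A + B) * tail_weight (\<alpha> + 1) x"
      using stable_profile_gderiv(2) D_def by blast
  qed
qed

text \<open>The lower Gaussian bound is applied at the radius \<open>r = r0 * max 1 \<bar>x\<bar>\<close> instead of \<open>\<bar>x\<bar>\<close>: it is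
  valid since Gaussians decrease with the distance, and \<open>r \<ge> r0\<close> puts \<open>\<rho> = r powr - \<alpha>\<close> into the range where the
  stable counterpart is linear in \<open>\<rho>\<close>. In this way small and large \<open>x\<close> are treated together.\<close>

lemma stable_profile_lower:
  "\<exists>c>0. \<forall>x::'a. c * tail_weight \<alpha> x \<le> stable_profile \<alpha> x"
proof -
  define m where "m = real DIM('a) / 2"
  have m: "m > 0" by (simp add: m_def)
  have \<beta>: "0 < \<alpha> / 2" "\<alpha> / 2 < 1" using \<alpha> by auto
  obtain K C c \<rho>0 \<epsilon> where K: "K > 0" "C > 0" "c > 0" "\<rho>0 > 0"
    and h: "\<forall>v>0. (1 - \<epsilon>) * exp (- v) - exp (- 2 * v) + \<epsilon> * exp (- (1 + K) * v) \<le> C * (v powr - m * exp (- 1 / (4 * v)))"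
    and E: "\<forall>\<rho>. 0 < \<rho> \<longrightarrow> \<rho> \<le> \<rho>0 \<longrightarrow> c * \<rho> \<le> (1 - \<epsilon>) * exp (- \<rho>) - exp (- (2 powr (\<alpha> / 2) * \<rho>)) + \<epsilon> * exp (- ((1 + K) powr (\<alpha> / 2) * \<rho>))"
    using gauss_profile_lower[OF m \<beta>] by metis
  define r0 where "r0 = max 1 (\<rho>0 powr - (1 / \<alpha>))"
  have r0: "r0 \<ge> 1" by (simp add: r0_def)
  have r0\<rho>: "r powr - \<alpha> \<le> \<rho>0" if "r \<ge> r0" for r
  proof -
    have "r powr - \<alpha> \<le> (\<rho>0 powr - (1 / \<alpha>)) powr - \<alpha>"
      using that \<alpha> K by (intro powr_mono2') (auto simp: r0_def)
    also have "\<dots> = \<rho>0" using \<alpha> K by (simp add: powr_powr)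
    finally show ?thesis .
  qed
  have main: "pi powr m * r powr - DIM('a) / C * (c * r powr - \<alpha>) \<le> stable_profile \<alpha> x"
    if r: "r \<ge> r0" "norm x \<le> r" for x :: 'a and r
  proof -
    have rp: "r > 0" using r r0 by simp
    define A where "A = pi powr m * r powr - DIM('a) / C"
    have A: "A > 0" using K rp by (simp add: A_def)
    define cc where "cc i = (if i = 0 then - A * (1 - \<epsilon>) else if i = 1 then A else - A * \<epsilon>)" for i :: nat
    define pp where "pp i = r powr - 2 * (if i = 0 then 1 else if i = 1 then 2 else 1 + K)" for i :: nat
    note ic = integrable_times_cos[of _ x]
    have "0 \<le> (\<integral>\<xi>. exp (- (((norm \<xi>)\<^sup>2) powr (\<alpha> / 2))) * cos (x \<bullet> \<xi>) \<partial>lborel)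
       + (\<Sum>i<3. cc i * exp (- (pp i powr (\<alpha> / 2))))"
    proof (rule stable_mixture_positivity)
      fix s :: real assume s: "s > 0"
      show "integrable lborel (\<lambda>\<xi>. exp (- s * (norm \<xi>)\<^sup>2) * cos (x \<bullet> \<xi>))"
        by (rule ic, rule gauss_fourier[OF s])
      define v where "v = s * r powr - 2"
      have v: "v > 0" using s rp by (simp add: v_def)
      have "A * ((1 - \<epsilon>) * exp (- v) - exp (- 2 * v) + \<epsilon> * exp (- (1 + K) * v)) \<le> A * (C * (v powr - m * exp (- 1 / (4 * v))))"
        using A by (intro mult_left_mono h[rule_format] v) auto
      also have "\<dots> = (pi / s) powr (DIM('a) / 2) * exp (- r\<^sup>2 / (4 * s))"
        unfolding gauss_scaled[OF s rp] A_def v_def m_def using K by simp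
      also have "\<dots> \<le> (pi / s) powr (DIM('a) / 2) * exp (- (norm x)\<^sup>2 / (4 * s))"
        using r s by (intro mult_left_mono) (auto intro!: divide_right_mono power_mono)
      also have "\<dots> = (LINT \<xi>|lborel. exp (- s * (norm \<xi>)\<^sup>2) * cos (x \<bullet> \<xi>))"
        unfolding gauss_fourier(2)[OF s] ..
      finally show "0 \<le> (LINT \<xi>|lborel. exp (- s * (norm \<xi>)\<^sup>2) * cos (x \<bullet> \<xi>)) + (\<Sum>i<3. cc i * exp (- s * pp i))"
        by (simp add: numeral_3_eq_3 cc_def pp_def v_def algebra_simps)
    qed (use \<alpha> ic integrable_stable K in \<open>auto simp: sq_powr_half pp_def\<close>)
    moreover have "pp 0 powr (\<alpha> / 2) = r powr - \<alpha>" "pp (Suc 0) powr (\<alpha> / 2) = 2 powr (\<alpha> / 2) * r powr - \<alpha>"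
       "pp (Suc (Suc 0)) powr (\<alpha> / 2) = (1 + K) powr (\<alpha> / 2) * r powr - \<alpha>"
      using K by (simp_all add: pp_def powr_mult powr_powr)
    ultimately have "A * ((1 - \<epsilon>) * exp (- (r powr - \<alpha>)) - exp (- (2 powr (\<alpha> / 2) * r powr - \<alpha>)) + \<epsilon> * exp (- ((1 + K) powr (\<alpha> / 2) * r powr - \<alpha>)))
       \<le> stable_profile \<alpha> x"
      by (simp add: sq_powr_half numeral_3_eq_3 cc_def algebra_simps stable_profile_def)
    moreover have "A * (c * r powr - \<alpha>) \<le> A * ((1 - \<epsilon>) * exp (- (r powr - \<alpha>)) - exp (- (2 powr (\<alpha> / 2) * r powr - \<alpha>)) + \<epsilon> * exp (- ((1 + K) powr (\<alpha> / 2) * r powr - \<alpha>)))"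
      using A rp r r0\<rho> by (intro mult_left_mono E[rule_format]) auto
    ultimately show ?thesis by (simp add: A_def)
  qed
  define c' where "c' = pi powr m / C * c * r0 powr - (DIM('a) + \<alpha>)"
  show ?thesis
  proof (intro exI[of _ c'] conjI allI)
    show "c' > 0" using K r0 by (simp add: c'_def)
    fix x :: 'a
    define r where "r = r0 * max 1 (norm x)"
    have r: "r \<ge> r0" "norm x \<le> r" using r0 mult_mono[of 1 r0 "norm x" "max 1 (norm x)"] by (auto simp: r_def)
    have "c' * tail_weight \<alpha> x = pi powr m / C * c * r powr - (DIM('a) + \<alpha>)"
      using r0 by (simp add: c'_def tail_weight_def r_def powr_mult)
    also have "\<dots> = pi powr m * r powr - DIM('a) / C * (c * r powr - \<alpha>)"
      using r r0 by (simp add: powr_add powr_diff powr_minus field_simps)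
    also have "\<dots> \<le> stable_profile \<alpha> x" by (rule main[OF r])
    finally show "c' * tail_weight \<alpha> x \<le> stable_profile \<alpha> x" .
  qed
qed

end

section \<open>The space-time kernel of the Duhamel term\<close>

lemma nn_integral_lborel_affine:
  fixes f :: "'a::euclidean_space \<Rightarrow> ennreal"
  assumes [measurable]: "f \<in> borel_measurable borel" and c: "c > 0"
  shows "(\<integral>\<^sup>+y. f (c *\<^sub>R y - x) \<partial>lborel) = ennreal (c powr - real DIM('a)) * (\<integral>\<^sup>+y. f y \<partial>lborel)"
proof -
  have "(\<integral>\<^sup>+y. f y \<partial>lborel) = ennreal (c ^ DIM('a)) * (\<integral>\<^sup>+y. f (- x + c *\<^sub>R y) \<partial>lborel)"
    by (rule nn_integral_lborel_scale[OF assms])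
  then have "ennreal (c powr - real DIM('a)) * (\<integral>\<^sup>+y. f y \<partial>lborel)
     = ennreal (c powr - real DIM('a)) * ennreal (c ^ DIM('a)) * (\<integral>\<^sup>+y. f (- x + c *\<^sub>R y) \<partial>lborel)"
    by (simp add: mult.assoc)
  also have "ennreal (c powr - real DIM('a)) * ennreal (c ^ DIM('a)) = 1"
    using c by (simp add: ennreal_mult[symmetric] powr_realpow[symmetric] powr_add[symmetric])
  finally show ?thesis by (simp add: algebra_simps)
qed

lemma nn_integral_lborel_reflect:
  fixes f :: "'a::euclidean_space \<Rightarrow> ennreal"
  assumes [measurable]: "f \<in> borel_measurable borel"
  shows "(\<integral>\<^sup>+x. f (z - x) \<partial>lborel) = (\<integral>\<^sup>+x. f x \<partial>lborel)"
  by (subst (2) lborel_affine[of "-1" z]) (simp_all add: nn_integral_density nn_integral_distr)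

lemma nn_integral_beta:
  fixes a b :: real
  assumes "a > 0" "b > 0"
  shows "(\<integral>\<^sup>+s. ennreal (s powr (a - 1) * (1 - s) powr (b - 1)) * indicator {0<..<1} s \<partial>lborel) = ennreal (Beta a b)"
proof -
  have "((\<lambda>t. t powr (a - 1) * (1 - t) powr (b - 1)) has_integral Beta a b) {0<..<1}"
    using has_integral_Beta_real[OF assms] by (simp add: has_integral_Icc_iff_Ioo)
  then have "(\<integral>\<^sup>+s. ennreal (indicator {0<..<1} s * (s powr (a - 1) * (1 - s) powr (b - 1))) \<partial>lborel) = ennreal (Beta a b)"
    by (intro nn_integral_has_integral_lebesgue) auto
  moreover have "ennreal (indicator {0<..<1} s * (s powr (a - 1) * (1 - s) powr (b - 1)))
     = ennreal (s powr (a - 1) * (1 - s) powr (b - 1)) * indicator {0<..<1} s" for s :: real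
    by (auto split: split_indicator)
  ultimately show ?thesis by simp
qed

lemma tail_weight_le_one: "\<gamma> \<ge> 0 \<Longrightarrow> tail_weight \<gamma> x \<le> 1"
  unfolding tail_weight_def by (rule order_trans[OF powr_mono2'[of _ 1]]) auto

lemma tail_weight_antimono: "\<gamma> \<le> \<delta> \<Longrightarrow> tail_weight \<delta> x \<le> tail_weight \<gamma> x"
  unfolding tail_weight_def by (intro powr_mono) auto

lemma tail_weight_le_powr:
  fixes x :: "'a::euclidean_space"
  assumes "\<gamma> \<ge> 0" "0 < \<rho>" "\<rho> \<le> norm x"
  shows "tail_weight \<gamma> x \<le> \<rho> powr - (real DIM('a) + \<gamma>)"
  unfolding tail_weight_def using assms by (intro powr_mono2') auto

lemma nn_integral_tail_small:
  fixes f :: "'a::euclidean_space \<Rightarrow> ennreal"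
  assumes [measurable]: "f \<in> borel_measurable borel" and fin: "(\<integral>\<^sup>+y. f y \<partial>lborel) < \<infinity>" and \<delta>: "\<delta> > 0"
  obtains R :: real where "R > 0" "(\<integral>\<^sup>+y. f y * indicator {y. R < norm y} y \<partial>lborel) < ennreal \<delta>"
proof -
  have "(\<lambda>n. \<integral>\<^sup>+y. f y * indicator {y. real n < norm y} y \<partial>lborel) \<longlonglongrightarrow> (\<integral>\<^sup>+y. 0 \<partial>(lborel :: 'a measure))"
  proof (rule nn_integral_dominated_convergence[where w=f])
    show "AE y in lborel. (\<lambda>n. f y * indicator {y. real n < norm y} y) \<longlonglongrightarrow> 0"
    proof (intro AE_I2 tendsto_eventually)
      fix y :: 'a
      obtain n0 :: nat where "norm y \<le> real n0" using real_arch_simple by blast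
      then show "\<forall>\<^sub>F n in sequentially. f y * indicator {y. real n < norm y} y = 0"
        by (intro eventually_mono[OF eventually_ge_at_top[of n0]]) (auto simp: indicator_def)
    qed
    show "AE y in lborel. f y * indicator {y. real n < norm y} y \<le> f y" for n
      by (intro AE_I2) (simp split: split_indicator)
  qed (use fin in simp_all)
  then have "\<forall>\<^sub>F n in sequentially. (\<integral>\<^sup>+y. f y * indicator {y. real n < norm y} y \<partial>lborel) < ennreal \<delta>"
    using \<delta> by (intro order_tendstoD) auto
  then obtain n0 where n0: "\<And>n. n \<ge> n0 \<Longrightarrow> (\<integral>\<^sup>+y. f y * indicator {y. real n < norm y} y \<partial>lborel) < ennreal \<delta>"
    by (auto simp: eventually_sequentially)
  show ?thesis by (rule that[OF _ n0[of "Suc n0"]]) simp_all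
qed

lemma powr_neg_tendsto_zero:
  fixes p :: real
  assumes "p > 0" "\<epsilon> > 0"
  obtains R where "R > 0" "\<forall>r\<ge>R. r powr - p \<le> \<epsilon>"
proof -
  have "((\<lambda>r. r powr - p) \<longlongrightarrow> 0) at_top" using assms by real_asymp
  then have "\<forall>\<^sub>F r in at_top. r powr - p < \<epsilon>" using assms by (intro order_tendstoD)
  then obtain R where R: "\<forall>r\<ge>R. r powr - p < \<epsilon>" by (auto simp: eventually_at_top_linorder)
  show ?thesis by (rule that[of "max 1 R"]) (use R in \<open>auto intro: less_imp_le\<close>)
qed

context
  fixes \<alpha> :: real and space_type :: "'a::euclidean_space itself"
  assumes \<alpha>: "1 < \<alpha>" "\<alpha> < 2"
begin

abbreviation (input) w :: "'a \<Rightarrow> real" where "w \<equiv> tail_weight \<alpha>"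

text \<open>This has the size and the scaling of the stable kernel at time \<open>t\<close>.\<close>

definition rescaled_weight :: "real \<Rightarrow> 'a \<Rightarrow> real" where
  "rescaled_weight t v = t powr - (DIM('a) / \<alpha>) * w (t powr - (1 / \<alpha>) *\<^sub>R v)"

lemma rescaled_weight_measurable [measurable]:
  "(\<lambda>x. rescaled_weight (f x) (g x)) \<in> borel_measurable M"
  if [measurable]: "f \<in> borel_measurable M" "g \<in> borel_measurable M"
  unfolding rescaled_weight_def by measurable

lemma rescaled_weight_nonneg [simp]: "0 \<le> rescaled_weight t v"
  by (simp add: rescaled_weight_def)

lemma rescaled_weight_le_time: "t > 0 \<Longrightarrow> rescaled_weight t v \<le> t powr - (DIM('a) / \<alpha>)"
  using \<alpha> by (simp add: rescaled_weight_def mult_left_le tail_weight_le_one)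

lemma rescaled_weight_le_space:
  assumes "t > 0" "0 < \<rho>" "\<rho> \<le> norm v"
  shows "rescaled_weight t v \<le> t * \<rho> powr - (DIM('a) + \<alpha>)"
proof -
  have "w (t powr - (1 / \<alpha>) *\<^sub>R v) \<le> (t powr - (1 / \<alpha>) * \<rho>) powr - (DIM('a) + \<alpha>)"
    using assms \<alpha> by (intro tail_weight_le_powr) auto
  also have "\<dots> = t powr (DIM('a) / \<alpha> + 1) * \<rho> powr - (DIM('a) + \<alpha>)"
  proof -
    have "- (1 / \<alpha>) * - (DIM('a) + \<alpha>) = DIM('a) / \<alpha> + 1" using \<alpha> by (simp add: field_simps)
    then show ?thesis using assms by (simp only: powr_mult powr_powr)
  qed
  finally have "rescaled_weight t v \<le> t powr - (DIM('a) / \<alpha>) * (t powr (DIM('a) / \<alpha> + 1) * \<rho> powr - (DIM('a) + \<alpha>))"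
    unfolding rescaled_weight_def by (rule mult_left_mono) simp
  also have "\<dots> = t * \<rho> powr - (DIM('a) + \<alpha>)"
    using assms by (simp add: mult.assoc[symmetric] powr_add[symmetric])
  finally show ?thesis .
qed

definition weight_mass :: real where
  "weight_mass = (LINT x::'a|lborel. w x)"

lemma weight_mass_nonneg: "weight_mass \<ge> 0"
  by (simp add: weight_mass_def)

lemma nn_integral_tail_weight: "(\<integral>\<^sup>+x. ennreal (w (x::'a)) \<partial>lborel) = ennreal weight_mass"
  unfolding weight_mass_def using \<alpha> by (intro nn_integral_eq_integral integrable_tail_weight) auto

lemma nn_integral_rescaled_weight:
  assumes t: "t > 0"
  shows "(\<integral>\<^sup>+v. ennreal (rescaled_weight t v) \<partial>lborel) = ennreal weight_mass"
proof -
  have "(\<integral>\<^sup>+v. ennreal (rescaled_weight t v) \<partial>lborel)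
     = ennreal (t powr - (DIM('a) / \<alpha>)) * (\<integral>\<^sup>+v. ennreal (w (t powr - (1 / \<alpha>) *\<^sub>R v - (0::'a))) \<partial>lborel)"
    by (simp add: rescaled_weight_def ennreal_mult nn_integral_cmult)
  also have "\<dots> = ennreal (t powr - (DIM('a) / \<alpha>)) * (ennreal ((t powr - (1 / \<alpha>)) powr - real DIM('a)) * ennreal weight_mass)"
    using t by (subst nn_integral_lborel_affine) (auto simp: nn_integral_tail_weight)
  also have "\<dots> = ennreal weight_mass"
    using t by (simp add: ennreal_mult[symmetric] mult.assoc[symmetric] powr_powr powr_add[symmetric] weight_mass_nonneg)
  finally show ?thesis .
qed

text \<open>The mechanism behind \<open>w\<^sub>1\<^sub>-\<^sub>s * w\<^sub>s \<le> C w\<^sub>1\<close> for the rescaled weights: one of the two increments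
  \<open>z = s powr (1 / \<alpha>) * y\<close> and \<open>x - z\<close> is at least \<open>\<bar>x\<bar> / 2\<close>, and the weight of that increment is at
  most a multiple of \<open>w x\<close>. If \<open>\<bar>x\<bar> \<le> 1\<close>, the role of the large increment is played by the larger of the
  times \<open>s\<close> and \<open>1 - s\<close>.\<close>

lemma weight_convolution_pointwise:
  fixes x y :: 'a
  assumes s: "0 < s" "s < 1"
  shows "rescaled_weight (1 - s) (s powr (1 / \<alpha>) *\<^sub>R y - x) * w y
    \<le> 2 powr (DIM('a) + \<alpha>) * w x * (s powr (DIM('a) / \<alpha>) * rescaled_weight (1 - s) (s powr (1 / \<alpha>) *\<^sub>R y - x) + w y)"
    (is "?W * ?t \<le> ?C * ?tx * (?sd * ?W + ?t)")
proof -
  define z where "z = s powr (1 / \<alpha>) *\<^sub>R y"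
  have t: "?t = ?sd * rescaled_weight s z"
    using s by (simp add: rescaled_weight_def z_def mult.assoc[symmetric] powr_add[symmetric])
  have W0: "?W \<ge> 0" "?t \<ge> 0" "?tx \<ge> 0" "?C \<ge> 0" "?sd \<ge> 0" by auto
  have D0: "?C * ?tx * (?sd * ?W) \<ge> 0" "?C * ?tx * ?t \<ge> 0" using W0 by auto
  show ?thesis
  proof (cases "norm x \<le> 1")
    case True
    then have tx: "?tx = 1" by (simp add: tail_weight_def)
    have C: "2 powr (DIM('a) / \<alpha>) \<le> ?C"
    proof (rule powr_mono)
      have "real DIM('a) / \<alpha> \<le> DIM('a) / 1" using \<alpha> by (intro divide_left_mono) auto
      then show "real DIM('a) / \<alpha> \<le> DIM('a) + \<alpha>" using \<alpha> by simp
    qed simp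
    have half: "r powr - (DIM('a) / \<alpha>) \<le> ?C" if "r \<ge> 1 / 2" for r :: real
    proof -
      have "r powr - (DIM('a) / \<alpha>) \<le> (1 / 2) powr - (DIM('a) / \<alpha>)"
        using that \<alpha> by (intro powr_mono2') auto
      also have "\<dots> = 2 powr (DIM('a) / \<alpha>)" by (simp add: powr_divide powr_minus_divide)
      finally show ?thesis using C by (rule order_trans)
    qed
    show ?thesis
    proof (cases "s \<le> 1 / 2")
      case True
      have "?W \<le> ?C" using rescaled_weight_le_time[of "1 - s"] half[of "1 - s"] s True by (force intro: order_trans)
      then have "?W * ?t \<le> ?C * ?t" by (rule mult_right_mono) simp
      then show ?thesis using D0 unfolding tx distrib_left mult_1_right by linarith
    next
      case False
      have "?t \<le> 1" using \<alpha> by (intro tail_weight_le_one) simp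
      also have "1 = s powr - (DIM('a) / \<alpha>) * ?sd" using s by (simp add: powr_add[symmetric])
      also have "\<dots> \<le> ?C * ?sd" using half[of s] False by (intro mult_right_mono) auto
      finally have "?W * ?t \<le> ?W * (?C * ?sd)" by (rule mult_left_mono) simp
      also have "?W * (?C * ?sd) = ?C * (?sd * ?W)" by simp
      finally show ?thesis using D0 unfolding tx distrib_left mult_1_right by linarith
    qed
  next
    case False
    have tx: "(norm x / 2) powr - (DIM('a) + \<alpha>) = ?C * ?tx"
    proof -
      have "w x = norm x powr - (DIM('a) + \<alpha>)" using False by (simp add: tail_weight_def max_def)
      moreover have "2 powr - (DIM('a) + \<alpha>) * 2 powr (DIM('a) + \<alpha>) = 1" by (simp add: powr_add[symmetric])
      ultimately show ?thesis using False by (simp add: powr_divide divide_eq_eq mult_ac)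
    qed
    have xp: "0 < norm x / 2" using False by linarith
    have n: "norm z \<ge> norm x / 2 \<or> norm (z - x) \<ge> norm x / 2"
      using norm_triangle_ineq2[of x z] by (auto simp: norm_minus_commute)
    then show ?thesis
    proof
      assume a: "norm z \<ge> norm x / 2"
      have "rescaled_weight s z \<le> s * (?C * ?tx)"
        using rescaled_weight_le_space[OF s(1) xp a] unfolding tx .
      also have "\<dots> \<le> 1 * (?C * ?tx)" using s by (intro mult_right_mono) auto
      finally have "?W * ?t \<le> ?W * (?sd * (?C * ?tx))" unfolding t by (intro mult_left_mono) auto
      also have "?W * (?sd * (?C * ?tx)) = ?C * ?tx * (?sd * ?W)" by simp
      finally show ?thesis using D0 unfolding distrib_left by linarith
    next
      assume a: "norm (z - x) \<ge> norm x / 2"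
      have "?W \<le> (1 - s) * (?C * ?tx)"
        using rescaled_weight_le_space[OF _ xp a, of "1 - s"] s unfolding tx z_def by simp
      also have "\<dots> \<le> 1 * (?C * ?tx)" using s by (intro mult_right_mono) auto
      finally have "?W * ?t \<le> (?C * ?tx) * ?t" by (intro mult_right_mono) auto
      then show ?thesis using D0 unfolding distrib_left by linarith
    qed
  qed
qed

text \<open>The size of \<open>\<nabla>p(1 - s, x, z)\<close> at \<open>z = s powr (1 / \<alpha>) * y\<close>, times \<open>s powr (1 / \<alpha> - 1)\<close>: this power
  is what remains of \<open>u(s, z) powr (1 + q) dz\<close> after the self-similar substitution, because
  \<open>d * q = \<alpha> - 1\<close>.\<close>

definition duhamel_density :: "real \<Rightarrow> 'a \<Rightarrow> 'a \<Rightarrow> real" where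
  "duhamel_density s x y = s powr (1 / \<alpha> - 1) * ((1 - s) powr - ((DIM('a) + 1) / \<alpha>) *
     tail_weight (\<alpha> + 1) ((1 - s) powr - (1 / \<alpha>) *\<^sub>R (s powr (1 / \<alpha>) *\<^sub>R y - x)))"

lemma duhamel_density_measurable [measurable]:
  assumes [measurable]: "f \<in> borel_measurable M" "g \<in> borel_measurable M" "h \<in> borel_measurable M"
  shows "(\<lambda>x. duhamel_density (f x) (g x) (h x)) \<in> borel_measurable M"
  unfolding duhamel_density_def by measurable

lemma duhamel_density_nonneg [simp]: "0 \<le> duhamel_density s x y"
  by (simp add: duhamel_density_def)

lemma duhamel_density_le:
  assumes "0 < s" "s < 1"
  shows "duhamel_density s x y \<le> s powr (1 / \<alpha> - 1) * (1 - s) powr - (1 / \<alpha>) * rescaled_weight (1 - s) (s powr (1 / \<alpha>) *\<^sub>R y - x)"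
proof -
  have "(1 - s) powr - ((DIM('a) + 1) / \<alpha>) = (1 - s) powr - (1 / \<alpha>) * (1 - s) powr - (DIM('a) / \<alpha>)"
    using assms by (simp add: powr_add[symmetric] add_divide_distrib)
  then show ?thesis
    unfolding duhamel_density_def rescaled_weight_def
    by (simp only: mult.assoc) (intro mult_left_mono tail_weight_antimono; simp)
qed

text \<open>The integral over the times in \<open>S\<close> only. The times close to 1, where the gradient of the kernel is
  singular, have to be separated from the others.\<close>

definition duhamel_weight :: "real set \<Rightarrow> 'a \<Rightarrow> 'a \<Rightarrow> ennreal" where
  "duhamel_weight S x y = (\<integral>\<^sup>+s. ennreal (duhamel_density s x y) * indicator S s \<partial>lborel)"

lemma duhamel_weight_measurable [measurable]:
  assumes [measurable]: "S \<in> sets borel" "f \<in> borel_measurable M" "g \<in> borel_measurable M"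
  shows "(\<lambda>x. duhamel_weight S (f x) (g x)) \<in> borel_measurable M"
  unfolding duhamel_weight_def by measurable

text \<open>The total mass of \<open>s powr (1 / \<alpha> - 1) * (1 - s) powr - (1 / \<alpha>)\<close>; it is finite because \<open>\<alpha> > 1\<close>.\<close>

definition beta_mass :: real where "beta_mass = Beta (1 / \<alpha>) (1 - 1 / \<alpha>)"

lemma beta_mass_nonneg: "beta_mass \<ge> 0"
  using \<alpha> by (simp add: beta_mass_def Beta_def Gamma_real_nonneg)

lemma nn_integral_beta_mass:
  "(\<integral>\<^sup>+s. ennreal (s powr (1 / \<alpha> - 1) * (1 - s) powr - (1 / \<alpha>)) * indicator {0<..<1} s \<partial>lborel) = ennreal beta_mass"
  using nn_integral_beta[of "1 / \<alpha>" "1 - 1 / \<alpha>"] \<alpha> by (simp add: beta_mass_def)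

lemma nn_integral_beta_mass_le:
  assumes F: "\<And>s. 0 < s \<Longrightarrow> s < 1 \<Longrightarrow> F s \<le> c * ennreal (s powr (1 / \<alpha> - 1) * (1 - s) powr - (1 / \<alpha>))"
    and S: "S \<subseteq> {0<..<1}"
  shows "(\<integral>\<^sup>+s. F s * indicator S s \<partial>lborel) \<le> c * ennreal beta_mass"
proof -
  have "(\<integral>\<^sup>+s. F s * indicator S s \<partial>lborel)
     \<le> (\<integral>\<^sup>+s. c * (ennreal (s powr (1 / \<alpha> - 1) * (1 - s) powr - (1 / \<alpha>)) * indicator {0<..<1} s) \<partial>lborel)"
    using S F by (intro nn_integral_mono) (auto split: split_indicator)
  also have "\<dots> = c * ennreal beta_mass"
    by (subst nn_integral_cmult) (simp_all add: nn_integral_beta_mass)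
  finally show ?thesis .
qed

lemma duhamel_weight_integral_x:
  "(\<integral>\<^sup>+x. duhamel_weight {0<..<1} x y \<partial>lborel) \<le> ennreal (weight_mass * beta_mass)"
proof -
  have "(\<integral>\<^sup>+x. duhamel_weight {0<..<1} x y \<partial>lborel)
      = (\<integral>\<^sup>+s. (\<integral>\<^sup>+x. ennreal (duhamel_density s x y) * indicator {0<..<1} s \<partial>lborel) \<partial>lborel)"
    unfolding duhamel_weight_def by (rule lborel_pair.Fubini') measurable
  also have "\<dots> = (\<integral>\<^sup>+s. (\<integral>\<^sup>+x. ennreal (duhamel_density s x y) \<partial>lborel) * indicator {0<..<1} s \<partial>lborel)"
    by (simp add: nn_integral_multc)
  also have "\<dots> \<le> ennreal weight_mass * ennreal beta_mass"
  proof (rule nn_integral_beta_mass_le)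
    fix s :: real assume s: "0 < s" "s < 1"
    have "(\<integral>\<^sup>+x. ennreal (duhamel_density s x y) \<partial>lborel)
      \<le> (\<integral>\<^sup>+x. ennreal (s powr (1 / \<alpha> - 1) * (1 - s) powr - (1 / \<alpha>)) * ennreal (rescaled_weight (1 - s) (s powr (1 / \<alpha>) *\<^sub>R y - x)) \<partial>lborel)"
      using duhamel_density_le[OF s] by (intro nn_integral_mono) (auto simp: ennreal_mult[symmetric] intro!: ennreal_leI)
    also have "\<dots> = ennreal (s powr (1 / \<alpha> - 1) * (1 - s) powr - (1 / \<alpha>)) * ennreal weight_mass"
      using s nn_integral_lborel_reflect[where f="\<lambda>v. ennreal (rescaled_weight (1 - s) v)"]
      by (subst nn_integral_cmult) (auto simp: nn_integral_rescaled_weight)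
    finally show "(\<integral>\<^sup>+x. ennreal (duhamel_density s x y) \<partial>lborel)
       \<le> ennreal weight_mass * ennreal (s powr (1 / \<alpha> - 1) * (1 - s) powr - (1 / \<alpha>))" by (simp add: mult.commute)
  qed simp
  finally show ?thesis by (simp add: ennreal_mult weight_mass_nonneg beta_mass_nonneg)
qed

lemma duhamel_weight_tail_weight:
  obtains C where "C \<ge> 0" "\<And>x. (\<integral>\<^sup>+y. duhamel_weight {0<..<1} x y * ennreal (w y) \<partial>lborel) \<le> ennreal (C * w x)"
proof
  define C where "C = 2 powr (DIM('a) + \<alpha>) * (2 * weight_mass)"
  show "C * beta_mass \<ge> 0" by (simp add: C_def weight_mass_nonneg beta_mass_nonneg)
  fix x :: 'a
  have "(\<integral>\<^sup>+y. duhamel_weight {0<..<1} x y * ennreal (w y) \<partial>lborel)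
      = (\<integral>\<^sup>+y. (\<integral>\<^sup>+s. ennreal (duhamel_density s x y * w y) * indicator {0<..<1} s \<partial>lborel) \<partial>lborel)"
    unfolding duhamel_weight_def by (subst nn_integral_multc[symmetric]) (auto simp: ennreal_mult mult_ac)
  also have "\<dots> = (\<integral>\<^sup>+s. (\<integral>\<^sup>+y. ennreal (duhamel_density s x y * w y) * indicator {0<..<1} s \<partial>lborel) \<partial>lborel)"
    by (rule lborel_pair.Fubini') measurable
  also have "\<dots> = (\<integral>\<^sup>+s. (\<integral>\<^sup>+y. ennreal (duhamel_density s x y * w y) \<partial>lborel) * indicator {0<..<1} s \<partial>lborel)"
    by (simp add: nn_integral_multc)
  also have "\<dots> \<le> ennreal (C * w x) * ennreal beta_mass"
  proof (rule nn_integral_beta_mass_le)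
    fix s :: real assume s: "0 < s" "s < 1"
    let ?W = "\<lambda>y. rescaled_weight (1 - s) (s powr (1 / \<alpha>) *\<^sub>R y - x)"
    let ?k = "s powr (1 / \<alpha> - 1) * (1 - s) powr - (1 / \<alpha>)"
    let ?c = "2 powr (DIM('a) + \<alpha>) * w x"
    have "duhamel_density s x y * w y \<le> ?k * (?c * (s powr (DIM('a) / \<alpha>) * ?W y + w y))" for y
    proof -
      have "duhamel_density s x y * w y \<le> ?k * ?W y * w y"
        by (intro mult_right_mono duhamel_density_le s) simp
      also have "\<dots> = ?k * (?W y * w y)" by simp
      also have "\<dots> \<le> ?k * (?c * (s powr (DIM('a) / \<alpha>) * ?W y + w y))"
        by (intro mult_left_mono weight_convolution_pointwise s) auto
      finally show ?thesis .
    qed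
    then have "(\<integral>\<^sup>+y. ennreal (duhamel_density s x y * w y) \<partial>lborel)
       \<le> (\<integral>\<^sup>+y. ennreal (?k * ?c) * (ennreal (s powr (DIM('a) / \<alpha>)) * ennreal (?W y) + ennreal (w y)) \<partial>lborel)"
      by (intro nn_integral_mono) (auto simp: ennreal_mult[symmetric] ennreal_plus[symmetric] mult.assoc simp del: ennreal_plus intro!: ennreal_leI)
    also have "\<dots> = ennreal (?k * ?c) * (ennreal (s powr (DIM('a) / \<alpha>)) * (\<integral>\<^sup>+y. ennreal (?W y) \<partial>lborel) + ennreal weight_mass)"
      by (simp add: nn_integral_cmult nn_integral_add nn_integral_tail_weight)
    also have "(\<integral>\<^sup>+y. ennreal (?W y) \<partial>lborel) = ennreal ((s powr (1 / \<alpha>)) powr - real DIM('a)) * ennreal weight_mass"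
      using s by (subst nn_integral_lborel_affine) (auto simp: nn_integral_rescaled_weight)
    also have "ennreal (s powr (DIM('a) / \<alpha>)) * (ennreal ((s powr (1 / \<alpha>)) powr - real DIM('a)) * ennreal weight_mass) = ennreal weight_mass"
      using s by (simp add: ennreal_mult[symmetric] mult.assoc[symmetric] powr_powr powr_add[symmetric] weight_mass_nonneg)
    also have "ennreal (?k * ?c) * (ennreal weight_mass + ennreal weight_mass) = ennreal (C * w x) * ennreal ?k"
      by (simp add: ennreal_mult[symmetric] ennreal_plus[symmetric] weight_mass_nonneg C_def mult_ac del: ennreal_plus)
    finally show "(\<integral>\<^sup>+y. ennreal (duhamel_density s x y * w y) \<partial>lborel) \<le> ennreal (C * w x) * ennreal ?k" .
  qed simp
  also have "\<dots> = ennreal (C * beta_mass * w x)"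
    by (simp add: ennreal_mult[symmetric] C_def weight_mass_nonneg beta_mass_nonneg mult_ac)
  finally show "(\<integral>\<^sup>+y. duhamel_weight {0<..<1} x y * ennreal (w y) \<partial>lborel) \<le> ennreal (C * beta_mass * w x)" .
qed

text \<open>For \<open>\<bar>y\<bar> \<le> \<bar>x\<bar> / 2\<close> the gradient kernel is only evaluated at distance at least \<open>\<bar>x\<bar> / 2\<close>, where
  its time singularity is absent and the spatial decay is one power better than that of the kernel.\<close>

lemma duhamel_weight_far:
  fixes x y :: 'a
  assumes "x \<noteq> 0" "norm y \<le> norm x / 2"
  shows "duhamel_weight {0<..<1} x y \<le> ennreal ((norm x / 2) powr - (DIM('a) + (\<alpha> + 1)) * beta_mass)"
proof -
  let ?c = "(norm x / 2) powr - (DIM('a) + (\<alpha> + 1))"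
  have "duhamel_weight {0<..<1} x y \<le> ennreal ?c * ennreal beta_mass"
    unfolding duhamel_weight_def
  proof (rule nn_integral_beta_mass_le)
    fix s :: real assume s: "0 < s" "s < 1"
    let ?z = "s powr (1 / \<alpha>) *\<^sub>R y"
    have "norm ?z \<le> 1 * norm y"
      using s \<alpha> by (simp add: powr_le1 mult_right_le_one_le mult_left_le_one_le)
    then have z: "norm (?z - x) \<ge> norm x / 2"
      using assms norm_triangle_ineq2[of x ?z] by (simp add: norm_minus_commute)
    have "tail_weight (\<alpha> + 1) ((1 - s) powr - (1 / \<alpha>) *\<^sub>R (?z - x)) \<le> ((1 - s) powr - (1 / \<alpha>) * (norm x / 2)) powr - (DIM('a) + (\<alpha> + 1))"
    proof (rule tail_weight_le_powr)
      show "(1 - s) powr - (1 / \<alpha>) * (norm x / 2) \<le> norm ((1 - s) powr - (1 / \<alpha>) *\<^sub>R (?z - x))"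
        unfolding norm_scaleR abs_of_nonneg[OF powr_ge_zero] by (rule mult_left_mono[OF z]) simp
    qed (use assms s \<alpha> in auto)
    also have "\<dots> = (1 - s) powr ((DIM('a) + 1) / \<alpha> + 1) * ?c"
    proof -
      have "- (1 / \<alpha>) * - (DIM('a) + (\<alpha> + 1)) = (DIM('a) + 1) / \<alpha> + 1" using \<alpha> by (simp add: field_simps)
      then show ?thesis using assms s by (simp only: powr_mult powr_powr)
    qed
    finally have "duhamel_density s x y \<le> s powr (1 / \<alpha> - 1) * ((1 - s) powr - ((DIM('a) + 1) / \<alpha>) * ((1 - s) powr ((DIM('a) + 1) / \<alpha> + 1) * ?c))"
      unfolding duhamel_density_def by (intro mult_left_mono) auto
    also have "\<dots> = s powr (1 / \<alpha> - 1) * ((1 - s) * ?c)"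
      using s by (simp add: mult.assoc[symmetric] powr_add[symmetric])
    also have "\<dots> \<le> s powr (1 / \<alpha> - 1) * ((1 - s) powr - (1 / \<alpha>) * ?c)"
    proof -
      have "(1 - s) powr 1 \<le> (1 - s) powr - (1 / \<alpha>)" using s \<alpha> by (intro powr_mono') (auto intro: order_trans[of _ 0])
      then show ?thesis using s by (intro mult_left_mono mult_right_mono) auto
    qed
    finally have "duhamel_density s x y \<le> ?c * (s powr (1 / \<alpha> - 1) * (1 - s) powr - (1 / \<alpha>))"
      by (simp add: mult_ac)
    then show "ennreal (duhamel_density s x y) \<le> ennreal ?c * ennreal (s powr (1 / \<alpha> - 1) * (1 - s) powr - (1 / \<alpha>))"
      by (subst ennreal_mult[symmetric]) (auto intro: ennreal_leI)
  qed simp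
  then show ?thesis by (simp add: ennreal_mult beta_mass_nonneg)
qed

lemma duhamel_density_early:
  assumes "0 < s" "s < 1 - \<eta>" "\<eta> > 0"
  shows "duhamel_density s x y \<le> s powr (1 / \<alpha> - 1) * \<eta> powr - ((DIM('a) + 1) / \<alpha>)"
proof -
  have "(1 - s) powr - ((DIM('a) + 1) / \<alpha>) * tail_weight (\<alpha> + 1) ((1 - s) powr - (1 / \<alpha>) *\<^sub>R (s powr (1 / \<alpha>) *\<^sub>R y - x))
     \<le> \<eta> powr - ((DIM('a) + 1) / \<alpha>) * 1"
    using assms \<alpha> by (intro mult_mono powr_mono2' tail_weight_le_one) auto
  then show ?thesis unfolding duhamel_density_def by (intro mult_left_mono) auto
qed

lemma duhamel_weight_early:
  assumes \<eta>: "\<eta> > 0"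
  shows "duhamel_weight {0<..<1 - \<eta>} x y \<le> ennreal (\<eta> powr - ((DIM('a) + 1) / \<alpha>) * beta_mass)"
proof -
  let ?c = "\<eta> powr - ((DIM('a) + 1) / \<alpha>)"
  have "duhamel_weight {0<..<1 - \<eta>} x y
     = (\<integral>\<^sup>+s. (ennreal (duhamel_density s x y) * indicator {0<..<1 - \<eta>} s) * indicator {0<..<1} s \<partial>lborel)"
    unfolding duhamel_weight_def using \<eta> by (intro nn_integral_cong) (auto split: split_indicator)
  also have "\<dots> \<le> ennreal ?c * ennreal beta_mass"
  proof (rule nn_integral_beta_mass_le)
    fix s :: real assume s: "0 < s" "s < 1"
    have "duhamel_density s x y \<le> ?c * (s powr (1 / \<alpha> - 1) * (1 - s) powr - (1 / \<alpha>))" if "s < 1 - \<eta>"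
    proof -
      have "s powr (1 / \<alpha> - 1) * ?c * 1 \<le> s powr (1 / \<alpha> - 1) * ?c * (1 - s) powr - (1 / \<alpha>)"
      proof (rule mult_left_mono)
        have "(1 - s) powr 0 \<le> (1 - s) powr - (1 / \<alpha>)" using s \<alpha> by (intro powr_mono') auto
        then show "1 \<le> (1 - s) powr - (1 / \<alpha>)" using s by simp
      qed simp
      then show ?thesis using duhamel_density_early[OF s(1) that \<eta>, of x y] by (simp add: mult_ac)
    qed
    then show "ennreal (duhamel_density s x y) * indicator {0<..<1 - \<eta>} s \<le> ennreal ?c * ennreal (s powr (1 / \<alpha> - 1) * (1 - s) powr - (1 / \<alpha>))"
      by (subst ennreal_mult[symmetric]) (auto intro: ennreal_leI split: split_indicator)
  qed simp
  finally show ?thesis by (simp add: ennreal_mult beta_mass_nonneg)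
qed

text \<open>A small power \<open>\<eta> powr \<theta>\<close> is split off from \<open>(1 - s) powr - (1 / \<alpha>)\<close>. The choice of \<open>\<theta>\<close> as half of
  \<open>1 - 1 / \<alpha>\<close> leaves the exponent \<open>\<theta> - 1 > - 1\<close>, so that the rest is still integrable.\<close>

lemma duhamel_weight_late:
  obtains C \<theta> where "C \<ge> 0" "\<theta> > 0"
    "\<And>\<eta> x. 0 < \<eta> \<Longrightarrow> \<eta> \<le> 1 / 2 \<Longrightarrow> (\<integral>\<^sup>+y. duhamel_weight {1 - \<eta>..<1} x y \<partial>lborel) \<le> ennreal (C * \<eta> powr \<theta>)"
proof -
  define \<theta> where "\<theta> = (1 - 1 / \<alpha>) / 2"
  define C where "C = weight_mass * 2 powr (DIM('a) / \<alpha>) * Beta (1 / \<alpha>) \<theta>"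
  have \<theta>: "\<theta> > 0" using \<alpha> by (simp add: \<theta>_def)
  have B0: "Beta (1 / \<alpha>) \<theta> \<ge> 0" unfolding Beta_def
    using \<alpha> \<theta> by (intro divide_nonneg_nonneg mult_nonneg_nonneg less_imp_le[OF Gamma_real_pos]) (auto intro: add_pos_pos)
  show ?thesis
  proof (rule that[of C \<theta>])
    show "C \<ge> 0" using B0 by (simp add: C_def weight_mass_nonneg)
    fix \<eta> :: real and x :: 'a
    assume \<eta>: "0 < \<eta>" "\<eta> \<le> 1 / 2"
    let ?k = "\<lambda>s. s powr (1 / \<alpha> - 1) * (1 - s) powr (\<theta> - 1)"
    let ?c = "weight_mass * 2 powr (DIM('a) / \<alpha>) * \<eta> powr \<theta>"
    have "(\<integral>\<^sup>+y. duhamel_weight {1 - \<eta>..<1} x y \<partial>lborel)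
        = (\<integral>\<^sup>+s. (\<integral>\<^sup>+y. ennreal (duhamel_density s x y) * indicator {1 - \<eta>..<1} s \<partial>lborel) \<partial>lborel)"
      unfolding duhamel_weight_def by (rule lborel_pair.Fubini') measurable
    also have "\<dots> = (\<integral>\<^sup>+s. (\<integral>\<^sup>+y. ennreal (duhamel_density s x y) \<partial>lborel) * indicator {1 - \<eta>..<1} s \<partial>lborel)"
      by (simp add: nn_integral_multc)
    also have "\<dots> \<le> (\<integral>\<^sup>+s. ennreal ?c * (ennreal (?k s) * indicator {0<..<1} s) \<partial>lborel)"
    proof (rule nn_integral_mono)
      fix s :: real
      show "(\<integral>\<^sup>+y. ennreal (duhamel_density s x y) \<partial>lborel) * indicator {1 - \<eta>..<1} s \<le> ennreal ?c * (ennreal (?k s) * indicator {0<..<1} s)"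
      proof (cases "s \<in> {1 - \<eta>..<1}")
        case True
        then have s: "0 < s" "s < 1" "s \<ge> 1 / 2" "1 - s \<le> \<eta>" using \<eta> by auto
        let ?m = "s powr (1 / \<alpha> - 1) * (1 - s) powr - (1 / \<alpha>)"
        have "(\<integral>\<^sup>+y. ennreal (duhamel_density s x y) \<partial>lborel)
          \<le> (\<integral>\<^sup>+y. ennreal ?m * ennreal (rescaled_weight (1 - s) (s powr (1 / \<alpha>) *\<^sub>R y - x)) \<partial>lborel)"
          using duhamel_density_le[OF s(1,2)] by (intro nn_integral_mono) (auto simp: ennreal_mult[symmetric] intro!: ennreal_leI)
        also have "\<dots> = ennreal ?m * (\<integral>\<^sup>+y. ennreal (rescaled_weight (1 - s) (s powr (1 / \<alpha>) *\<^sub>R y - x)) \<partial>lborel)"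
          by (rule nn_integral_cmult) measurable
        also have "(\<integral>\<^sup>+y. ennreal (rescaled_weight (1 - s) (s powr (1 / \<alpha>) *\<^sub>R y - x)) \<partial>lborel)
           = ennreal ((s powr (1 / \<alpha>)) powr - real DIM('a)) * ennreal weight_mass"
          using s by (subst nn_integral_lborel_affine) (auto simp: nn_integral_rescaled_weight)
        also have "ennreal ?m * (ennreal ((s powr (1 / \<alpha>)) powr - real DIM('a)) * ennreal weight_mass)
           = ennreal (?m * ((s powr (1 / \<alpha>)) powr - real DIM('a) * weight_mass))"
          by (simp add: ennreal_mult[symmetric] weight_mass_nonneg)
        also have "\<dots> \<le> ennreal (?c * ?k s)"
        proof (rule ennreal_leI)
          have 1: "(s powr (1 / \<alpha>)) powr - real DIM('a) \<le> 2 powr (DIM('a) / \<alpha>)"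
          proof -
            have "s powr - (DIM('a) / \<alpha>) \<le> (1 / 2) powr - (DIM('a) / \<alpha>)"
              using s \<alpha> by (intro powr_mono2') auto
            then show ?thesis by (simp add: powr_powr powr_divide powr_minus_divide)
          qed
          have 2: "(1 - s) powr - (1 / \<alpha>) \<le> \<eta> powr \<theta> * (1 - s) powr (\<theta> - 1)"
          proof -
            have "(1 - s) powr - (1 / \<alpha>) = (1 - s) powr \<theta> * (1 - s) powr (\<theta> - 1)"
              using s by (simp add: powr_add[symmetric] \<theta>_def)
            also have "\<dots> \<le> \<eta> powr \<theta> * (1 - s) powr (\<theta> - 1)"
              using s \<theta> by (intro mult_right_mono powr_mono2) auto
            finally show ?thesis .
          qed
          have "?m * ((s powr (1 / \<alpha>)) powr - real DIM('a) * weight_mass)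
             \<le> (s powr (1 / \<alpha> - 1) * (\<eta> powr \<theta> * (1 - s) powr (\<theta> - 1))) * (2 powr (DIM('a) / \<alpha>) * weight_mass)"
            using 1 2 by (intro mult_mono mult_left_mono mult_right_mono) (auto simp: weight_mass_nonneg)
          then show "?m * ((s powr (1 / \<alpha>)) powr - real DIM('a) * weight_mass) \<le> ?c * ?k s"
            by (simp add: mult_ac)
        qed
        finally show ?thesis using True s by (simp add: ennreal_mult weight_mass_nonneg)
      qed simp
    qed
    also have "\<dots> = ennreal ?c * ennreal (Beta (1 / \<alpha>) \<theta>)"
      using \<alpha> \<theta> by (subst nn_integral_cmult) (auto simp: nn_integral_beta)
    also have "\<dots> = ennreal (C * \<eta> powr \<theta>)"
      using B0 by (simp add: ennreal_mult[symmetric] weight_mass_nonneg C_def mult_ac)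
    finally show "(\<integral>\<^sup>+y. duhamel_weight {1 - \<eta>..<1} x y \<partial>lborel) \<le> ennreal (C * \<eta> powr \<theta>)" .
  qed (rule \<theta>)
qed

section \<open>Tail bounds from the integral inequality\<close>

abbreviation (input) duhamel_op :: "real set \<Rightarrow> ('a \<Rightarrow> ennreal) \<Rightarrow> 'a \<Rightarrow> ennreal" where
  "duhamel_op S f x \<equiv> \<integral>\<^sup>+y. duhamel_weight S x y * f y \<partial>lborel"

abbreviation (input) h :: "'a \<Rightarrow> 'a \<Rightarrow> ennreal" where
  "h \<equiv> duhamel_weight {0<..<1}"

abbreviation (input) H :: "('a \<Rightarrow> ennreal) \<Rightarrow> 'a \<Rightarrow> ennreal" where
  "H f x \<equiv> \<integral>\<^sup>+y. h x y * f y \<partial>lborel"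

abbreviation (input) far_weight :: "'a \<Rightarrow> real" where
  "far_weight x \<equiv> (norm x / 2) powr - (DIM('a) + (\<alpha> + 1))"

context
  fixes q C1 M :: real and U :: "'a \<Rightarrow> real"
  assumes q: "0 < q" and C1: "0 \<le> C1" and M: "0 \<le> M"
    and U [measurable]: "U \<in> borel_measurable borel" and U0: "\<And>x. 0 \<le> U x"
    and Uint: "integrable lborel U" and Uint': "integrable lborel (\<lambda>y. U y * U y powr q)"
    and Ubd: "\<exists>K. AE y in lborel. U y \<le> K"
    and U_upper: "\<And>x. ennreal (U x) \<le> ennreal (M * w x) +
        ennreal C1 * H (\<lambda>y. ennreal (U y * U y powr q)) x"
begin

abbreviation (input) source :: "'a \<Rightarrow> ennreal" where
  "source y \<equiv> ennreal (U y * U y powr q)"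

text \<open>
  The hypotheses of this context are all that is known about the profile \<open>U\<close> at time 1: integrability,
  boundedness almost everywhere, and the integral inequality. Integrals of nonnegative functions are
  taken in the extended nonnegative reals, where Tonelli's theorem needs no integrability.
\<close>

definition duhamel_potential :: "'a \<Rightarrow> ennreal" where
  "duhamel_potential x = H source x"

definition source_mass :: real where
  "source_mass = (LINT y|lborel. U y * U y powr q)"

lemma source_mass_nonneg: "source_mass \<ge> 0"
  unfolding source_mass_def by (intro Bochner_Integration.integral_nonneg mult_nonneg_nonneg U0) simp

lemma nn_integral_source: "(\<integral>\<^sup>+y. source y \<partial>lborel) = ennreal source_mass"
  unfolding source_mass_def by (intro nn_integral_eq_integral Uint' AE_I2 mult_nonneg_nonneg U0) simp

lemma duhamel_weight_meas [measurable]: "duhamel_weight S x \<in> borel_measurable borel" if "S \<in> sets borel"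
proof -
  have "(\<lambda>y. duhamel_weight S x y) \<in> borel_measurable borel"
    by (rule duhamel_weight_measurable[OF that]) auto
  then show ?thesis .
qed

lemma duhamel_potential_late:
  obtains C \<theta> where "C \<ge> 0" "\<theta> > 0" "\<forall>\<eta> x. 0 < \<eta> \<longrightarrow> \<eta> \<le> 1 / 2 \<longrightarrow>
    duhamel_op {1 - \<eta>..<1} source x \<le> ennreal (C * \<eta> powr \<theta>)"
proof -
  obtain K0 where K0: "AE y in lborel. U y \<le> K0" using Ubd by blast
  define K where "K = max 0 K0 * max 0 K0 powr q"
  have "K \<ge> 0" by (simp add: K_def)
  have K: "AE y in lborel. source y \<le> ennreal K"
    using K0 by eventually_elim (use U0 q in \<open>auto simp: K_def intro!: ennreal_leI mult_mono powr_mono2\<close>)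
  obtain C \<theta> where C: "C \<ge> 0" "\<theta> > 0"
    "\<forall>\<eta> (x::'a). 0 < \<eta> \<longrightarrow> \<eta> \<le> 1 / 2 \<longrightarrow> (\<integral>\<^sup>+y. duhamel_weight {1 - \<eta>..<1} x y \<partial>lborel) \<le> ennreal (C * \<eta> powr \<theta>)"
    using duhamel_weight_late by metis
  show ?thesis
  proof (rule that[of "K * C" \<theta>])
    show "\<forall>\<eta> x. 0 < \<eta> \<longrightarrow> \<eta> \<le> 1 / 2 \<longrightarrow>
      duhamel_op {1 - \<eta>..<1} source x \<le> ennreal (K * C * \<eta> powr \<theta>)"
    proof (intro allI impI)
      fix \<eta> :: real and x :: 'a assume \<eta>: "0 < \<eta>" "\<eta> \<le> 1 / 2"
      have "duhamel_op {1 - \<eta>..<1} source x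
         \<le> duhamel_op {1 - \<eta>..<1} (\<lambda>y. ennreal K) x"
        by (rule nn_integral_mono_AE, rule AE_mp[OF K], rule AE_I2, rule impI, rule mult_left_mono) auto
      also have "\<dots> = (\<integral>\<^sup>+y. duhamel_weight {1 - \<eta>..<1} x y \<partial>lborel) * ennreal K"
        by (rule nn_integral_multc) measurable
      also have "\<dots> \<le> ennreal (C * \<eta> powr \<theta>) * ennreal K"
        using C(3) \<eta> by (intro mult_right_mono) auto
      also have "\<dots> = ennreal (K * C * \<eta> powr \<theta>)"
        using \<open>K \<ge> 0\<close> C by (simp add: ennreal_mult[symmetric] mult_ac)
      finally show "duhamel_op {1 - \<eta>..<1} source x \<le> ennreal (K * C * \<eta> powr \<theta>)" .
    qed
  qed (use C \<open>K \<ge> 0\<close> in auto)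
qed

lemma duhamel_weight_split:
  assumes "0 < \<eta>" "\<eta> < 1"
  shows "h x y = duhamel_weight {0<..<1 - \<eta>} x y + duhamel_weight {1 - \<eta>..<1} x (y::'a)"
proof -
  have ind: "indicator {0<..<1} s = indicator {0<..<1 - \<eta>} s + (indicator {1 - \<eta>..<1} s :: ennreal)" for s :: real
    using assms by (auto simp: indicator_def)
  have [measurable]: "(\<lambda>s. duhamel_density s x y) \<in> borel_measurable borel"
    using duhamel_density_measurable[of "\<lambda>s. s" borel "\<lambda>_. x" "\<lambda>_. y"] by simp
  show ?thesis
    unfolding duhamel_weight_def ind distrib_left by (rule nn_integral_add) measurable
qed

lemma duhamel_weight_early_le:
  assumes "0 < \<eta>" "\<eta> < 1"
  shows "duhamel_weight {0<..<1 - \<eta>} x (y::'a) \<le> h x y"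
  using duhamel_weight_split[OF assms, of x y] by (simp only: le_iff_add) blast

lemma duhamel_potential_near:
  assumes R: "R > 0" and x: "2 * R \<le> norm x"
  shows "H (\<lambda>y. (source y * indicator {y. norm y \<le> R} y)) x
     \<le> ennreal (far_weight x * beta_mass * source_mass)"
proof -
  let ?c = "far_weight x * beta_mass"
  have "H (\<lambda>y. (source y * indicator {y. norm y \<le> R} y)) x
    \<le> (\<integral>\<^sup>+y. ennreal ?c * source y \<partial>lborel)"
  proof (rule nn_integral_mono)
    fix y :: 'a
    have "x \<noteq> 0" using R x by auto
    then show "h x y * (source y * indicator {y. norm y \<le> R} y)
       \<le> ennreal ?c * source y"
      using duhamel_weight_far[of x y] x by (auto intro!: mult_right_mono split: split_indicator)
  qed
  also have "\<dots> = ennreal ?c * ennreal source_mass"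
    by (simp add: nn_integral_cmult nn_integral_source)
  also have "\<dots> = ennreal (?c * source_mass)"
    using beta_mass_nonneg source_mass_nonneg by (simp add: ennreal_mult[symmetric])
  finally show ?thesis .
qed

lemma duhamel_potential_early:
  assumes \<eta>: "0 < \<eta>" and [measurable]: "A \<in> sets borel"
  shows "duhamel_op {0<..<1 - \<eta>} (\<lambda>y. (source y * indicator A y)) x
     \<le> ennreal (\<eta> powr - ((DIM('a) + 1) / \<alpha>) * beta_mass) * (\<integral>\<^sup>+y. source y * indicator A y \<partial>lborel)"
proof -
  let ?V = "\<lambda>y. source y * indicator A y"
  have "duhamel_op {0<..<1 - \<eta>} ?V x
    \<le> (\<integral>\<^sup>+y. ennreal (\<eta> powr - ((DIM('a) + 1) / \<alpha>) * beta_mass) * ?V y \<partial>lborel)"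
    by (intro nn_integral_mono mult_right_mono duhamel_weight_early[OF \<eta>]) simp
  also have "\<dots> = ennreal (\<eta> powr - ((DIM('a) + 1) / \<alpha>) * beta_mass) * (\<integral>\<^sup>+y. ?V y \<partial>lborel)"
    by (rule nn_integral_cmult) measurable
  finally show ?thesis .
qed

lemma duhamel_potential_eq_split:
  assumes \<eta>: "0 < \<eta>" "\<eta> < 1"
  shows "duhamel_potential x = duhamel_op {0<..<1 - \<eta>} source x
     + duhamel_op {1 - \<eta>..<1} source x"
proof -
  have "duhamel_potential x = (\<integral>\<^sup>+y. duhamel_weight {0<..<1 - \<eta>} x y * source y
      + duhamel_weight {1 - \<eta>..<1} x y * source y \<partial>lborel)"
    unfolding duhamel_potential_def by (simp only: duhamel_weight_split[OF \<eta>] distrib_right)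
  also have "\<dots> = duhamel_op {0<..<1 - \<eta>} source x
     + duhamel_op {1 - \<eta>..<1} source x"
    by (rule nn_integral_add) measurable
  finally show ?thesis .
qed

lemma duhamel_potential_bounded:
  obtains K where "K \<ge> 0" "\<forall>x. duhamel_potential x \<le> ennreal K"
proof -
  obtain C \<theta> where C: "C \<ge> 0" "\<theta> > 0" "\<forall>\<eta> x. 0 < \<eta> \<longrightarrow> \<eta> \<le> 1 / 2 \<longrightarrow>
    duhamel_op {1 - \<eta>..<1} source x \<le> ennreal (C * \<eta> powr \<theta>)"
    by (rule duhamel_potential_late)
  define c where "c = (1 / 2) powr - ((DIM('a) + 1) / \<alpha>) * beta_mass"
  have c: "c \<ge> 0" using beta_mass_nonneg by (simp add: c_def)
  show ?thesis
  proof (rule that[of "c * source_mass + C * (1 / 2) powr \<theta>"])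
    show "0 \<le> c * source_mass + C * (1 / 2) powr \<theta>" using c C source_mass_nonneg by simp
    show "\<forall>x. duhamel_potential x \<le> ennreal (c * source_mass + C * (1 / 2) powr \<theta>)"
    proof
      fix x :: 'a
      have "duhamel_op {0<..<1 - 1 / 2} source x \<le> ennreal c * ennreal source_mass"
        using duhamel_potential_early[of "1 / 2" UNIV x] by (simp add: nn_integral_source c_def)
      moreover have "duhamel_op {1 - 1 / 2..<1} source x \<le> ennreal (C * (1 / 2) powr \<theta>)"
        using C(3)[rule_format, of "1 / 2" x] by simp
      ultimately have "duhamel_potential x \<le> ennreal c * ennreal source_mass + ennreal (C * (1 / 2) powr \<theta>)"
        using duhamel_potential_eq_split[of "1 / 2" x] by (simp add: add_mono)
      then show "duhamel_potential x \<le> ennreal (c * source_mass + C * (1 / 2) powr \<theta>)"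
        using c C source_mass_nonneg by (simp add: ennreal_mult ennreal_plus)
    qed
  qed
qed

text \<open>Three small contributions: times in \<open>[1 - \<eta>, 1)\<close>, by boundedness of \<open>U\<close>; earlier times and large \<open>y\<close>, where the
  weight is bounded and the tail of the integrable function \<open>U powr (1 + q)\<close> is small; and small \<open>y\<close>,
  where the weight itself decays in \<open>x\<close>.\<close>

lemma duhamel_potential_decay:
  assumes \<epsilon>: "\<epsilon> > 0"
  obtains R where "R > 0" "\<forall>x. norm x \<ge> R \<longrightarrow> duhamel_potential x \<le> ennreal \<epsilon>"
proof -
  obtain C \<theta> where C: "C \<ge> 0" "\<theta> > 0" "\<forall>\<eta> x. 0 < \<eta> \<longrightarrow> \<eta> \<le> 1 / 2 \<longrightarrow>
    duhamel_op {1 - \<eta>..<1} source x \<le> ennreal (C * \<eta> powr \<theta>)"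
    by (rule duhamel_potential_late)
  obtain R1 where R1: "R1 > 0" "\<forall>r\<ge>R1. r powr - \<theta> \<le> \<epsilon> / 3 / (C + 1)"
    using powr_neg_tendsto_zero[of \<theta> "\<epsilon> / 3 / (C + 1)"] C \<epsilon> by auto
  define \<eta> where "\<eta> = 1 / max 2 R1"
  have \<eta>: "0 < \<eta>" "\<eta> \<le> 1 / 2" by (auto simp: \<eta>_def field_simps)
  have "\<eta> powr \<theta> = max 2 R1 powr - \<theta>" by (simp add: \<eta>_def powr_divide powr_minus_divide)
  also have "\<dots> \<le> \<epsilon> / 3 / (C + 1)" using R1 by auto
  finally have "C * \<eta> powr \<theta> \<le> C * (\<epsilon> / 3 / (C + 1))" using C by (intro mult_left_mono) auto
  also have "\<dots> \<le> \<epsilon> / 3" using C \<epsilon> by (simp add: field_simps)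
  finally have late: "C * \<eta> powr \<theta> \<le> \<epsilon> / 3" .
  define c where "c = \<eta> powr - ((DIM('a) + 1) / \<alpha>) * beta_mass"
  have c: "c \<ge> 0" using beta_mass_nonneg by (simp add: c_def)
  obtain R2 where R2: "R2 > 0"
    "(\<integral>\<^sup>+y. source y * indicator {y. R2 < norm y} y \<partial>lborel) < ennreal (\<epsilon> / 3 / (c + 1))"
  proof (rule nn_integral_tail_small)
    show "(\<integral>\<^sup>+y. source y \<partial>lborel) < \<infinity>" by (simp add: nn_integral_source)
    show "\<epsilon> / 3 / (c + 1) > 0" using c \<epsilon> by simp
  qed auto
  define N where "N = beta_mass * source_mass"
  have N: "N \<ge> 0" using beta_mass_nonneg source_mass_nonneg by (simp add: N_def)
  obtain R3 where R3: "R3 > 0" "\<forall>r\<ge>R3. r powr - (DIM('a) + (\<alpha> + 1)) \<le> \<epsilon> / 3 / (N + 1)"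
    using powr_neg_tendsto_zero[of "DIM('a) + (\<alpha> + 1)" "\<epsilon> / 3 / (N + 1)"] N \<epsilon> \<alpha> by auto
  show ?thesis
  proof (rule that[of "max (2 * R2) (2 * R3)"])
    show "max (2 * R2) (2 * R3) > 0" using R2 by auto
    show "\<forall>x. max (2 * R2) (2 * R3) \<le> norm x \<longrightarrow> duhamel_potential x \<le> ennreal \<epsilon>"
    proof (intro allI impI)
      fix x :: 'a assume x: "max (2 * R2) (2 * R3) \<le> norm x"
      let ?V = "\<lambda>y. source y"
      have "duhamel_op {0<..<1 - \<eta>} ?V x
        \<le> (\<integral>\<^sup>+y. h x y * (?V y * indicator {y. norm y \<le> R2} y)
           + duhamel_weight {0<..<1 - \<eta>} x y * (?V y * indicator {y. R2 < norm y} y) \<partial>lborel)"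
        using duhamel_weight_early_le[of \<eta> x] \<eta>
        by (intro nn_integral_mono) (auto split: split_indicator intro!: mult_right_mono)
      also have "\<dots> = H (\<lambda>y. (?V y * indicator {y. norm y \<le> R2} y)) x
           + duhamel_op {0<..<1 - \<eta>} (\<lambda>y. (?V y * indicator {y. R2 < norm y} y)) x"
        by (rule nn_integral_add) measurable
      also have "\<dots> \<le> ennreal (far_weight x * N) + ennreal c * ennreal (\<epsilon> / 3 / (c + 1))"
      proof (rule add_mono)
        show "H (\<lambda>y. (?V y * indicator {y. norm y \<le> R2} y)) x \<le> ennreal (far_weight x * N)"
          using duhamel_potential_near[of R2 x] R2 x by (simp add: N_def mult.assoc)
        have "duhamel_op {0<..<1 - \<eta>} (\<lambda>y. (?V y * indicator {y. R2 < norm y} y)) x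
           \<le> ennreal c * (\<integral>\<^sup>+y. ?V y * indicator {y. R2 < norm y} y \<partial>lborel)"
          unfolding c_def by (rule duhamel_potential_early[OF \<eta>(1)]) measurable
        also have "\<dots> \<le> ennreal c * ennreal (\<epsilon> / 3 / (c + 1))"
          by (intro mult_left_mono less_imp_le[OF R2(2)]) simp
        finally show "duhamel_op {0<..<1 - \<eta>} (\<lambda>y. (?V y * indicator {y. R2 < norm y} y)) x \<le> ennreal c * ennreal (\<epsilon> / 3 / (c + 1))" .
      qed
      also have "\<dots> \<le> ennreal (\<epsilon> / 3) + ennreal (\<epsilon> / 3)"
      proof (rule add_mono)
        have "far_weight x * N \<le> \<epsilon> / 3 / (N + 1) * N"
          using R3 x N by (intro mult_right_mono) auto
        also have "\<dots> \<le> \<epsilon> / 3" using N \<epsilon> by (simp add: field_simps)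
        finally show "ennreal (far_weight x * N) \<le> ennreal (\<epsilon> / 3)" by (rule ennreal_leI)
        have "c * (\<epsilon> / 3 / (c + 1)) \<le> \<epsilon> / 3" using c \<epsilon> by (simp add: field_simps)
        then show "ennreal c * ennreal (\<epsilon> / 3 / (c + 1)) \<le> ennreal (\<epsilon> / 3)"
          using c \<epsilon> by (subst ennreal_mult[symmetric]) (auto intro: ennreal_leI)
      qed
      finally have early: "duhamel_op {0<..<1 - \<eta>} ?V x \<le> ennreal (\<epsilon> / 3) + ennreal (\<epsilon> / 3)" .
      have "\<eta> < 1" using \<eta> by simp
      have "duhamel_potential x \<le> (ennreal (\<epsilon> / 3) + ennreal (\<epsilon> / 3)) + ennreal (\<epsilon> / 3)"
        unfolding duhamel_potential_eq_split[OF \<eta>(1) \<open>\<eta> < 1\<close>]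
        by (intro add_mono early order_trans[OF C(3)[rule_format, OF \<eta>] ennreal_leI[OF late]])
      also have "\<dots> = ennreal \<epsilon>" using \<epsilon> by (simp add: ennreal_plus[symmetric] del: ennreal_plus)
      finally show "duhamel_potential x \<le> ennreal \<epsilon>" .
    qed
  qed
qed

lemma solution_decay:
  assumes \<epsilon>: "\<epsilon> > 0"
  obtains R where "R > 0" "\<forall>x. norm x \<ge> R \<longrightarrow> U x \<le> \<epsilon>"
proof -
  have "\<epsilon> / 2 / (C1 + 1) > 0" using \<epsilon> C1 by simp
  then obtain R1 where R1: "R1 > 0" "\<forall>x. norm x \<ge> R1 \<longrightarrow> duhamel_potential x \<le> ennreal (\<epsilon> / 2 / (C1 + 1))"
    using duhamel_potential_decay by blast
  obtain R2 where R2: "R2 > 0" "\<forall>r\<ge>R2. r powr - (DIM('a) + \<alpha>) \<le> \<epsilon> / 2 / (M + 1)"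
    using powr_neg_tendsto_zero[of "DIM('a) + \<alpha>" "\<epsilon> / 2 / (M + 1)"] M \<epsilon> \<alpha> by auto
  show ?thesis
  proof (rule that[of "max R1 R2"])
    show "max R1 R2 > 0" using R1 by auto
    show "\<forall>x. max R1 R2 \<le> norm x \<longrightarrow> U x \<le> \<epsilon>"
    proof (intro allI impI)
      fix x :: 'a assume x: "max R1 R2 \<le> norm x"
      have "w x \<le> norm x powr - (DIM('a) + \<alpha>)"
        using x R1 \<alpha> by (intro tail_weight_le_powr) auto
      also have "\<dots> \<le> \<epsilon> / 2 / (M + 1)" using R2 x by auto
      finally have "M * w x \<le> M * (\<epsilon> / 2 / (M + 1))" using M by (intro mult_left_mono)
      also have "\<dots> \<le> \<epsilon> / 2" using M \<epsilon> by (simp add: field_simps)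
      finally have 1: "M * w x \<le> \<epsilon> / 2" .
      have "ennreal C1 * duhamel_potential x \<le> ennreal C1 * ennreal (\<epsilon> / 2 / (C1 + 1))"
        using R1 x by (intro mult_left_mono) auto
      also have "\<dots> = ennreal (C1 * (\<epsilon> / 2 / (C1 + 1)))" using C1 \<epsilon> by (simp add: ennreal_mult[symmetric])
      also have "\<dots> \<le> ennreal (\<epsilon> / 2)" using C1 \<epsilon> by (intro ennreal_leI) (simp add: field_simps)
      finally have "ennreal C1 * duhamel_potential x \<le> ennreal (\<epsilon> / 2)" .
      then have "ennreal (U x) \<le> ennreal (\<epsilon> / 2) + ennreal (\<epsilon> / 2)"
        by (intro order_trans[OF U_upper[of x, folded duhamel_potential_def]] add_mono ennreal_leI 1)
      also have "\<dots> = ennreal \<epsilon>" using \<epsilon> by (simp add: ennreal_plus[symmetric] del: ennreal_plus)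
      finally show "U x \<le> \<epsilon>" using \<epsilon> by (simp add: ennreal_le_iff)
    qed
  qed
qed

lemma far_powr_le_tail_weight:
  fixes x :: 'a
  assumes "norm x \<ge> 1"
  shows "far_weight x \<le> 2 powr (DIM('a) + (\<alpha> + 1)) * w x / norm x"
proof -
  define p where "p = real DIM('a) + \<alpha>"
  have "w x = norm x powr - p"
    using assms by (simp add: tail_weight_def max_def p_def)
  moreover have "norm x powr - (p + 1) = norm x powr - p / norm x"
    using assms powr_add[of "norm x" "- p" "- 1"] by (simp add: powr_minus_divide)
  moreover have "(norm x / 2) powr - (p + 1) = 2 powr (p + 1) * norm x powr - (p + 1)"
    by (simp add: powr_divide powr_minus_divide del: minus_add_distrib)
  moreover have "real DIM('a) + (\<alpha> + 1) = p + 1" by (simp add: p_def)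
  ultimately show ?thesis by (simp only: times_divide_eq_right order_refl)
qed

text \<open>Outside a large ball \<open>U powr q \<le> \<epsilon>\<close>, which makes the critical nonlinearity a small linear term.\<close>

lemma duhamel_potential_near_far:
  assumes \<epsilon>: "\<epsilon> > 0"
  obtains R N where "R \<ge> 1" "N \<ge> 0" "\<forall>x. norm x \<ge> R \<longrightarrow>
     duhamel_potential x \<le> ennreal (N * w x / norm x) + ennreal \<epsilon> * H (\<lambda>y. ennreal (U y)) x"
proof -
  obtain R where R: "R > 0" "\<forall>x. norm x \<ge> R \<longrightarrow> U x \<le> \<epsilon> powr (1 / q)"
    using solution_decay[of "\<epsilon> powr (1 / q)"] \<epsilon> by auto
  have Rq: "U y powr q \<le> \<epsilon>" if "norm y \<ge> R" for y
  proof -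
    have "U y powr q \<le> (\<epsilon> powr (1 / q)) powr q" using R that U0 q by (intro powr_mono2) auto
    then show ?thesis using q \<epsilon> by (simp add: powr_powr)
  qed
  define N where "N = 2 powr (DIM('a) + (\<alpha> + 1)) * (beta_mass * source_mass)"
  have N: "N \<ge> 0" using beta_mass_nonneg source_mass_nonneg by (simp add: N_def)
  show ?thesis
  proof (rule that[of "max 1 (2 * R)", OF _ N], simp, intro allI impI)
    fix x :: 'a assume "max 1 (2 * R) \<le> norm x"
    then have x: "2 * R \<le> norm x" "1 \<le> norm x" by auto
    have "far_weight x * (beta_mass * source_mass) \<le> (2 powr (DIM('a) + (\<alpha> + 1)) * w x / norm x) * (beta_mass * source_mass)"
      by (intro mult_right_mono far_powr_le_tail_weight x mult_nonneg_nonneg beta_mass_nonneg source_mass_nonneg)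
    then have n: "far_weight x * beta_mass * source_mass \<le> N * w x / norm x"
      by (simp add: N_def mult_ac)
    let ?V = "\<lambda>y. source y"
    have "duhamel_potential x \<le> (\<integral>\<^sup>+y. h x y * (?V y * indicator {y. norm y \<le> R} y)
        + ennreal \<epsilon> * (h x y * ennreal (U y)) \<partial>lborel)"
      unfolding duhamel_potential_def
    proof (rule nn_integral_mono)
      fix y :: 'a
      show "h x y * ?V y \<le> h x y * (?V y * indicator {y. norm y \<le> R} y)
        + ennreal \<epsilon> * (h x y * ennreal (U y))"
      proof (cases "norm y \<le> R")
        case False
        then have "?V y \<le> ennreal (\<epsilon> * U y)"
          using Rq[of y] U0[of y] mult_left_mono[of "U y powr q" \<epsilon> "U y"] by (intro ennreal_leI) (simp add: mult.commute)
        then have "h x y * ?V y \<le> h x y * ennreal (\<epsilon> * U y)"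
          by (intro mult_left_mono) auto
        then show ?thesis using False \<epsilon> U0[of y] by (simp add: ennreal_mult mult_ac)
      qed simp
    qed
    also have "\<dots> = H (\<lambda>y. (?V y * indicator {y. norm y \<le> R} y)) x
        + ennreal \<epsilon> * H (\<lambda>y. ennreal (U y)) x"
      by (subst nn_integral_add) (auto simp: nn_integral_cmult)
    also have "\<dots> \<le> ennreal (N * w x / norm x) + ennreal \<epsilon> * H (\<lambda>y. ennreal (U y)) x"
      by (intro add_right_mono order_trans[OF duhamel_potential_near[OF R(1) x(1)] ennreal_leI[OF n]])
    finally show "duhamel_potential x \<le> ennreal (N * w x / norm x) + ennreal \<epsilon> * H (\<lambda>y. ennreal (U y)) x" .
  qed
qed

text \<open>The proof compares \<open>U\<close> with \<open>A * w\<close>. The number \<open>\<epsilon>\<close> is so small that, with \<open>\<epsilon>' = C1 * \<epsilon>\<close>, the operator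
  \<open>\<epsilon>' * H\<close> maps \<open>w\<close> to at most \<open>w / 2\<close> and has norm at most 1/2 on integrable functions. The first fact turns the linear inequality for \<open>U\<close>
  into one for the excess \<open>V\<close> of \<open>U\<close> over \<open>A * w\<close>, and the second one makes \<open>V\<close> vanish almost everywhere.
  Then \<open>H V = 0\<close>, and the inequality \<open>V \<le> \<epsilon>' * H V\<close> holds at every point, so \<open>V\<close> vanishes everywhere.\<close>

theorem upper_tail_bound:
  obtains A where "A > 0" "\<forall>x. U x \<le> A * w x"
proof -
  obtain C2 where C2: "C2 \<ge> 0" "\<And>x::'a. H (\<lambda>y. ennreal (w y)) x \<le> ennreal (C2 * w x)"
    using duhamel_weight_tail_weight by metis
  obtain K where K: "K \<ge> 0" "\<forall>x. duhamel_potential x \<le> ennreal K" using duhamel_potential_bounded by metis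
  obtain J where J: "J \<ge> 0" "\<And>y::'a. (\<integral>\<^sup>+x. h x y \<partial>lborel) \<le> ennreal J"
    using duhamel_weight_integral_x mult_nonneg_nonneg[OF weight_mass_nonneg beta_mass_nonneg] by metis
  define \<epsilon> where "\<epsilon> = 1 / (2 * (C1 + 1) * (C2 + J + 1))"
  have \<epsilon>: "\<epsilon> > 0" using C1 C2 J by (simp add: \<epsilon>_def)
  define \<epsilon>' where "\<epsilon>' = C1 * \<epsilon>"
  have \<epsilon>': "\<epsilon>' \<ge> 0" using C1 \<epsilon> by (simp add: \<epsilon>'_def)
  have "C1 / (C1 + 1) \<le> 1" using C1 by simp
  then have "C1 / (C1 + 1) * (1 / (2 * (C2 + J + 1))) \<le> 1 * (1 / (2 * (C2 + J + 1)))"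
    using C2 J by (intro mult_right_mono) auto
  moreover have "\<epsilon>' = C1 / (C1 + 1) * (1 / (2 * (C2 + J + 1)))"
    by (simp only: \<epsilon>'_def \<epsilon>_def times_divide_times_eq mult_1_right times_divide_eq_right divide_divide_eq_left) (simp only: mult_ac)
  ultimately have \<epsilon>'le: "\<epsilon>' \<le> 1 / (2 * (C2 + J + 1))" by (simp only: mult_1_left)
  have "1 / (2 * (C2 + J + 1)) * C2 \<le> 1 / 2" "1 / (2 * (C2 + J + 1)) * J \<le> 1 / 2"
    using C2(1) J(1) by (simp_all add: field_simps)
  then have half: "\<epsilon>' * C2 \<le> 1 / 2" "\<epsilon>' * J \<le> 1 / 2"
    using mult_right_mono[OF \<epsilon>'le C2(1)] mult_right_mono[OF \<epsilon>'le J(1)] by linarith+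
  obtain R N where R: "R \<ge> 1" and N: "N \<ge> 0" and near_far: "\<forall>x. norm x \<ge> R \<longrightarrow>
     duhamel_potential x \<le> ennreal (N * w x / norm x) + ennreal \<epsilon> * H (\<lambda>y. ennreal (U y)) x"
    by (rule duhamel_potential_near_far[OF \<epsilon>])
  let ?HU = "\<lambda>x. H (\<lambda>y. ennreal (U y)) x"
  define A1 where "A1 = 1 + M + C1 * N + C1 * K * R powr (DIM('a) + \<alpha>)"
  have A1: "A1 > 0" using M C1 N K by (simp add: A1_def add_pos_nonneg)
  have lin: "ennreal (U x) \<le> ennreal (A1 * w x) + ennreal \<epsilon>' * ?HU x" for x
  proof (cases "norm x \<ge> R")
    case True
    have n: "N * w x / norm x \<le> N * w x"
      using True R N mult_left_mono[of 1 "norm x" "N * w x"] by (subst pos_divide_le_eq) auto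
    have "ennreal C1 * duhamel_potential x \<le> ennreal C1 * (ennreal (N * w x) + ennreal \<epsilon> * ?HU x)"
      by (intro mult_left_mono order_trans[OF near_far[rule_format, OF True]] add_right_mono ennreal_leI n) simp
    then have "ennreal (U x) \<le> ennreal (M * w x) + ennreal C1 * (ennreal (N * w x) + ennreal \<epsilon> * ?HU x)"
      by (intro order_trans[OF U_upper[of x, folded duhamel_potential_def]] add_left_mono)
    also have "\<dots> = ennreal (M * w x + C1 * (N * w x)) + ennreal \<epsilon>' * ?HU x"
      using M C1 N \<epsilon> by (simp add: distrib_left ennreal_mult ennreal_plus \<epsilon>'_def add.assoc mult.assoc)
    also have "\<dots> \<le> ennreal (A1 * w x) + ennreal \<epsilon>' * ?HU x"
    proof (intro add_right_mono ennreal_leI)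
      have "(M + C1 * N) * w x \<le> A1 * w x"
        using C1 K by (intro mult_right_mono) (auto simp: A1_def)
      then show "M * w x + C1 * (N * w x) \<le> A1 * w x" by (simp add: algebra_simps)
    qed
    finally show ?thesis .
  next
    case False
    have "R powr - (DIM('a) + \<alpha>) \<le> w x"
      unfolding tail_weight_def using False \<alpha> by (intro powr_mono2') (use R in auto)
    then have "R powr (DIM('a) + \<alpha>) * R powr - (DIM('a) + \<alpha>) \<le> R powr (DIM('a) + \<alpha>) * w x"
      by (rule mult_left_mono) simp
    moreover have "R powr (DIM('a) + \<alpha>) * R powr - (DIM('a) + \<alpha>) = 1"
      using R by (simp add: powr_add[symmetric])
    ultimately have "C1 * K * 1 \<le> C1 * K * (R powr (DIM('a) + \<alpha>) * w x)"
      using C1 K by (intro mult_left_mono) auto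
    moreover have "A1 * w x = w x + M * w x + C1 * N * w x + C1 * K * (R powr (DIM('a) + \<alpha>) * w x)"
      by (simp add: A1_def algebra_simps)
    moreover have "C1 * N * w x \<ge> 0" "w x \<ge> 0" using C1 N by auto
    ultimately have le: "M * w x + C1 * K \<le> A1 * w x" by linarith
    have "ennreal (U x) \<le> ennreal (M * w x) + ennreal C1 * ennreal K"
      using K(2) by (intro order_trans[OF U_upper[of x, folded duhamel_potential_def]] add_left_mono mult_left_mono) auto
    also have "\<dots> = ennreal (M * w x + C1 * K)" using M C1 K by (simp add: ennreal_mult ennreal_plus)
    also have "\<dots> \<le> ennreal (A1 * w x)" by (rule ennreal_leI[OF le])
    finally show ?thesis by (rule order_trans) simp
  qed
  define A where "A = 2 * A1"
  define V where "V x = ennreal (U x - A * w x)" for x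
  have Vm [measurable]: "V \<in> borel_measurable borel" unfolding V_def by measurable
  have UV: "ennreal (U x) \<le> ennreal (A * w x) + V x" for x
    unfolding V_def using A1 by (cases "U x \<ge> A * w x")
      (auto simp: ennreal_plus[symmetric] ennreal_neg A_def simp del: ennreal_plus intro: ennreal_leI)
  have VH: "V x \<le> ennreal \<epsilon>' * H V x" (is "_ \<le> _ * ?HV x") for x
  proof -
    have "?HU x \<le> (\<integral>\<^sup>+y. ennreal A * (h x y * ennreal (w y)) + h x y * V y \<partial>lborel)"
    proof (rule nn_integral_mono)
      fix y :: 'a
      have "h x y * ennreal (U y) \<le> h x y * (ennreal (A * w y) + V y)"
        by (intro mult_left_mono UV) simp
      then show "h x y * ennreal (U y) \<le> ennreal A * (h x y * ennreal (w y)) + h x y * V y"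
        using A1 by (simp add: A_def ennreal_mult distrib_left mult_ac)
    qed
    also have "\<dots> = ennreal A * H (\<lambda>y. ennreal (w y)) x + ?HV x"
      by (subst nn_integral_add) (auto simp: nn_integral_cmult)
    also have "\<dots> \<le> ennreal A * ennreal (C2 * w x) + ?HV x"
      by (intro add_right_mono mult_left_mono C2) simp
    finally have "ennreal \<epsilon>' * ?HU x \<le> ennreal \<epsilon>' * (ennreal A * ennreal (C2 * w x) + ?HV x)"
      by (intro mult_left_mono) auto
    also have "\<dots> = ennreal (\<epsilon>' * C2 * (A * w x)) + ennreal \<epsilon>' * ?HV x"
      using \<epsilon>' C2 A1 by (simp add: distrib_left ennreal_mult A_def mult_ac)
    also have "\<dots> \<le> ennreal (1 / 2 * (A * w x)) + ennreal \<epsilon>' * ?HV x"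
      using A1 by (intro add_right_mono ennreal_leI mult_right_mono half) (auto simp: A_def)
    finally have "ennreal (U x) \<le> ennreal (A1 * w x) + (ennreal (1 / 2 * (A * w x)) + ennreal \<epsilon>' * ?HV x)"
      by (intro order_trans[OF lin[of x]] add_left_mono)
    also have "\<dots> = ennreal (A * w x) + ennreal \<epsilon>' * ?HV x"
      using A1 by (simp add: A_def add.assoc[symmetric] ennreal_plus[symmetric] del: ennreal_plus)
    finally have "ennreal (U x) - ennreal (A * w x) \<le> ennreal \<epsilon>' * ?HV x"
      by (subst ennreal_minus_le_iff) auto
    then show ?thesis using A1 by (simp add: V_def ennreal_minus A_def)
  qed
  have Hm [measurable]: "(\<lambda>p. duhamel_weight {0<..<1} (fst p) (snd p)) \<in> borel_measurable (borel \<Otimes>\<^sub>M borel :: ('a \<times> 'a) measure)"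
    by (rule duhamel_weight_measurable) auto
  have IV: "(\<integral>\<^sup>+x. V x \<partial>lborel) \<le> ennreal (1 / 2) * (\<integral>\<^sup>+x. V x \<partial>lborel)"
  proof -
    have m2: "(\<lambda>p. duhamel_weight {0<..<1} (fst p) (snd p) * V (snd p)) \<in> borel_measurable (lborel \<Otimes>\<^sub>M lborel :: ('a \<times> 'a) measure)"
      by measurable
    have m1: "(\<lambda>x. \<integral>\<^sup>+y. h x y * V y \<partial>lborel) \<in> borel_measurable (lborel :: 'a measure)"
      using lborel.borel_measurable_nn_integral_fst[OF m2] by simp
    have "(\<integral>\<^sup>+x. H V x \<partial>lborel)
      = (\<integral>\<^sup>+y. (\<integral>\<^sup>+x. h x y * V y \<partial>lborel) \<partial>lborel)"
      using lborel_pair.Fubini[OF m2] by simp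
    also have "\<dots> \<le> (\<integral>\<^sup>+y. ennreal J * V y \<partial>lborel)"
    proof (rule nn_integral_mono)
      fix y :: 'a
      have "(\<lambda>x. h x y) \<in> borel_measurable lborel"
        using duhamel_weight_measurable[of "{0<..<1}" "\<lambda>x. x" lborel "\<lambda>_. y"] by simp
      then have "(\<integral>\<^sup>+x. h x y * V y \<partial>lborel) = (\<integral>\<^sup>+x. h x y \<partial>lborel) * V y"
        by (rule nn_integral_multc)
      also have "\<dots> \<le> ennreal J * V y" by (intro mult_right_mono J) simp
      finally show "(\<integral>\<^sup>+x. h x y * V y \<partial>lborel) \<le> ennreal J * V y" .
    qed
    also have "\<dots> = ennreal J * (\<integral>\<^sup>+y. V y \<partial>lborel)" by (rule nn_integral_cmult) measurable
    finally have inner: "(\<integral>\<^sup>+x. H V x \<partial>lborel) \<le> ennreal J * (\<integral>\<^sup>+y. V y \<partial>lborel)" .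
    have "(\<integral>\<^sup>+x. V x \<partial>lborel) \<le> (\<integral>\<^sup>+x. ennreal \<epsilon>' * H V x \<partial>lborel)"
      by (rule nn_integral_mono) (rule VH)
    also have "\<dots> = ennreal \<epsilon>' * (\<integral>\<^sup>+x. H V x \<partial>lborel)"
      by (rule nn_integral_cmult[OF m1])
    also have "\<dots> \<le> ennreal \<epsilon>' * (ennreal J * (\<integral>\<^sup>+y. V y \<partial>lborel))"
      by (rule mult_left_mono[OF inner]) simp
    also have "\<dots> = ennreal (\<epsilon>' * J) * (\<integral>\<^sup>+y. V y \<partial>lborel)" using \<epsilon>' J by (simp add: ennreal_mult mult.assoc)
    also have "\<dots> \<le> ennreal (1 / 2) * (\<integral>\<^sup>+y. V y \<partial>lborel)" by (intro mult_right_mono ennreal_leI half) simp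
    finally show ?thesis .
  qed
  have "(\<integral>\<^sup>+x. V x \<partial>lborel) \<le> (\<integral>\<^sup>+x. ennreal (U x) \<partial>lborel)"
    unfolding V_def using A1 by (intro nn_integral_mono ennreal_leI) (simp add: A_def)
  also have "\<dots> = ennreal (LINT x|lborel. U x)" using U0 Uint by (intro nn_integral_eq_integral) auto
  finally have Vfin: "(\<integral>\<^sup>+x. V x \<partial>lborel) \<noteq> \<infinity>" by (auto simp: top_unique)
  have "(\<integral>\<^sup>+x. V x \<partial>lborel) = 0"
  proof -
    obtain v where v: "(\<integral>\<^sup>+x. V x \<partial>lborel) = ennreal v" "v \<ge> 0" using Vfin by (cases "\<integral>\<^sup>+x. V x \<partial>lborel") auto
    then have "ennreal v \<le> ennreal (1 / 2 * v)" using IV by (simp add: ennreal_mult[symmetric] del: ennreal_half)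
    then show ?thesis using v by simp
  qed
  then have "AE x in lborel. V x = 0" by (simp add: nn_integral_0_iff_AE)
  then have "H V x = 0" for x
    by (subst nn_integral_0_iff_AE) auto
  then have V0: "V x = 0" for x using VH[of x] by simp
  show ?thesis
  proof (rule that[of A])
    show "A > 0" using A1 by (simp add: A_def)
    show "\<forall>x. U x \<le> A * w x"
      using V0 by (auto simp: V_def ennreal_eq_0_iff)
  qed
qed

text \<open>At infinity the Duhamel term takes away at most half of \<open>m * w\<close>: a quarter for \<open>y\<close> in the ball, because of
  the gain \<open>1 / \<bar>x\<bar>\<close>, and a quarter for the other \<open>y\<close>, because of \<open>\<epsilon>\<close>.\<close>

theorem lower_tail_bound:
  fixes m :: real
  assumes m: "m > 0" and lower: "\<And>x. ennreal (m * w x) \<le> ennreal (U x) + ennreal C1 * duhamel_potential x"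
    and cont: "continuous_on UNIV U" and pos: "\<And>x. 0 < U x"
  obtains c where "c > 0" "\<forall>x. c * w x \<le> U x"
proof -
  obtain A where A: "A > 0" "\<forall>x. U x \<le> A * w x" using upper_tail_bound by metis
  obtain C2 where C2: "C2 \<ge> 0" "\<And>x::'a. H (\<lambda>y. ennreal (w y)) x \<le> ennreal (C2 * w x)"
    using duhamel_weight_tail_weight by metis
  define \<epsilon> where "\<epsilon> = m / (4 * (C1 * A * C2 + 1))"
  have CAC: "C1 * A * C2 \<ge> 0" using C1 A C2 by simp
  have \<epsilon>: "\<epsilon> > 0" using m CAC by (simp add: \<epsilon>_def add_nonneg_pos)
  have \<epsilon>le: "C1 * \<epsilon> * A * C2 \<le> m / 4"
  proof -
    have "C1 * \<epsilon> * A * C2 = m / 4 * ((C1 * A * C2) / (C1 * A * C2 + 1))" by (simp add: \<epsilon>_def)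
    also have "\<dots> \<le> m / 4 * 1" using CAC m by (intro mult_left_mono) auto
    finally show ?thesis by simp
  qed
  obtain R N where R: "R \<ge> 1" and N: "N \<ge> 0" and near_far: "\<forall>x. norm x \<ge> R \<longrightarrow>
     duhamel_potential x \<le> ennreal (N * w x / norm x) + ennreal \<epsilon> * H (\<lambda>y. ennreal (U y)) x"
    by (rule duhamel_potential_near_far[OF \<epsilon>])
  define R' where "R' = max R (4 * C1 * N / m)"
  have far: "m / 2 * w x \<le> U x" if x: "norm x \<ge> R'" for x
  proof -
    have x1: "norm x \<ge> R" "norm x \<ge> 4 * C1 * N / m" using x by (auto simp: R'_def)
    have "H (\<lambda>y. ennreal (U y)) x
       \<le> (\<integral>\<^sup>+y. ennreal A * (h x y * ennreal (w y)) \<partial>lborel)"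
    proof (rule nn_integral_mono)
      fix y :: 'a
      have "h x y * ennreal (U y) \<le> h x y * ennreal (A * w y)"
        using A by (intro mult_left_mono ennreal_leI) auto
      then show "h x y * ennreal (U y) \<le> ennreal A * (h x y * ennreal (w y))"
        using A by (simp add: ennreal_mult mult_ac)
    qed
    also have "\<dots> = ennreal A * H (\<lambda>y. ennreal (w y)) x"
      by (rule nn_integral_cmult) measurable
    also have "\<dots> \<le> ennreal A * ennreal (C2 * w x)" by (intro mult_left_mono C2) simp
    finally have h: "H (\<lambda>y. ennreal (U y)) x \<le> ennreal A * ennreal (C2 * w x)" .
    have "duhamel_potential x \<le> ennreal (N * w x / norm x) + ennreal \<epsilon> * (ennreal A * ennreal (C2 * w x))"
      by (intro order_trans[OF near_far[rule_format, OF x1(1)]] add_mono mult_left_mono order_refl h) simp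
    then have "ennreal C1 * duhamel_potential x \<le> ennreal C1 * (ennreal (N * w x / norm x) + ennreal \<epsilon> * (ennreal A * ennreal (C2 * w x)))"
      by (rule mult_left_mono) simp
    also have "\<dots> = ennreal (C1 * N / norm x * w x + C1 * \<epsilon> * A * C2 * w x)"
      using C1 N \<epsilon> A C2 by (simp add: ennreal_mult[symmetric] ennreal_plus[symmetric] distrib_left mult.assoc del: ennreal_plus)
    also have "\<dots> \<le> ennreal (m / 2 * w x)"
    proof (rule ennreal_leI)
      have "norm x > 0" using x1 R by linarith
      then have "C1 * N / norm x \<le> m / 4" using x1(2) m by (simp add: field_simps)
      then have "(C1 * N / norm x + C1 * \<epsilon> * A * C2) * w x \<le> (m / 4 + m / 4) * w x"
        using \<epsilon>le by (intro mult_right_mono add_mono) auto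
      then show "C1 * N / norm x * w x + C1 * \<epsilon> * A * C2 * w x \<le> m / 2 * w x"
        by (simp add: algebra_simps)
    qed
    finally have "ennreal (m * w x) \<le> ennreal (U x) + ennreal (m / 2 * w x)"
      by (intro order_trans[OF lower[of x]] add_left_mono)
    also have "\<dots> = ennreal (U x + m / 2 * w x)" using U0 m by (simp add: ennreal_plus)
    finally have "m * w x \<le> U x + m / 2 * w x"
      using U0[of x] m by (subst (asm) ennreal_le_iff) auto
    then show ?thesis by simp
  qed
  have "\<exists>z\<in>cball 0 R'. \<forall>x\<in>cball 0 R'. U z \<le> U x"
    by (rule continuous_attains_inf) (use R in \<open>auto simp: R'_def intro: continuous_on_subset[OF cont]\<close>)
  then obtain z where z0: "\<forall>x\<in>cball 0 R'. U z \<le> U x" by blast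
  then have z: "U z \<le> U x" if "norm x \<le> R'" for x using that by simp
  show ?thesis
  proof (rule that[of "min (U z) (m / 2)"])
    show "min (U z) (m / 2) > 0" using pos m by simp
    show "\<forall>x. min (U z) (m / 2) * w x \<le> U x"
    proof
      fix x :: 'a
      show "min (U z) (m / 2) * w x \<le> U x"
      proof (cases "norm x \<ge> R'")
        case True
        have "min (U z) (m / 2) * w x \<le> m / 2 * w x" by (intro mult_right_mono) auto
        then show ?thesis using far[OF True] by linarith
      next
        case False
        have "min (U z) (m / 2) * w x \<le> U z * 1"
          using pos \<alpha> by (intro mult_mono tail_weight_le_one) (auto intro: less_imp_le)
        then show ?thesis using z[of x] False by simp
      qed
    qed
  qed
qed

end

end

section \<open>Two-sided estimate of the source solution\<close>

text \<open>The gradient is defined by a definite description, which uniqueness of derivatives evaluates.\<close>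

lemma gderiv_grad: "GDERIV f x :> D \<Longrightarrow> grad f x = D" for f :: "'b::real_inner \<Rightarrow> real"
  unfolding grad_def
proof (rule the_equality)
  fix D' assume D: "GDERIV f x :> D" and D': "GDERIV f x :> D'"
  have "(\<lambda>h. h \<bullet> D') = (\<lambda>h. h \<bullet> D)"
    using has_derivative_unique[OF D'[unfolded gderiv_def] D[unfolded gderiv_def]] .
  then have "(D' - D) \<bullet> D' = (D' - D) \<bullet> D" by metis
  then have "(D' - D) \<bullet> (D' - D) = 0" by (simp add: inner_diff_right)
  then show "D' = D" by simp
qed

context
  fixes \<alpha> :: real and space_type :: "'a::euclidean_space itself"
  assumes \<alpha>: "1 < \<alpha>" "\<alpha> < 2"
begin

definition stable_gradient :: "'a \<Rightarrow> 'a" where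
  "stable_gradient x = - (LINT \<xi>|lborel. (exp (- (norm \<xi> powr \<alpha>)) * sin (x \<bullet> \<xi>)) *\<^sub>R \<xi>)"

lemma stable_profile_has_derivative:
  "(stable_profile \<alpha> has_derivative (\<lambda>h. h \<bullet> stable_gradient x)) (at x)"
  using stable_profile_gderiv(2)[OF \<alpha>, of x] by (simp add: gderiv_def stable_gradient_def)

lemma stable_gradient_bound: "\<exists>C>0. \<forall>x. norm (stable_gradient x) \<le> C * tail_weight (\<alpha> + 1) x"
proof -
  obtain C where C: "C > 0" "\<forall>x::'a. \<exists>D. GDERIV (stable_profile \<alpha>) x :> D \<and> norm D \<le> C * tail_weight (\<alpha> + 1) x"
    using stable_profile_gradient_bound[OF \<alpha>] by blast
  have "norm (stable_gradient x) \<le> C * tail_weight (\<alpha> + 1) x" for x :: 'a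
  proof -
    obtain D where D: "GDERIV (stable_profile \<alpha>) x :> D" "norm D \<le> C * tail_weight (\<alpha> + 1) x"
      using C by blast
    have "GDERIV (stable_profile \<alpha>) x :> stable_gradient x"
      using stable_profile_has_derivative by (simp add: gderiv_def)
    then have "D = stable_gradient x" using gderiv_grad D(1) by blast
    then show ?thesis using D(2) by simp
  qed
  then show ?thesis using C by blast
qed

lemma stable_gradient_continuous: "X \<longlonglongrightarrow> x \<Longrightarrow> (\<lambda>n. stable_gradient (X n)) \<longlonglongrightarrow> stable_gradient x"
  unfolding stable_gradient_def
proof (intro tendsto_minus integral_dominated_convergence[where w="\<lambda>\<xi>. norm \<xi> * exp (- (norm \<xi> powr \<alpha>))"])
  show "integrable lborel (\<lambda>\<xi>::'a. norm \<xi> * exp (- (norm \<xi> powr \<alpha>)))"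
    by (rule integrable_stable[OF \<alpha>])
  assume X: "X \<longlonglongrightarrow> x"
  show "AE \<xi> in lborel. (\<lambda>n. (exp (- (norm \<xi> powr \<alpha>)) * sin (X n \<bullet> \<xi>)) *\<^sub>R \<xi>) \<longlonglongrightarrow> (exp (- (norm \<xi> powr \<alpha>)) * sin (x \<bullet> \<xi>)) *\<^sub>R \<xi>"
    by (intro AE_I2 tendsto_intros X)
  fix n
  show "AE \<xi> in lborel. norm ((exp (- (norm \<xi> powr \<alpha>)) * sin (X n \<bullet> \<xi>)) *\<^sub>R \<xi>) \<le> norm \<xi> * exp (- (norm \<xi> powr \<alpha>))"
  proof (rule AE_I2)
    fix \<xi> :: 'a
    have "\<bar>sin (X n \<bullet> \<xi>)\<bar> * (norm \<xi> * exp (- (norm \<xi> powr \<alpha>))) \<le> 1 * (norm \<xi> * exp (- (norm \<xi> powr \<alpha>)))"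
      by (intro mult_right_mono) auto
    then show "norm ((exp (- (norm \<xi> powr \<alpha>)) * sin (X n \<bullet> \<xi>)) *\<^sub>R \<xi>) \<le> norm \<xi> * exp (- (norm \<xi> powr \<alpha>))"
      by (simp add: abs_mult mult_ac)
  qed
qed measurable

end

text \<open>
  Substitution \<open>\<xi> \<mapsto> t powr - (1 / \<alpha>) * \<xi>\<close> reduces the kernel at time \<open>t\<close> to the stable profile.
\<close>

lemma stable_kernel_eq:
  fixes x :: "real ^ 'n"
  assumes \<alpha>: "1 < \<alpha>" "\<alpha> < 2" and t: "t > 0"
  shows "stable_kernel \<alpha> t x = t powr - (CARD('n) / \<alpha>) / (2 * pi) ^ CARD('n) * stable_profile \<alpha> (t powr - (1 / \<alpha>) *\<^sub>R x)"
proof -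
  define c where "c = t powr - (1 / \<alpha>)"
  have c: "c > 0" using t by (simp add: c_def)
  have tc: "t * (c * r) powr \<alpha> = r powr \<alpha>" if "r \<ge> 0" for r
  proof -
    have "(c * r) powr \<alpha> = c powr \<alpha> * r powr \<alpha>" using c that by (simp add: powr_mult)
    moreover have "c powr \<alpha> = t powr - 1" using \<alpha> by (simp only: c_def powr_powr) simp
    ultimately show ?thesis using t by (simp add: powr_minus_divide)
  qed
  let ?f = "\<lambda>\<xi>::real^'n. exp (- \<i> * of_real (x \<bullet> \<xi>)) * of_real (exp (- t * norm \<xi> powr \<alpha>))"
  have "integrable lborel (\<lambda>\<xi>::real^'n. exp (- (norm \<xi> powr \<alpha>)))" by (rule integrable_stable[OF \<alpha>])
  then have "(\<integral>\<^sup>+\<xi>. ennreal (exp (- (norm (\<xi>::real^'n) powr \<alpha>))) \<partial>lborel) < \<infinity>"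
    unfolding integrable_iff_bounded by simp
  moreover have "(\<integral>\<^sup>+\<xi>. ennreal (exp (- t * norm (\<xi>::real^'n) powr \<alpha>)) \<partial>lborel)
     = ennreal (c ^ DIM(real^'n)) * (\<integral>\<^sup>+\<xi>. ennreal (exp (- t * norm (0 + c *\<^sub>R (\<xi>::real^'n)) powr \<alpha>)) \<partial>lborel)"
    by (rule nn_integral_lborel_scale[OF _ c]) measurable
  moreover have "exp (- t * norm (0 + c *\<^sub>R (\<xi>::real^'n)) powr \<alpha>) = exp (- (norm \<xi> powr \<alpha>))" for \<xi>
    using tc[of "norm \<xi>"] c by simp
  ultimately have "(\<integral>\<^sup>+\<xi>. ennreal (exp (- t * norm (\<xi>::real^'n) powr \<alpha>)) \<partial>lborel) < \<infinity>"
    by (simp add: ennreal_mult_less_top)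
  then have I: "integrable lborel ?f"
    unfolding integrable_iff_bounded by (auto simp: norm_mult)
  have Re: "Re (?f \<xi>) = exp (- t * norm \<xi> powr \<alpha>) * cos (x \<bullet> \<xi>)" for \<xi>
    by (simp add: Re_exp)
  have "stable_kernel \<alpha> t x = 1 / (2 * pi) ^ CARD('n) * Re (LINT \<xi>|lborel. ?f \<xi>)"
  proof -
    have e: "1 / complex_of_real r = complex_of_real (1 / r)" for r by simp
    have m: "Re (complex_of_real r * w) = r * Re w" for r w by simp
    show ?thesis unfolding stable_kernel_def e m ..
  qed
  also have "Re (LINT \<xi>|lborel. ?f \<xi>) = (LINT \<xi>|lborel. exp (- t * norm \<xi> powr \<alpha>) * cos (x \<bullet> \<xi>))"
    unfolding integral_Re[OF I, symmetric] Re ..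
  also have "\<dots> = c ^ DIM(real^'n) * (LINT \<xi>|lborel. exp (- t * norm (c *\<^sub>R \<xi>) powr \<alpha>) * cos (x \<bullet> (c *\<^sub>R \<xi>)))"
    by (rule integral_lborel_scale[OF _ c]) measurable
  also have "(\<lambda>\<xi>::real^'n. exp (- t * norm (c *\<^sub>R \<xi>) powr \<alpha>) * cos (x \<bullet> (c *\<^sub>R \<xi>))) = (\<lambda>\<xi>. exp (- (norm \<xi> powr \<alpha>)) * cos ((c *\<^sub>R x) \<bullet> \<xi>))"
  proof
    fix \<xi> :: "real^'n"
    show "exp (- t * norm (c *\<^sub>R \<xi>) powr \<alpha>) * cos (x \<bullet> (c *\<^sub>R \<xi>)) = exp (- (norm \<xi> powr \<alpha>)) * cos ((c *\<^sub>R x) \<bullet> \<xi>)"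
      using tc[of "norm \<xi>"] c by simp
  qed
  also have "c ^ DIM(real^'n) = t powr - (CARD('n) / \<alpha>)"
    using t by (simp add: c_def powr_realpow[symmetric] powr_powr)
  finally show ?thesis by (simp add: stable_profile_def c_def)
qed

lemma stable_kernel_gradient:
  fixes x z :: "real ^ 'n"
  assumes \<alpha>: "1 < \<alpha>" "\<alpha> < 2" and t: "t > 0"
  shows "grad (\<lambda>y. stable_kernel2 \<alpha> t x y) z
     = (t powr - ((CARD('n) + 1) / \<alpha>) / (2 * pi) ^ CARD('n)) *\<^sub>R stable_gradient \<alpha> (t powr - (1 / \<alpha>) *\<^sub>R (z - x))"
proof (rule gderiv_grad)
  define c where "c = t powr - (1 / \<alpha>)"
  define k where "k = t powr - (CARD('n) / \<alpha>) / (2 * pi) ^ CARD('n)"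
  have "((\<lambda>y. k * stable_profile \<alpha> (c *\<^sub>R (y - x))) has_derivative
      (\<lambda>h. k * ((c *\<^sub>R h) \<bullet> stable_gradient \<alpha> (c *\<^sub>R (z - x))))) (at z)"
    by (rule has_derivative_mult_right, rule has_derivative_compose[where g="stable_profile \<alpha>"])
      (auto intro!: derivative_eq_intros stable_profile_has_derivative[OF \<alpha>])
  moreover have "t powr - ((CARD('n) + 1) / \<alpha>) / (2 * pi) ^ CARD('n) = k * c"
    using t by (simp add: k_def c_def powr_add[symmetric] add_divide_distrib add.commute)
  ultimately show "GDERIV (\<lambda>y. stable_kernel2 \<alpha> t x y) z :> (t powr - ((CARD('n) + 1) / \<alpha>) / (2 * pi) ^ CARD('n)) *\<^sub>R stable_gradient \<alpha> (t powr - (1 / \<alpha>) *\<^sub>R (z - x))"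
    unfolding gderiv_def stable_kernel2_def stable_kernel_eq[OF \<alpha> t] c_def[symmetric] k_def[symmetric]
    by (simp add: mult.assoc)
qed

lemma ennreal_norm_integral_le: "ennreal (norm (\<integral>x. f x \<partial>M)) \<le> (\<integral>\<^sup>+x. norm (f x) \<partial>M)"
  for f :: "'a \<Rightarrow> real"
proof (cases "integrable M f")
  case True
  then show ?thesis by (rule integral_norm_bound_ennreal)
qed (simp add: not_integrable_integral_eq)

context
  fixes \<alpha> q M :: real and b :: "real ^ 'n" and u :: "real \<Rightarrow> real ^ 'n \<Rightarrow> real"
  assumes \<alpha>: "1 < \<alpha>" "\<alpha> < 2" and q: "q = (\<alpha> - 1) / real CARD('n)" and M: "0 < M"
    and u: "source_solution \<alpha> q b M u"
begin

lemma q_pos: "q > 0" using \<alpha> by (simp add: q)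

lemma u_mild: "mild_solution \<alpha> q b M u"
  and u_pos: "t > 0 \<Longrightarrow> 0 < u t x"
  and u_Lp: "t > 0 \<Longrightarrow> in_all_Lp (u t)"
  and u_self_similar: "self_similar \<alpha> u"
  using u unfolding source_solution_def by blast+

lemma u_measurable: "u 1 \<in> borel_measurable borel"
  using u_Lp[OF zero_less_one] by (simp add: in_all_Lp_def)

lemma u_integrable: "integrable lborel (u 1)" "integrable lborel (\<lambda>y. u 1 y * u 1 y powr q)"
proof -
  have i: "integrable lborel (\<lambda>x. \<bar>u 1 x\<bar> powr r)" if "r \<ge> 1" for r
    using u_Lp[OF zero_less_one] that by (simp add: in_all_Lp_def)
  have "\<bar>u 1 x\<bar> powr 1 = u 1 x" "\<bar>u 1 x\<bar> powr (1 + q) = u 1 x * u 1 x powr q" for x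
    using u_pos[of 1 x] by (simp_all add: powr_add)
  then show "integrable lborel (u 1)" "integrable lborel (\<lambda>y. u 1 y * u 1 y powr q)"
    using i[of 1] i[of "1 + q"] q_pos by simp_all
qed

lemma u_bounded: "\<exists>K. AE y in lborel. u 1 y \<le> K"
proof -
  obtain K where "AE y in lborel. \<bar>u 1 y\<bar> \<le> K"
    using u_Lp[OF zero_less_one] by (auto simp: in_all_Lp_def)
  then have "AE y in lborel. u 1 y \<le> K" by eventually_elim simp
  then show ?thesis by blast
qed

lemma u_scaling:
  assumes s: "s > 0"
  shows "u s z = s powr - (CARD('n) / \<alpha>) * u 1 (s powr - (1 / \<alpha>) *\<^sub>R z)"
proof -
  have "s powr - (1 / \<alpha>) > 0" using s by simp
  from u_self_similar[unfolded self_similar_def, rule_format, OF this s]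
  have "u s z = (s powr - (1 / \<alpha>)) ^ CARD('n) * u ((s powr - (1 / \<alpha>)) powr \<alpha> * s) (s powr - (1 / \<alpha>) *\<^sub>R z)"
    by blast
  moreover have "(s powr - (1 / \<alpha>)) powr \<alpha> = s powr - 1"
    using \<alpha> by (simp only: powr_powr) simp
  then have "(s powr - (1 / \<alpha>)) powr \<alpha> * s = 1"
    using s by (simp add: powr_minus_divide)
  moreover have "(s powr - (1 / \<alpha>)) ^ CARD('n) = s powr - (CARD('n) / \<alpha>)"
    using s by (simp add: powr_realpow[symmetric] powr_powr)
  ultimately show ?thesis by simp
qed

text \<open>The nonlinearity \<open>u(s, z) powr (1 + q)\<close>, written in terms of the profile at time 1. This makes its
  joint measurability in \<open>(s, z)\<close> evident, which is not part of the hypotheses on \<open>u\<close>.\<close>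

definition flux :: "real \<Rightarrow> real ^ 'n \<Rightarrow> real" where
  "flux s z = s powr - (CARD('n) / \<alpha> * (1 + q)) * (u 1 (s powr - (1 / \<alpha>) *\<^sub>R z) * u 1 (s powr - (1 / \<alpha>) *\<^sub>R z) powr q)"

lemma flux_measurable [measurable]:
  assumes [measurable]: "f \<in> borel_measurable N" "g \<in> borel_measurable N"
  shows "(\<lambda>p. flux (f p) (g p)) \<in> borel_measurable N"
proof -
  note [measurable] = u_measurable
  show ?thesis unfolding flux_def by measurable
qed

lemma flux_eq:
  assumes s: "s > 0"
  shows "u s z * \<bar>u s z\<bar> powr q = flux s z"
proof -
  let ?v = "u 1 (s powr - (1 / \<alpha>) *\<^sub>R z)"
  have v: "?v > 0" by (rule u_pos) simp
  have "u s z * \<bar>u s z\<bar> powr q = s powr - (CARD('n) / \<alpha>) * ?v * (s powr - (CARD('n) / \<alpha>) * ?v) powr q"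
    using u_pos[OF s, of z] unfolding u_scaling[OF s] by simp
  also have "\<dots> = s powr - (CARD('n) / \<alpha>) * (s powr - (CARD('n) / \<alpha>)) powr q * (?v * ?v powr q)"
    using v by (simp add: powr_mult)
  also have "s powr - (CARD('n) / \<alpha>) * (s powr - (CARD('n) / \<alpha>)) powr q = s powr - (CARD('n) / \<alpha> * (1 + q))"
  proof -
    have "- (CARD('n) / \<alpha>) + - (CARD('n) / \<alpha>) * q = - (CARD('n) / \<alpha> * (1 + q))"
      by (simp add: distrib_left)
    then show ?thesis by (simp only: powr_powr powr_add[symmetric])
  qed
  finally show ?thesis by (simp add: flux_def)
qed

lemma flux_nonneg: "0 \<le> flux s z"
  unfolding flux_def using u_pos[of 1] by (intro mult_nonneg_nonneg) (auto intro: less_imp_le)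

text \<open>The powers of \<open>s\<close> from the substitution and from the nonlinearity combine to one that does not depend on
  the dimension, because \<open>d * q = \<alpha> - 1\<close>.\<close>

lemma scaling_exponent: "CARD('n) / \<alpha> - CARD('n) / \<alpha> * (1 + q) = 1 / \<alpha> - 1"
proof -
  have "CARD('n) / \<alpha> - CARD('n) / \<alpha> * (1 + q) = - (CARD('n) * q) / \<alpha>"
    by (simp add: distrib_left)
  also have "CARD('n) * q = \<alpha> - 1" by (simp add: q)
  also have "- (\<alpha> - 1) / \<alpha> = 1 / \<alpha> - 1" using \<alpha> by (simp add: diff_divide_distrib)
  finally show ?thesis .
qed

lemma flux_scaled:
  assumes s: "s > 0"
  shows "s powr (CARD('n) / \<alpha>) * flux s (s powr (1 / \<alpha>) *\<^sub>R y) = s powr (1 / \<alpha> - 1) * (u 1 y * u 1 y powr q)"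
proof -
  have "s powr - (1 / \<alpha>) *\<^sub>R (s powr (1 / \<alpha>) *\<^sub>R y) = y"
    using s by (simp add: powr_add[symmetric])
  then have "flux s (s powr (1 / \<alpha>) *\<^sub>R y) = s powr - (CARD('n) / \<alpha> * (1 + q)) * (u 1 y * u 1 y powr q)"
    by (simp only: flux_def)
  then have "s powr (CARD('n) / \<alpha>) * flux s (s powr (1 / \<alpha>) *\<^sub>R y) = (s powr (CARD('n) / \<alpha>) * s powr - (CARD('n) / \<alpha> * (1 + q))) * (u 1 y * u 1 y powr q)"
    by simp
  also have "s powr (CARD('n) / \<alpha>) * s powr - (CARD('n) / \<alpha> * (1 + q)) = s powr (1 / \<alpha> - 1)"
    unfolding powr_add[symmetric] using scaling_exponent by simp
  finally show ?thesis .
qed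

abbreviation (input) integrand :: "real ^ 'n \<Rightarrow> real \<Rightarrow> real ^ 'n \<Rightarrow> real" where
  "integrand x s z \<equiv> duhamel_integrand \<alpha> q b u 1 x s z"

lemma integrand_eq:
  assumes "0 < s" "s < 1"
  shows "integrand x s z = ((1 - s) powr - ((CARD('n) + 1) / \<alpha>) / (2 * pi) ^ CARD('n)) *
    (b \<bullet> stable_gradient \<alpha> ((1 - s) powr - (1 / \<alpha>) *\<^sub>R (z - x))) * flux s z"
  unfolding duhamel_integrand_def using assms by (simp add: stable_kernel_gradient[OF \<alpha>] flux_eq)

abbreviation (input) flux_one :: "real ^ 'n \<Rightarrow> ennreal" where
  "flux_one y \<equiv> ennreal (u 1 y * u 1 y powr q)"

abbreviation (input) gradient_weight :: "real \<Rightarrow> real ^ 'n \<Rightarrow> real" where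
  "gradient_weight s v \<equiv> (1 - s) powr - ((CARD('n) + 1) / \<alpha>) * tail_weight (\<alpha> + 1) ((1 - s) powr - (1 / \<alpha>) *\<^sub>R v)"

lemma integrand_bound:
  obtains B where "B > 0" "\<forall>s x z. 0 < s \<longrightarrow> s < 1 \<longrightarrow>
    \<bar>integrand x s z\<bar> \<le> B * (gradient_weight s (z - x) * flux s z)"
proof -
  obtain C where C: "C > 0" "\<And>x::real^'n. norm (stable_gradient \<alpha> x) \<le> C * tail_weight (\<alpha> + 1) x"
    using stable_gradient_bound[OF \<alpha>] by blast
  define B where "B = (norm b + 1) * C"
  show ?thesis
  proof (rule that[of B])
    show "B > 0" using C by (simp add: B_def add_nonneg_pos)
    show "\<forall>s x z. 0 < s \<longrightarrow> s < 1 \<longrightarrow>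
      \<bar>integrand x s z\<bar> \<le> B * (gradient_weight s (z - x) * flux s z)"
    proof (intro allI impI)
      fix s :: real and x z :: "real ^ 'n" assume s: "0 < s" "s < 1"
      let ?v = "(1 - s) powr - (1 / \<alpha>) *\<^sub>R (z - x)"
      let ?t = "(1 - s) powr - ((CARD('n) + 1) / \<alpha>)"
      have "\<bar>b \<bullet> stable_gradient \<alpha> ?v\<bar> \<le> norm b * norm (stable_gradient \<alpha> ?v)"
        by (rule Cauchy_Schwarz_ineq2)
      also have "\<dots> \<le> (norm b + 1) * (C * tail_weight (\<alpha> + 1) ?v)"
        using C by (intro mult_mono) auto
      finally have 1: "\<bar>b \<bullet> stable_gradient \<alpha> ?v\<bar> \<le> B * tail_weight (\<alpha> + 1) ?v" by (simp add: B_def)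
      have 2: "?t / (2 * pi) ^ CARD('n) \<le> ?t"
      proof -
        have "1 \<le> 2 * pi" using pi_gt3 by simp
        then have "1 \<le> (2 * pi) ^ CARD('n)" by (rule one_le_power)
        then show ?thesis by (simp add: divide_le_eq mult_le_cancel_left1)
      qed
      have "\<bar>integrand x s z\<bar> = ?t / (2 * pi) ^ CARD('n) * \<bar>b \<bullet> stable_gradient \<alpha> ?v\<bar> * flux s z"
        unfolding integrand_eq[OF s] using flux_nonneg by (simp add: abs_mult)
      also have "\<dots> \<le> ?t * (B * tail_weight (\<alpha> + 1) ?v) * flux s z"
        by (intro mult_right_mono mult_mono 1 2 flux_nonneg) auto
      finally show "\<bar>integrand x s z\<bar> \<le> B * (?t * tail_weight (\<alpha> + 1) ?v * flux s z)" by (simp add: mult_ac)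
    qed
  qed
qed

lemma DIM_CARD: "DIM(real ^ 'n) = CARD('n)" by simp

text \<open>The statement is for arbitrary sets of times, because the continuity of \<open>u 1\<close> needs it for times close
  to 1.\<close>

lemma duhamel_term_bound:
  obtains B where "B > 0" "\<forall>S x. S \<in> sets borel \<longrightarrow> S \<subseteq> {0<..<1} \<longrightarrow>
     ennreal \<bar>LINT s:S|lborel. (LINT z|lborel. integrand x s z)\<bar>
       \<le> ennreal B * (\<integral>\<^sup>+y. duhamel_weight \<alpha> S x y * flux_one y \<partial>lborel)"
proof -
  note [measurable] = u_measurable
  obtain B where B: "B > 0" "\<forall>s x z. 0 < s \<longrightarrow> s < 1 \<longrightarrow>
    \<bar>integrand x s z\<bar> \<le> B * (gradient_weight s (z - x) * flux s z)"
    by (rule integrand_bound)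
  have inner: "(\<integral>\<^sup>+z. ennreal \<bar>integrand x s z\<bar> \<partial>lborel)
     \<le> (\<integral>\<^sup>+y. ennreal B * (ennreal (duhamel_density \<alpha> s x y) * flux_one y) \<partial>lborel)"
    if s: "0 < s" "s < 1" for s x
  proof -
    let ?G = "\<lambda>z. B * (gradient_weight s (z - x) * flux s z)"
    have c: "s powr (1 / \<alpha>) > 0" using s by simp
    have "(\<integral>\<^sup>+z. ennreal \<bar>integrand x s z\<bar> \<partial>lborel) \<le> (\<integral>\<^sup>+z. ennreal (?G z) \<partial>lborel)"
      using B(2) s by (intro nn_integral_mono ennreal_leI) auto
    also have "\<dots> = ennreal ((s powr (1 / \<alpha>)) ^ DIM(real^'n)) * (\<integral>\<^sup>+y. ennreal (?G (0 + s powr (1 / \<alpha>) *\<^sub>R y)) \<partial>lborel)"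
      by (rule nn_integral_lborel_scale[OF _ c]) measurable
    also have "\<dots> = (\<integral>\<^sup>+y. ennreal ((s powr (1 / \<alpha>)) ^ DIM(real^'n)) * ennreal (?G (0 + s powr (1 / \<alpha>) *\<^sub>R y)) \<partial>lborel)"
      by (rule nn_integral_cmult[symmetric]) measurable
    also have "\<dots> = (\<integral>\<^sup>+y. ennreal B * (ennreal (duhamel_density \<alpha> s x y) * flux_one y) \<partial>lborel)"
    proof (rule nn_integral_cong)
      fix y :: "real ^ 'n"
      let ?y = "s powr (1 / \<alpha>) *\<^sub>R y"
      let ?T = "gradient_weight s (?y - x)"
      have dd: "duhamel_density \<alpha> s x y = s powr (1 / \<alpha> - 1) * ?T"
        unfolding duhamel_density_def[OF \<alpha>] DIM_CARD by simp
      have pw: "(s powr (1 / \<alpha>)) ^ DIM(real^'n) = s powr (CARD('n) / \<alpha>)"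
        using s by (simp add: powr_realpow[symmetric] powr_powr)
      have T0: "?T \<ge> 0" by simp
      have v0: "u 1 y * u 1 y powr q \<ge> 0" using u_pos[of 1 y] by simp
      have "(s powr (1 / \<alpha>)) ^ DIM(real^'n) * ?G (0 + ?y) = B * (?T * (s powr (CARD('n) / \<alpha>) * flux s ?y))"
        unfolding pw by simp
      also have "\<dots> = B * (duhamel_density \<alpha> s x y * (u 1 y * u 1 y powr q))"
        unfolding flux_scaled[OF s(1)] dd by simp
      finally have e: "(s powr (1 / \<alpha>)) ^ DIM(real^'n) * ?G (0 + ?y) = B * (duhamel_density \<alpha> s x y * (u 1 y * u 1 y powr q))" .
      have "ennreal ((s powr (1 / \<alpha>)) ^ DIM(real^'n)) * ennreal (?G (0 + ?y)) = ennreal ((s powr (1 / \<alpha>)) ^ DIM(real^'n) * ?G (0 + ?y))"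
        by (rule ennreal_mult[symmetric]) (use B T0 flux_nonneg in \<open>auto intro!: mult_nonneg_nonneg\<close>)
      also have "\<dots> = ennreal B * (ennreal (duhamel_density \<alpha> s x y) * flux_one y)"
        unfolding e using B v0 duhamel_density_nonneg[OF \<alpha>, of s x y] by (simp add: ennreal_mult)
      finally show "ennreal ((s powr (1 / \<alpha>)) ^ DIM(real^'n)) * ennreal (?G (0 + ?y))
         = ennreal B * (ennreal (duhamel_density \<alpha> s x y) * flux_one y)" .
    qed
    finally show ?thesis .
  qed
  show ?thesis
  proof (rule that[OF B(1)], intro allI impI)
    fix S :: "real set" and x :: "real ^ 'n"
    assume S [measurable]: "S \<in> sets borel" and S01: "S \<subseteq> {0<..<1}"
    have dm: "(\<lambda>p. duhamel_density \<alpha> (fst p) x (snd p)) \<in> borel_measurable (lborel \<Otimes>\<^sub>M lborel)"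
      by (rule duhamel_density_measurable[OF \<alpha>]) auto
    have dm1 [measurable]: "(\<lambda>s. duhamel_density \<alpha> s x y) \<in> borel_measurable borel" for y
      by (rule duhamel_density_measurable[OF \<alpha>]) auto
    let ?V = "\<lambda>y. flux_one y"
    have "ennreal \<bar>LINT s:S|lborel. (LINT z|lborel. integrand x s z)\<bar>
       \<le> (\<integral>\<^sup>+s. ennreal \<bar>indicator S s *\<^sub>R (LINT z|lborel. integrand x s z)\<bar> \<partial>lborel)"
      unfolding set_lebesgue_integral_def using ennreal_norm_integral_le by (metis (mono_tags, lifting) nn_integral_cong real_norm_def)
    also have "\<dots> \<le> (\<integral>\<^sup>+s. (\<integral>\<^sup>+y. ennreal B * (ennreal (duhamel_density \<alpha> s x y) * indicator S s * ?V y) \<partial>lborel) \<partial>lborel)"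
    proof (rule nn_integral_mono)
      fix s :: real
      show "ennreal \<bar>indicator S s *\<^sub>R (LINT z|lborel. integrand x s z)\<bar> \<le> (\<integral>\<^sup>+y. ennreal B * (ennreal (duhamel_density \<alpha> s x y) * indicator S s * ?V y) \<partial>lborel)"
      proof (cases "s \<in> S")
        case True
        then have s: "0 < s" "s < 1" using S01 by auto
        have "ennreal \<bar>LINT z|lborel. integrand x s z\<bar> \<le> (\<integral>\<^sup>+z. ennreal \<bar>integrand x s z\<bar> \<partial>lborel)"
          using ennreal_norm_integral_le[of lborel "integrand x s"] by simp
        also note inner[OF s, of x]
        finally show ?thesis using True by simp
      qed simp
    qed
    also have "\<dots> = (\<integral>\<^sup>+y. (\<integral>\<^sup>+s. ennreal B * (ennreal (duhamel_density \<alpha> s x y) * indicator S s * ?V y) \<partial>lborel) \<partial>lborel)"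
    proof -
      have "(\<lambda>(s, y). ennreal B * (ennreal (duhamel_density \<alpha> s x y) * indicator S s * ?V y)) \<in> borel_measurable (lborel \<Otimes>\<^sub>M lborel)"
        using dm unfolding split_beta' by measurable
      from lborel_pair.Fubini'[OF this] show ?thesis by simp
    qed
    also have "\<dots> = (\<integral>\<^sup>+y. ennreal B * (duhamel_weight \<alpha> S x y * ?V y) \<partial>lborel)"
    proof (rule nn_integral_cong)
      fix y :: "real ^ 'n"
      have "(\<integral>\<^sup>+s. ennreal B * (ennreal (duhamel_density \<alpha> s x y) * indicator S s * ?V y) \<partial>lborel)
        = ennreal B * (\<integral>\<^sup>+s. ennreal (duhamel_density \<alpha> s x y) * indicator S s * ?V y \<partial>lborel)"
        by (rule nn_integral_cmult) measurable
      also have "(\<integral>\<^sup>+s. ennreal (duhamel_density \<alpha> s x y) * indicator S s * ?V y \<partial>lborel) = duhamel_weight \<alpha> S x y * ?V y"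
        unfolding duhamel_weight_def[OF \<alpha>] by (rule nn_integral_multc) measurable
      finally show "(\<integral>\<^sup>+s. ennreal B * (ennreal (duhamel_density \<alpha> s x y) * indicator S s * ?V y) \<partial>lborel) = ennreal B * (duhamel_weight \<alpha> S x y * ?V y)" .
    qed
    also have "\<dots> = ennreal B * (\<integral>\<^sup>+y. duhamel_weight \<alpha> S x y * ?V y \<partial>lborel)"
    proof (rule nn_integral_cmult)
      have "(\<lambda>y. duhamel_weight \<alpha> S x y) \<in> borel_measurable lborel"
        by (rule duhamel_weight_measurable[OF \<alpha> S]) auto
      then show "(\<lambda>y. duhamel_weight \<alpha> S x y * ?V y) \<in> borel_measurable lborel" by measurable
    qed
    finally show "ennreal \<bar>LINT s:S|lborel. (LINT z|lborel. integrand x s z)\<bar> \<le> ennreal B * (\<integral>\<^sup>+y. duhamel_weight \<alpha> S x y * ?V y \<partial>lborel)" .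
  qed
qed

lemma integrand_set_integrable:
  "set_integrable (lborel \<Otimes>\<^sub>M lborel) ({0<..<1} \<times> UNIV) (\<lambda>(s, z). integrand x s z)"
  by (rule conjunct1[OF u_mild[unfolded mild_solution_def, rule_format, OF zero_less_one]])

lemma mild_equation:
  "u 1 x = M * stable_kernel \<alpha> 1 x + (LINT s:{0<..<1}|lborel. (LINT z|lborel. integrand x s z))"
  by (rule conjunct2[OF u_mild[unfolded mild_solution_def, rule_format, OF zero_less_one]])

lemma integrand_restricted:
  assumes [measurable]: "S \<in> sets borel" and S: "S \<subseteq> {0<..<1}"
  shows "set_integrable lborel S (\<lambda>s. LINT z|lborel. integrand x s z)"
    and "integrable (lborel \<Otimes>\<^sub>M lborel) (\<lambda>p. indicator S (fst p) * integrand x (fst p) (snd p))"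
    and "(LINT s:S|lborel. (LINT z|lborel. integrand x s z)) = (LINT p|(lborel \<Otimes>\<^sub>M lborel). indicator S (fst p) * integrand x (fst p) (snd p))"
proof -
  have "set_integrable (lborel \<Otimes>\<^sub>M lborel) (S \<times> UNIV) (\<lambda>(s, z). integrand x s z)"
    by (rule set_integrable_subset[OF integrand_set_integrable]) (use S in \<open>auto intro!: pair_measureI\<close>)
  then show I: "integrable (lborel \<Otimes>\<^sub>M lborel) (\<lambda>p. indicator S (fst p) * integrand x (fst p) (snd p))"
    unfolding set_integrable_def by (simp add: split_beta' indicator_times)
  have e: "(LINT z|lborel. indicator S s * integrand x s z) = indicator S s *\<^sub>R (LINT z|lborel. integrand x s z)" for s
    by simp
  show "set_integrable lborel S (\<lambda>s. LINT z|lborel. integrand x s z)"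
    unfolding set_integrable_def e[symmetric] using lborel_pair.integrable_fst'[OF I] by simp
  show "(LINT s:S|lborel. (LINT z|lborel. integrand x s z)) = (LINT p|(lborel \<Otimes>\<^sub>M lborel). indicator S (fst p) * integrand x (fst p) (snd p))"
    unfolding set_lebesgue_integral_def e[symmetric] using lborel_pair.integral_fst'[OF I] by simp
qed

lemma flux_integrable:
  assumes "0 < \<eta>"
  shows "integrable (lborel \<Otimes>\<^sub>M lborel) (\<lambda>p. indicator {0<..<1 - \<eta>} (fst p) * flux (fst p) (snd p))"
proof (rule integrableI_nonneg)
  note [measurable] = u_measurable
  show "AE p in lborel \<Otimes>\<^sub>M lborel. 0 \<le> indicator {0<..<1 - \<eta>} (fst p) * flux (fst p) (snd p)"
    using flux_nonneg by auto
  let ?N = "LINT y|lborel. u 1 y * u 1 y powr q"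
  have N: "(\<integral>\<^sup>+y. flux_one y \<partial>lborel) = ennreal ?N"
    by (intro nn_integral_eq_integral u_integrable AE_I2 mult_nonneg_nonneg less_imp_le[OF u_pos]) auto
  have "(\<integral>\<^sup>+p. ennreal (indicator {0<..<1 - \<eta>} (fst p) * flux (fst p) (snd p)) \<partial>(lborel \<Otimes>\<^sub>M lborel))
     = (\<integral>\<^sup>+s. (\<integral>\<^sup>+z. ennreal (indicator {0<..<1 - \<eta>} s * flux s z) \<partial>lborel) \<partial>lborel)"
    by (subst lborel.nn_integral_fst[symmetric]) auto
  also have "\<dots> \<le> (\<integral>\<^sup>+s. (ennreal ?N * ennreal (s powr (1 / \<alpha> - 1) * (1 - s) powr - (1 / \<alpha>))) * indicator {0<..<1} s \<partial>lborel)"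
  proof (rule nn_integral_mono)
    fix s :: real
    show "(\<integral>\<^sup>+z. ennreal (indicator {0<..<1 - \<eta>} s * flux s z) \<partial>lborel) \<le> (ennreal ?N * ennreal (s powr (1 / \<alpha> - 1) * (1 - s) powr - (1 / \<alpha>))) * indicator {0<..<1} s"
    proof (cases "s \<in> {0<..<1 - \<eta>}")
      case True
      then have s: "0 < s" "s < 1" using assms by auto
      have c: "s powr (1 / \<alpha>) > 0" using s by simp
      have pw: "(s powr (1 / \<alpha>)) ^ DIM(real^'n) = s powr (CARD('n) / \<alpha>)"
        using s by (simp add: powr_realpow[symmetric] powr_powr)
      have "(\<integral>\<^sup>+z. ennreal (flux s z) \<partial>lborel) = ennreal ((s powr (1 / \<alpha>)) ^ DIM(real^'n)) * (\<integral>\<^sup>+y. ennreal (flux s (0 + s powr (1 / \<alpha>) *\<^sub>R y)) \<partial>lborel)"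
        by (rule nn_integral_lborel_scale[OF _ c]) measurable
      also have "\<dots> = (\<integral>\<^sup>+y. ennreal (s powr (CARD('n) / \<alpha>)) * ennreal (flux s (s powr (1 / \<alpha>) *\<^sub>R y)) \<partial>lborel)"
        unfolding pw add_0_left by (rule nn_integral_cmult[symmetric]) measurable
      also have "\<dots> = (\<integral>\<^sup>+y. ennreal (s powr (1 / \<alpha> - 1)) * flux_one y \<partial>lborel)"
        using flux_scaled[OF s(1)] flux_nonneg u_pos[of 1]
        by (intro nn_integral_cong) (simp add: ennreal_mult[symmetric] less_imp_le)
      also have "\<dots> = ennreal (s powr (1 / \<alpha> - 1)) * ennreal ?N"
        unfolding N[symmetric] by (rule nn_integral_cmult) measurable
      also have "\<dots> \<le> ennreal (s powr (1 / \<alpha> - 1) * (1 - s) powr - (1 / \<alpha>)) * ennreal ?N"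
      proof (intro mult_right_mono ennreal_leI)
        have "(1 - s) powr 0 \<le> (1 - s) powr - (1 / \<alpha>)" using s \<alpha> by (intro powr_mono') auto
        then have "s powr (1 / \<alpha> - 1) * 1 \<le> s powr (1 / \<alpha> - 1) * (1 - s) powr - (1 / \<alpha>)"
          using s by (intro mult_left_mono) auto
        then show "s powr (1 / \<alpha> - 1) \<le> s powr (1 / \<alpha> - 1) * (1 - s) powr - (1 / \<alpha>)" by simp
      qed simp
      finally show ?thesis using True s by (simp add: mult.commute)
    qed simp
  qed
  also have "\<dots> \<le> ennreal ?N * ennreal (beta_mass \<alpha>)"
    by (rule nn_integral_beta_mass_le[OF \<alpha>]) auto
  finally show "(\<integral>\<^sup>+p. ennreal (indicator {0<..<1 - \<eta>} (fst p) * flux (fst p) (snd p)) \<partial>(lborel \<Otimes>\<^sub>M lborel)) < \<infinity>"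
    by (rule order.strict_trans1) (simp add: ennreal_mult_less_top)
qed measurable

text \<open>Away from \<open>s = 1\<close> the gradient kernel is bounded and continuous, so dominated convergence applies with a multiple of
  the flux as majorant.\<close>

lemma early_duhamel_continuous:
  assumes \<eta>: "0 < \<eta>"
  shows "continuous_on UNIV (\<lambda>x. LINT s:{0<..<1 - \<eta>}|lborel. (LINT z|lborel. integrand x s z))"
proof -
  obtain B where B: "B > 0" "\<forall>s x z. 0 < s \<longrightarrow> s < 1 \<longrightarrow>
    \<bar>integrand x s z\<bar> \<le> B * (gradient_weight s (z - x) * flux s z)"
    by (rule integrand_bound)
  define c where "c = \<eta> powr - ((CARD('n) + 1) / \<alpha>)"
  have S: "{0<..<1 - \<eta>} \<subseteq> {0<..<1}" using \<eta> by auto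
  note R = integrand_restricted[OF _ S]
  have "continuous_on UNIV (\<lambda>x. LINT p|(lborel \<Otimes>\<^sub>M lborel). indicator {0<..<1 - \<eta>} (fst p) * integrand x (fst p) (snd p))"
  proof (rule continuous_at_imp_continuous_on, rule ballI, rule continuous_at_sequentiallyI)
    fix x :: "real ^ 'n" and X assume X: "X \<longlonglongrightarrow> x"
    show "(\<lambda>n. LINT p|(lborel \<Otimes>\<^sub>M lborel). indicator {0<..<1 - \<eta>} (fst p) * integrand (X n) (fst p) (snd p))
       \<longlonglongrightarrow> (LINT p|(lborel \<Otimes>\<^sub>M lborel). indicator {0<..<1 - \<eta>} (fst p) * integrand x (fst p) (snd p))"
    proof (rule integral_dominated_convergence)
      show "integrable (lborel \<Otimes>\<^sub>M lborel) (\<lambda>p. B * c * (indicator {0<..<1 - \<eta>} (fst p) * flux (fst p) (snd p)))"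
        by (intro integrable_mult_right flux_integrable \<eta>)
      show "(\<lambda>p. indicator {0<..<1 - \<eta>} (fst p) * integrand x (fst p) (snd p)) \<in> borel_measurable (lborel \<Otimes>\<^sub>M lborel)"
        "(\<lambda>p. indicator {0<..<1 - \<eta>} (fst p) * integrand (X n) (fst p) (snd p)) \<in> borel_measurable (lborel \<Otimes>\<^sub>M lborel)" for n
        using R(2) by (auto intro: borel_measurable_integrable)
      show "AE p in lborel \<Otimes>\<^sub>M lborel. (\<lambda>n. indicator {0<..<1 - \<eta>} (fst p) * integrand (X n) (fst p) (snd p))
          \<longlonglongrightarrow> indicator {0<..<1 - \<eta>} (fst p) * integrand x (fst p) (snd p)"
      proof (rule AE_I2)
        fix p :: "real \<times> (real ^ 'n)"
        show "(\<lambda>n. indicator {0<..<1 - \<eta>} (fst p) * integrand (X n) (fst p) (snd p))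
          \<longlonglongrightarrow> indicator {0<..<1 - \<eta>} (fst p) * integrand x (fst p) (snd p)"
        proof (cases "fst p \<in> {0<..<1 - \<eta>}")
          case True
          then have s: "0 < fst p" "fst p < 1" using \<eta> by auto
          show ?thesis unfolding integrand_eq[OF s]
            by (intro tendsto_intros stable_gradient_continuous[OF \<alpha>] X)
        qed simp
      qed
      fix n
      show "AE p in lborel \<Otimes>\<^sub>M lborel. norm (indicator {0<..<1 - \<eta>} (fst p) * integrand (X n) (fst p) (snd p))
         \<le> B * c * (indicator {0<..<1 - \<eta>} (fst p) * flux (fst p) (snd p))"
      proof (rule AE_I2)
        fix p :: "real \<times> (real ^ 'n)"
        show "norm (indicator {0<..<1 - \<eta>} (fst p) * integrand (X n) (fst p) (snd p)) \<le> B * c * (indicator {0<..<1 - \<eta>} (fst p) * flux (fst p) (snd p))"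
        proof (cases "fst p \<in> {0<..<1 - \<eta>}")
          case True
          obtain s z where p: "p = (s, z)" by (cases p)
          have s: "0 < s" "s < 1" "\<eta> \<le> 1 - s" using True \<eta> by (auto simp: p)
          have "gradient_weight s (z - X n) \<le> c * 1"
            unfolding c_def using s \<eta> \<alpha> by (intro mult_mono powr_mono2' tail_weight_le_one) auto
          then have "B * (gradient_weight s (z - X n) * flux s z) \<le> B * (c * 1 * flux s z)"
            using B flux_nonneg by (intro mult_left_mono mult_right_mono) auto
          then have "\<bar>integrand (X n) s z\<bar> \<le> B * (c * 1 * flux s z)"
            using B(2)[rule_format, OF s(1,2), of "X n" z] by linarith
          then show ?thesis using True by (simp add: p mult.assoc)
        qed simp
      qed
    qed
  qed
  moreover have "{0<..<1 - \<eta>} \<in> sets borel" by simp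
  ultimately show ?thesis using R(3) by simp
qed

lemma kernel_at_one: "stable_kernel \<alpha> 1 x = stable_profile \<alpha> x / (2 * pi) ^ CARD('n)" for x :: "real ^ 'n"
  using stable_kernel_eq[OF \<alpha>, of 1 x] by simp

lemma kernel_bounds:
  obtains cp Cp where "cp > 0" "Cp > 0" "\<forall>x::real^'n. cp * tail_weight \<alpha> x \<le> stable_kernel \<alpha> 1 x" "\<forall>x::real^'n. stable_kernel \<alpha> 1 x \<le> Cp * tail_weight \<alpha> x"
proof -
  obtain c where c: "c > 0" "\<forall>x::real^'n. c * tail_weight \<alpha> x \<le> stable_profile \<alpha> x"
    using stable_profile_lower[OF \<alpha>] by blast
  obtain C where C: "C > 0" "\<forall>x::real^'n. stable_profile \<alpha> x \<le> C * tail_weight \<alpha> x"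
    using stable_profile_upper[OF \<alpha>] by blast
  let ?P = "(2 * pi) ^ CARD('n)"
  have P: "?P > 0" by simp
  show ?thesis
  proof (rule that[of "c / ?P" "C / ?P"])
    show "c / ?P > 0" "C / ?P > 0" using c C P by auto
    show "\<forall>x::real^'n. c / ?P * tail_weight \<alpha> x \<le> stable_kernel \<alpha> 1 x"
      unfolding kernel_at_one using c P by (auto intro!: divide_right_mono simp: times_divide_eq_left)
    show "\<forall>x::real^'n. stable_kernel \<alpha> 1 x \<le> C / ?P * tail_weight \<alpha> x"
      unfolding kernel_at_one using C P by (auto intro!: divide_right_mono simp: times_divide_eq_left)
  qed
qed

text \<open>Continuity of \<open>u 1\<close> comes from uniform convergence: cutting off the times in \<open>[1 - \<eta>, 1)\<close> changes the
  Duhamel term by \<open>O(\<eta> powr \<theta>)\<close>, uniformly in \<open>x\<close>.\<close>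

lemma solution_bounds_at_one:
  obtains C where "C > 0" "\<forall>x. inverse C * stable_kernel \<alpha> 1 x \<le> u 1 x \<and> u 1 x \<le> C * stable_kernel \<alpha> 1 x"
proof -
  obtain cp Cp where cp: "cp > 0" "Cp > 0" "\<forall>x::real^'n. cp * tail_weight \<alpha> x \<le> stable_kernel \<alpha> 1 x" "\<forall>x::real^'n. stable_kernel \<alpha> 1 x \<le> Cp * tail_weight \<alpha> x"
    by (rule kernel_bounds)
  obtain B where B: "B > 0" "\<forall>S x. S \<in> sets borel \<longrightarrow> S \<subseteq> {0<..<1} \<longrightarrow>
     ennreal \<bar>LINT s:S|lborel. (LINT z|lborel. integrand x s z)\<bar>
       \<le> ennreal B * (\<integral>\<^sup>+y. duhamel_weight \<alpha> S x y * flux_one y \<partial>lborel)"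
    by (rule duhamel_term_bound)
  have u0: "0 \<le> u 1 x" for x using u_pos[of 1 x] by simp
  let ?Pot = "\<lambda>x. (\<integral>\<^sup>+y. duhamel_weight \<alpha> {0<..<1} x y * flux_one y \<partial>lborel)"
  let ?D = "\<lambda>S x. LINT s:S|lborel. (LINT z|lborel. integrand x s z)"
  have D: "ennreal \<bar>?D {0<..<1} x\<bar> \<le> ennreal B * ?Pot x" for x
    using B(2) by simp
  have upper: "ennreal (u 1 x) \<le> ennreal (M * Cp * tail_weight \<alpha> x) + ennreal B * ?Pot x" for x
  proof -
    have "u 1 x \<le> M * Cp * tail_weight \<alpha> x + \<bar>?D {0<..<1} x\<bar>"
      unfolding mild_equation[of x] using cp(4) M mult_left_mono[of "stable_kernel \<alpha> 1 x" "Cp * tail_weight \<alpha> x" M] by (simp add: mult.assoc add_mono)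
    then have "ennreal (u 1 x) \<le> ennreal (M * Cp * tail_weight \<alpha> x + \<bar>?D {0<..<1} x\<bar>)"
      by (rule ennreal_leI)
    also have "\<dots> = ennreal (M * Cp * tail_weight \<alpha> x) + ennreal \<bar>?D {0<..<1} x\<bar>"
      using M cp by (intro ennreal_plus) auto
    also have "\<dots> \<le> ennreal (M * Cp * tail_weight \<alpha> x) + ennreal B * ?Pot x"
      by (intro add_left_mono D)
    finally show ?thesis .
  qed
  have lower: "ennreal (M * cp * tail_weight \<alpha> x) \<le> ennreal (u 1 x) + ennreal B * ?Pot x" for x
  proof -
    have "M * cp * tail_weight \<alpha> x \<le> M * stable_kernel \<alpha> 1 x"
      using cp(3) M mult_left_mono[of "cp * tail_weight \<alpha> x" "stable_kernel \<alpha> 1 x" M] by (simp add: mult.assoc)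
    also have "\<dots> \<le> u 1 x + \<bar>?D {0<..<1} x\<bar>" using mild_equation[of x] by linarith
    finally have "ennreal (M * cp * tail_weight \<alpha> x) \<le> ennreal (u 1 x + \<bar>?D {0<..<1} x\<bar>)"
      by (rule ennreal_leI)
    also have "\<dots> = ennreal (u 1 x) + ennreal \<bar>?D {0<..<1} x\<bar>"
      using u0 by (intro ennreal_plus) auto
    also have "\<dots> \<le> ennreal (u 1 x) + ennreal B * ?Pot x"
      by (intro add_left_mono D)
    finally show ?thesis .
  qed
  have MC: "0 \<le> M * Cp" and B0: "0 \<le> B" using M cp B by auto
  note prems = \<alpha> q_pos B0 MC u_measurable u0 u_integrable u_bounded upper
  obtain Cl \<theta> where late: "Cl \<ge> 0" "\<theta> > 0" "\<forall>\<eta> x. 0 < \<eta> \<longrightarrow> \<eta> \<le> 1 / 2 \<longrightarrow>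
    (\<integral>\<^sup>+y. duhamel_weight \<alpha> {1 - \<eta>..<1} x y * flux_one y \<partial>lborel) \<le> ennreal (Cl * \<eta> powr \<theta>)"
    by (rule duhamel_potential_late[OF prems])
  have cont: "continuous_on UNIV (u 1)"
  proof (rule uniform_limit_theorem)
    define \<eta> where "\<eta> n = 1 / real (n + 2)" for n :: nat
    have \<eta>: "0 < \<eta> n" "\<eta> n \<le> 1 / 2" for n by (auto simp: \<eta>_def field_simps)
    let ?f = "\<lambda>n x. M * stable_kernel \<alpha> 1 x + ?D {0<..<1 - \<eta> n} x"
    have "continuous_on UNIV (stable_profile \<alpha> :: real^'n \<Rightarrow> real)"
      by (intro continuous_at_imp_continuous_on ballI has_derivative_continuous[OF stable_profile_has_derivative[OF \<alpha>]])
    then have "continuous_on UNIV (\<lambda>x::real^'n. stable_kernel \<alpha> 1 x)"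
      unfolding kernel_at_one by (intro continuous_intros) auto
    then show "\<forall>\<^sub>F n in sequentially. continuous_on UNIV (?f n)"
      by (intro always_eventually allI continuous_intros early_duhamel_continuous \<eta>)
    have close: "dist (?f n x) (u 1 x) \<le> B * (Cl * \<eta> n powr \<theta>)" for n x
    proof -
      have un: "{0<..<1} = {0<..<1 - \<eta> n} \<union> {1 - \<eta> n..<1}" and dj: "{0<..<1 - \<eta> n} \<inter> {1 - \<eta> n..<1} = {}"
        and sub: "{0<..<1 - \<eta> n} \<subseteq> {0<..<1}" "{1 - \<eta> n..<1} \<subseteq> {0<..<1}"
        using \<eta>[of n] by auto
      have "?D {0<..<1} x = ?D {0<..<1 - \<eta> n} x + ?D {1 - \<eta> n..<1} x"
        unfolding un by (rule set_integral_Un[OF dj]) (auto intro!: integrand_restricted(1) sub)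
      then have "u 1 x - ?f n x = ?D {1 - \<eta> n..<1} x" using mild_equation[of x] by simp
      then have "dist (?f n x) (u 1 x) = \<bar>?D {1 - \<eta> n..<1} x\<bar>" by (simp add: dist_norm abs_minus_commute)
      moreover have "ennreal \<bar>?D {1 - \<eta> n..<1} x\<bar> \<le> ennreal B * ennreal (Cl * \<eta> n powr \<theta>)"
        by (rule order_trans[OF B(2)[rule_format, OF _ sub(2)] mult_left_mono[OF late(3)[rule_format, OF \<eta>]]]) auto
      then have "\<bar>?D {1 - \<eta> n..<1} x\<bar> \<le> B * (Cl * \<eta> n powr \<theta>)"
        using B late by (subst (asm) ennreal_mult[symmetric]) (auto simp: ennreal_le_iff)
      ultimately show ?thesis by simp
    qed
    have "(\<lambda>n. B * (Cl * \<eta> n powr \<theta>)) \<longlonglongrightarrow> 0"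
      unfolding \<eta>_def using late(2) by real_asymp
    show "uniform_limit UNIV ?f (u 1) sequentially"
    proof (rule uniform_limitI)
      fix e :: real assume "e > 0"
      then have "\<forall>\<^sub>F n in sequentially. B * (Cl * \<eta> n powr \<theta>) < e"
        using \<open>(\<lambda>n. B * (Cl * \<eta> n powr \<theta>)) \<longlonglongrightarrow> 0\<close> by (intro order_tendstoD) auto
      then show "\<forall>\<^sub>F n in sequentially. \<forall>x\<in>UNIV. dist (?f n x) (u 1 x) < e"
        by eventually_elim (auto intro: le_less_trans[OF close])
    qed
  qed simp
  obtain A where A: "A > 0" "\<forall>x. u 1 x \<le> A * tail_weight \<alpha> x"
    by (rule upper_tail_bound[OF prems])
  have Mc: "0 < M * cp" using M cp by simp
  have lower': "ennreal (M * cp * tail_weight \<alpha> x) \<le> ennreal (u 1 x) + ennreal B * duhamel_potential \<alpha> q (u 1) x" for x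
    using lower[of x] unfolding duhamel_potential_def[OF prems] .
  have pos: "0 < u 1 x" for x by (rule u_pos) simp
  obtain c where c: "c > 0" "\<forall>x. c * tail_weight \<alpha> x \<le> u 1 x"
    by (rule lower_tail_bound[OF prems Mc lower' cont pos])
  define C where "C = max (A / cp) (Cp / c)"
  have C: "C > 0" using A cp by (simp add: C_def less_max_iff_disj)
  show ?thesis
  proof (rule that[OF C], intro allI conjI)
    fix x :: "real ^ 'n"
    have k0: "stable_kernel \<alpha> 1 x > 0"
      using cp(1,3) tail_weight_pos[of \<alpha> x] by (meson mult_pos_pos less_le_trans)
    have "u 1 x \<le> A / cp * (cp * tail_weight \<alpha> x)" using A cp by simp
    also have "\<dots> \<le> A / cp * stable_kernel \<alpha> 1 x" using A cp by (intro mult_left_mono) auto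
    also have "\<dots> \<le> C * stable_kernel \<alpha> 1 x" using k0 by (intro mult_right_mono) (auto simp: C_def)
    finally show "u 1 x \<le> C * stable_kernel \<alpha> 1 x" .
    have "stable_kernel \<alpha> 1 x \<le> Cp / c * (c * tail_weight \<alpha> x)" using c cp by simp
    also have "\<dots> \<le> Cp / c * u 1 x" using c cp by (intro mult_left_mono) auto
    also have "\<dots> \<le> C * u 1 x" using u0 by (intro mult_right_mono) (auto simp: C_def)
    finally show "inverse C * stable_kernel \<alpha> 1 x \<le> u 1 x" using C by (simp add: field_simps)
  qed
qed

lemma solution_bounds:
  "\<exists>C>0. \<forall>t>0. \<forall>x. inverse C * stable_kernel \<alpha> t x \<le> u t x \<and> u t x \<le> C * stable_kernel \<alpha> t x"
proof -
  obtain C where C: "C > 0" "\<forall>x. inverse C * stable_kernel \<alpha> 1 x \<le> u 1 x \<and> u 1 x \<le> C * stable_kernel \<alpha> 1 x"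
    by (rule solution_bounds_at_one)
  show ?thesis
  proof (intro exI[of _ C] conjI C(1) allI impI)
    fix t :: real and x :: "real ^ 'n" assume t: "t > 0"
    let ?c = "t powr - (CARD('n) / \<alpha>)" and ?x = "t powr - (1 / \<alpha>) *\<^sub>R x"
    have k: "stable_kernel \<alpha> t x = ?c * stable_kernel \<alpha> 1 ?x"
      unfolding kernel_at_one stable_kernel_eq[OF \<alpha> t] by simp
    have "?c * (inverse C * stable_kernel \<alpha> 1 ?x) \<le> ?c * u 1 ?x" "?c * u 1 ?x \<le> ?c * (C * stable_kernel \<alpha> 1 ?x)"
      using C(2) by (auto intro!: mult_left_mono)
    then show "inverse C * stable_kernel \<alpha> t x \<le> u t x" "u t x \<le> C * stable_kernel \<alpha> t x"
      unfolding k u_scaling[OF t] by (simp_all add: mult_ac)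
  qed
qed

end

theorem theorem1p1:
  fixes \<alpha> q M :: real and b :: "real ^ 'n"
  assumes "1 < \<alpha>" and "\<alpha> < 2"
    and "q = (\<alpha> - 1) / real CARD('n)"
    and "0 < M"
    and unique: "\<And>v w t x. source_solution \<alpha> q b M v \<Longrightarrow> source_solution \<alpha> q b M w \<Longrightarrow> 0 < t
                   \<Longrightarrow> v t x = w t x"
  shows "\<exists>C>0. \<forall>u. source_solution \<alpha> q b M u \<longrightarrow>
           (\<forall>t>0. \<forall>x. inverse C * stable_kernel \<alpha> t x \<le> u t x \<and> u t x \<le> C * stable_kernel \<alpha> t x)"
proof (cases "\<exists>v. source_solution \<alpha> q b M v")
  case True
  then obtain v where v: "source_solution \<alpha> q b M v" by blast
  obtain C where C: "C > 0"
    "\<forall>t>0. \<forall>x. inverse C * stable_kernel \<alpha> t x \<le> v t x \<and> v t x \<le> C * stable_kernel \<alpha> t x"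
    using solution_bounds[OF assms(1-4) v] by blast
  show ?thesis
  proof (intro exI[of _ C] conjI C(1) allI impI)
    fix u t x assume u: "source_solution \<alpha> q b M u" and t: "(0::real) < t"
    have "u t x = v t x" by (rule unique[OF u v t])
    then show "inverse C * stable_kernel \<alpha> t x \<le> u t x" "u t x \<le> C * stable_kernel \<alpha> t x"
      using C(2) t by simp_all
  qed
next
  case False
  then show ?thesis by (intro exI[of _ 1]) auto
qed

end
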